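(* Suppose that the data $\{(y_t,x_{tT})\}_{t=1}^T$ are generated by the multiple-break model described in the context and that Assumptions A1--A5 (listed in the context) hold. Let $M>0$, and let $$\bar\Xi_M=\Big\{\mathcal K\in\Xi_\nu:\max_{1\le g\le G}\max_{1\le j\le m}|k_{gj}-k_{gj}^0|\le Mv_T^{-2}\Big\},$$ $$\bar\Theta_M=\Big\{\theta\in\Theta:\max_{1\le g\le G}\max_{1\le j\le m+1}\|\beta_{gj}-\beta_{gj}^0\|\le MT^{-1/2},\ \max_{1\le j\le m+1}\|\Sigma_j-\Sigma_j^0\|\le MT^{-1/2}\Big\}.$$ Then, as $T\to\infty$, $$\sup_{(\mathcal K,\theta)\in\bar\Xi_M\times\bar\Theta_M}\ell_{T,R}(\mathcal K,\theta)=\sup_{\mathcal K\in\bar\Xi_M}\ell_T(\mathcal K,\theta^0)+\sup_{\theta\in\bar\Theta_M}\ell_{T,R}(\mathcal K^0,\theta)+o_p(1),$$ where $\ell_T(\mathcal K,\theta)=\log L_T(\mathcal K,\theta)-\log L_T(\mathcal K^0,\theta^0)$ and $\ell_{T,R}(\mathcal K,\theta)=\ell_T(\mathcal K,\theta)+\gamma'R(\theta)$ with a Lagrange multiplier $\gamma$.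
   Context: Notation. $\|\cdot\|$ is the Euclidean norm for vectors and the induced operator norm for matrices; $\|X\|_r=(\sum_i\sum_jE|X_{ij}|^r)^{1/r}$ for a random matrix $X$; $\circ$ is the Hadamard (entrywise) product, $\otimes$ the Kronecker product; $[a]$ is the integer part; $e_l$ is the $l$-th unit vector; $I_n$ is the identity matrix. Regressors. $y_t$ is $n\times1$ and $x_{tT}=(z_t',\varphi(t/T)',T^{-1/2}w_t')'$ is $q\times 1$, with $z_t$ ($q_z\times1$) stationary-type regressors, $\varphi(t/T)=[(t/T),(t/T)^2,\dots,(t/T)^{q_\varphi}]'$, and $w_t=w_{t-1}+u_{wt}$ ($q_w\times 1$) integrated regressors, where $u_{wt}$ has mean zero and $w_0$ is $O_p(1)$ or a fixed finite constant; $q=q_z+q_\varphi+q_w$. $S$ is an $nq\times p$ selection matrix of full column rank and $X_{tT}=S'(x_{tT}\otimes I_n)$ ($p\times n$). Model. There are $m$ breaks ($m$ known). Basic parameters are $\theta=(\theta_1,\dots,\theta_{m+1})$, $\theta_j=(\beta_j,\Sigma_j)$, $\beta_j\in\mathbb R^p$, $\Sigma_j$ an $n\times n$ covariance matrix. The coefficient indices are partitioned into disjoint sets $\mathcal G_1,\dots,\mathcal G_G$ with $\bigcup_g\mathcal G_g=\{1,\dots,p\}$ ($\mathcal G_G$ may be empty), and $\beta_{gj}=\sum_{l\in\mathcal G_g}e_l\circ\beta_j$, so $\beta_j=\sum_g\beta_{gj}$. A collection of break dates is $\mathcal K=\{\mathcal K_1,\dots,\mathcal K_G\}$, $\mathcal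 K_g=(k_{g1},\dots,k_{gm})$, with $k_{g0}=0$, $k_{g,m+1}=T$. Given $\mathcal K$ and $\theta$: $\beta_{t,\mathcal K}=\sum_g\beta_{g,t,\mathcal K}$ with $\beta_{g,t,\mathcal K}=\beta_{gj}$ for $k_{g,j-1}+1\le t\le k_{gj}$; $\Sigma_{t,\mathcal K}=\Sigma_j$ for $k_{G,j-1}+1\le t\le k_{Gj}$ (the covariance matrix breaks with group $G$); $\theta_{t,\mathcal K}=(\beta_{t,\mathcal K},\Sigma_{t,\mathcal K})$. Superscript $0$ denotes true values. The data satisfy $y_t=X_{tT}'\beta^0_{t,\mathcal K^0}+u_t$, $E[u_t]=0$, $E[u_tu_t']=\Sigma^0_{t,\mathcal K^0}$. Restrictions on parameters are given by a function $R:\Theta\to\mathbb R^r$ through $R(\theta)=0$; the true value satisfies $R(\theta^0)=0$. True parameters may depend on $T$ as in A4. The $k_{gj}^0$ are genuine break dates: $\delta_{gj}\ne0$ for $g<G$ and $(\delta_{Gj},\Phi_j)\neq(0,0)$, with $\delta_{gj},\Phi_j$ from A4. Quasi-likelihood. $L_T(\mathcal K,\theta)=\prod_{t=1}^Tf(y_t|X_{tT},\theta_{t,\mathcal K})$ with $$f(y_t|X_{tT},\theta_{t,\mathcal K})=(2\pi)^{-n/2}|\Sigma_{t,\mathcal K}|^{-1/2}\exp\big(-\tfrac12\|\Sigma_{t,\mathcal K}^{-1/2}(y_t-X_{tT}'\beta_{t,\mathcal K})\|^2\big).$$ For a fixed trimming parameter $\nu>0$, $\Xi_\nu=\{\mathcal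 K:\min_{1\le g\le G}\min_{1\le j\le m+1}(k_{gj}-k_{g,j-1})\ge T\nu\}$ (no separation is required across groups). Assumptions. A1. There is $k_0>0$ such that for all $k>k_0$ the minimum eigenvalues of $k^{-1}\sum_{t=s}^{s+k}x_{tT}x_{tT}'$ are bounded away from zero for every $s=1,\dots,T-k$. A2. Let $\mathcal F_t=\sigma(\{z_s,u_{ws},\eta_s\}_{s\le t})$, $\eta_s=(\Sigma^0_{s,\mathcal K^0})^{-1/2}u_s$. (a) Let $\zeta_t=(z_t',u_{wt}')'$ and let $z_t$ include a constant term. $\{\zeta_t\otimes\eta_t,\mathcal F_t\}_{t\in\mathbb Z}$ is strongly mixing ($\alpha$-mixing) of size $-(4+\delta)/\delta$ for some $\delta\in(0,1/2)$, $E[z_t\otimes\eta_t]=0$ and $\sup_t\|\zeta_t\otimes\eta_t\|_{4+\delta}<\infty$. (b) $\{\eta_t\eta_t'-I_n\}_{t\in\mathbb Z}$ satisfies the same mixing and moment conditions. (c) $\{w_0\otimes\eta_t\}_{t\in\mathbb Z}$ is strongly mixing as in (a) with $\sup_t\|w_0\otimes\eta_t\|_{4+\delta}<\infty$, and $w_0$ is $\mathcal F_0$-measurable. A3. $\mathcal K^0\in\Xi_\nu$ and $k_{gj}^0=[T\lambda_{gj}^0]$ for all $(g,j)\in\{1,\dots,G\}\times\{1,\dots,m\}$, where $0<\lambda_{g1}^0<\dots<\lambda_{gm}^0<1$. A4. For every $g\in\{1,\dots,G\}$ and $j\in\{1,\dots,m\}$ there are a $p\times1$ vector $\delta_{gj}$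 and an $n\times n$ matrix $\Phi_j$, independent of $T$, with $\beta_{g,j+1}^0-\beta_{gj}^0=v_T\delta_{gj}$ and $\Sigma_{j+1}^0-\Sigma_j^0=v_T\Phi_j$, where $v_T>0$ is a scalar with $v_T\to0$ and $\sqrt Tv_T/\log T\to\infty$ as $T\to\infty$. Put $\delta_j=\sum_g\delta_{gj}$. A5. The true parameters belong to the compact space $\Theta=\{\theta:\max_{j\le m+1}\|\beta_j\|\le c_1,\ c_2\le\min_{j\le m+1}\lambda_{\min}(\Sigma_j),\ \max_{j\le m+1}\lambda_{\max}(\Sigma_j)\le c_3\}$ for constants $c_1<\infty$, $0<c_2\le c_3<\infty$, with $\lambda_{\min},\lambda_{\max}$ the extreme eigenvalues.
   Formalization: "Stationary-type" z_t is taken to mean uniformly bounded second moments, and "integrated" w_t that partial sums of u_wt have variance at most linear in their length; A2 alone does not give this, and with infinite-variance regressors the claim can fail. *)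

theory Defs
  imports "HOL-Probability.Probability" "HOL-Library.Landau_Symbols"
begin

section \<open>Matrices\<close>

text \<open>A column vector seen as a one-column matrix.\<close>

definition col :: "real^'a \<Rightarrow> real^1^'a" where
  "col v = (\<chi> i j. v $ i)"

definition outer :: "real^'a \<Rightarrow> real^'b \<Rightarrow> real^'b^'a" where
  "outer v w = (\<chi> i j. v $ i * w $ j)"

definition hadamard :: "real^'a \<Rightarrow> real^'a \<Rightarrow> real^'a" where
  "hadamard v w = (\<chi> i. v $ i * w $ i)"

text \<open>The Kronecker product \<open>x \<otimes> B\<close> of a column vector with a matrix; the rows of the product
  are indexed by pairs.\<close>

definition kron :: "real^'q \<Rightarrow> real^'b^'a \<Rightarrow> real^'b^('q \<times> 'a)" where
  "kron x B = (\<chi> r b. x $ fst r * B $ snd r $ b)"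

text \<open>The norm of the type \<^typ>\<open>real^'b^'a\<close> is the Frobenius norm; this is the operator norm
  induced by the Euclidean norms.\<close>

definition op_norm :: "real^'b^'a \<Rightarrow> real" where
  "op_norm A = onorm (\<lambda>v. A *v v)"

definition psd :: "real^'n^'n \<Rightarrow> bool" where
  "psd A \<longleftrightarrow> transpose A = A \<and> (\<forall>v. 0 \<le> v \<bullet> (A *v v))"

text \<open>The positive semidefinite square root, which exists uniquely for positive semidefinite
  arguments.\<close>

definition mat_sqrt :: "real^'n^'n \<Rightarrow> real^'n^'n" where
  "mat_sqrt A = (SOME B. psd B \<and> B ** B = A)"

definition inv_sqrt :: "real^'n^'n \<Rightarrow> real^'n^'n" where
  "inv_sqrt A = matrix_inv (mat_sqrt A)"

definition eigenvals :: "real^'n^'n \<Rightarrow> real set" where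
  "eigenvals A = {l. \<exists>v. v \<noteq> 0 \<and> A *v v = l *\<^sub>R v}"

text \<open>Only meant for symmetric matrices, whose set of eigenvalues is finite and nonempty.\<close>

definition lam_min :: "real^'n^'n \<Rightarrow> real" where
  "lam_min A = Min (eigenvals A)"

definition lam_max :: "real^'n^'n \<Rightarrow> real" where
  "lam_max A = Max (eigenvals A)"


section \<open>Moments, strong mixing, convergence in probability\<close>

definition Lr_norm :: "'a measure \<Rightarrow> real \<Rightarrow> ('a \<Rightarrow> real^'c^'b) \<Rightarrow> real" where
  "Lr_norm P r X = (\<Sum>i\<in>UNIV. \<Sum>j\<in>UNIV. (LINT \<omega>|P. \<bar>X \<omega> $ i $ j\<bar> powr r)) powr (1 / r)"

text \<open>\<open>sup\<^sub>t \<parallel>X\<^sub>t\<parallel>\<^sub>r < \<infinity>\<close>. Integrability is demanded because the Bochner integral of a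
  non-integrable function is 0.\<close>

definition Lr_bounded :: "'a measure \<Rightarrow> real \<Rightarrow> (int \<Rightarrow> 'a \<Rightarrow> real^'c^'b) \<Rightarrow> bool" where
  "Lr_bounded P r X \<longleftrightarrow>
     (\<forall>t i j. integrable P (\<lambda>\<omega>. \<bar>X t \<omega> $ i $ j\<bar> powr r)) \<and>
     (\<exists>C. \<forall>t. Lr_norm P r (X t) \<le> C)"

text \<open>The \<open>\<sigma>\<close>-field generated by the variables \<open>X s\<close>, \<open>s \<in> I\<close>.\<close>

definition gen_sigma ::
    "'a measure \<Rightarrow> (int \<Rightarrow> 'a \<Rightarrow> 'b::topological_space) \<Rightarrow> int set \<Rightarrow> 'a measure" where
  "gen_sigma P X I =
     sigma (space P) {X s -` B \<inter> space P | s B. s \<in> I \<and> B \<in> sets borel}"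

definition mixing_coeff ::
    "'a measure \<Rightarrow> (int \<Rightarrow> 'a \<Rightarrow> 'b::topological_space) \<Rightarrow> nat \<Rightarrow> real" where
  "mixing_coeff P X h =
     Sup {\<bar>measure P (A \<inter> B) - measure P A * measure P B\<bar> | t A B.
            A \<in> sets (gen_sigma P X {..t}) \<and> B \<in> sets (gen_sigma P X {t + int h..})}"

text \<open>Strong mixing of size \<open>-a\<close>: the coefficients are \<open>O(h\<^bsup>-b\<^esup>)\<close> for some \<open>b > a\<close>.\<close>

definition strongly_mixing ::
    "'a measure \<Rightarrow> real \<Rightarrow> (int \<Rightarrow> 'a \<Rightarrow> 'b::topological_space) \<Rightarrow> bool" where
  "strongly_mixing P a X \<longleftrightarrow>
     (\<exists>b>a. (\<lambda>h. mixing_coeff P X h) \<in> O(\<lambda>h. real h powr (- b)))"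

text \<open>\<open>o\<^sub>p(1)\<close>, formulated with outer probability, so that no measurability of the
  remainder (here a difference of suprema over uncountable sets) is presupposed.\<close>

definition o_p1 :: "'a measure \<Rightarrow> (nat \<Rightarrow> 'a \<Rightarrow> real) \<Rightarrow> bool" where
  "o_p1 P X \<longleftrightarrow>
     (\<forall>\<epsilon>>0. \<exists>A. (\<forall>T. A T \<in> sets P \<and> {\<omega> \<in> space P. \<epsilon> < \<bar>X T \<omega>\<bar>} \<subseteq> A T) \<and>
               (\<lambda>T. measure P (A T)) \<longlonglongrightarrow> 0)"


section \<open>Regressors\<close>

text \<open>The coordinates of \<open>x\<^sub>t\<^sub>T = (z\<^sub>t', \<phi>(t/T)', T\<^bsup>-1/2\<^esup> w\<^sub>t')'\<close> are classified by a map
  \<open>kind\<close>, so that the trend block and the integrated block may be empty. A block is represented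
  by the vector that vanishes on the coordinates outside the block, so stacking is addition.
  In particular \<open>\<zeta>\<^sub>t = (z\<^sub>t', u\<^sub>w\<^sub>t')'\<close> is \<open>z\<^sub>t + u\<^sub>w\<^sub>t\<close>.\<close>

datatype regressor = Stationary | Trend nat | Integrated

definition in_block :: "('q \<Rightarrow> regressor) \<Rightarrow> regressor \<Rightarrow> real^'q \<Rightarrow> bool" where
  "in_block kind b v \<longleftrightarrow> (\<forall>i. kind i \<noteq> b \<longrightarrow> v $ i = 0)"

text \<open>The powers \<open>1, \<dots>, q\<^sub>\<phi>\<close> occur once each, for some \<open>q\<^sub>\<phi> \<ge> 0\<close>.\<close>

definition trend_layout :: "('q \<Rightarrow> regressor) \<Rightarrow> bool" where
  "trend_layout kind \<longleftrightarrow> (\<exists>qf. bij_betw kind (kind -` range Trend) (Trend ` {1..qf}))"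

definition trend :: "('q \<Rightarrow> regressor) \<Rightarrow> real \<Rightarrow> real^'q" where
  "trend kind s = (\<chi> i. case kind i of Trend l \<Rightarrow> s ^ l | _ \<Rightarrow> 0)"

text \<open>Stationary-type: no stationarity is imposed, only uniformly bounded second moments.\<close>

definition stationary_type :: "'a measure \<Rightarrow> (int \<Rightarrow> 'a \<Rightarrow> real^'q) \<Rightarrow> bool" where
  "stationary_type P z \<longleftrightarrow>
     (\<exists>C. \<forall>t. integrable P (\<lambda>\<omega>. (norm (z t \<omega>))\<^sup>2) \<and> (LINT \<omega>|P. (norm (z t \<omega>))\<^sup>2) \<le> C)"

text \<open>The increments of an integrated (of order one) process are mean zero and short-memory: the
  variance of a partial sum grows at most linearly in its length, as for a covariance-stationary
  process with summable autocovariances.\<close>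

definition integrated_increments :: "'a measure \<Rightarrow> (int \<Rightarrow> 'a \<Rightarrow> real^'q) \<Rightarrow> bool" where
  "integrated_increments P u \<longleftrightarrow>
     (\<forall>t. has_bochner_integral P (u t) 0) \<and>
     (\<exists>C. \<forall>s t. s \<le> t \<longrightarrow>
        integrable P (\<lambda>\<omega>. (norm (\<Sum>i\<in>{s<..t}. u i \<omega>))\<^sup>2) \<and>
        (LINT \<omega>|P. (norm (\<Sum>i\<in>{s<..t}. u i \<omega>))\<^sup>2) \<le> C * of_int (t - s))"

definition selection_matrix :: "real^'p^'r \<Rightarrow> bool" where
  "selection_matrix S \<longleftrightarrow> (\<forall>i l. S $ i $ l \<in> {0, 1}) \<and> rank S = CARD('p)"

definition Xmat :: "real^'p^('q \<times> 'n) \<Rightarrow> real^'q \<Rightarrow> real^'n^'p" where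
  "Xmat S x = transpose S ** kron x (mat 1)"


section \<open>Break dates and parameters\<close>

text \<open>\<open>K g j\<close> is \<open>k\<^sub>g\<^sub>j\<close> and \<open>\<theta> j\<close> is \<open>(\<beta>\<^sub>j, \<Sigma>\<^sub>j)\<close>. Elements of \<open>date_space\<close> and
  \<open>param_space\<close> are extensional functions, i.e. genuine finite tuples.\<close>

type_synonym dates = "nat \<Rightarrow> nat \<Rightarrow> int"
type_synonym ('p, 'n) param = "nat \<Rightarrow> (real^'p) \<times> (real^'n^'n)"

definition date_space :: "nat \<Rightarrow> nat \<Rightarrow> nat \<Rightarrow> dates set" where
  "date_space G m T =
     {K \<in> {1..G} \<rightarrow>\<^sub>E ({0..m+1} \<rightarrow>\<^sub>E UNIV). \<forall>g\<in>{1..G}. K g 0 = 0 \<and> K g (m+1) = int T}"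

definition trimmed_dates :: "nat \<Rightarrow> nat \<Rightarrow> real \<Rightarrow> nat \<Rightarrow> dates set" where
  "trimmed_dates G m \<nu> T =
     {K \<in> date_space G m T.
        \<forall>g\<in>{1..G}. \<forall>j\<in>{1..m+1}. real_of_int (K g j - K g (j - 1)) \<ge> real T * \<nu>}"

definition param_space :: "nat \<Rightarrow> real \<Rightarrow> real \<Rightarrow> real \<Rightarrow> ('p::finite, 'n::finite) param set" where
  "param_space m c1 c2 c3 =
     {\<theta> \<in> {1..m+1} \<rightarrow>\<^sub>E UNIV. \<forall>j\<in>{1..m+1}.
        norm (fst (\<theta> j)) \<le> c1 \<and> transpose (snd (\<theta> j)) = snd (\<theta> j) \<and>
        c2 \<le> lam_min (snd (\<theta> j)) \<and> lam_max (snd (\<theta> j)) \<le> c3}"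

text \<open>\<open>grp g\<close> is the set of coefficient indices of group \<open>g\<close>; only the last group may be empty.\<close>

definition coeff_groups :: "nat \<Rightarrow> (nat \<Rightarrow> 'p set) \<Rightarrow> bool" where
  "coeff_groups G grp \<longleftrightarrow>
     1 \<le> G \<and> disjoint_family_on grp {1..G} \<and> (\<Union>g\<in>{1..G}. grp g) = UNIV \<and>
     (\<forall>g\<in>{1..<G}. grp g \<noteq> {})"

definition beta_grp :: "(nat \<Rightarrow> 'p set) \<Rightarrow> ('p::finite, 'n::finite) param \<Rightarrow> nat \<Rightarrow> nat \<Rightarrow> real^'p" where
  "beta_grp grp \<theta> g j = (\<Sum>l\<in>grp g. hadamard (axis l 1) (fst (\<theta> j)))"

definition regime :: "nat \<Rightarrow> dates \<Rightarrow> nat \<Rightarrow> int \<Rightarrow> nat" where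
  "regime m K g t = (THE j. j \<in> {1..m+1} \<and> K g (j - 1) + 1 \<le> t \<and> t \<le> K g j)"

definition beta_at ::
    "nat \<Rightarrow> nat \<Rightarrow> (nat \<Rightarrow> 'p set) \<Rightarrow> dates \<Rightarrow> ('p::finite, 'n::finite) param \<Rightarrow> int \<Rightarrow> real^'p" where
  "beta_at G m grp K \<theta> t = (\<Sum>g\<in>{1..G}. beta_grp grp \<theta> g (regime m K g t))"

definition Sigma_at :: "nat \<Rightarrow> nat \<Rightarrow> dates \<Rightarrow> ('p::finite, 'n::finite) param \<Rightarrow> int \<Rightarrow> real^'n^'n" where
  "Sigma_at G m K \<theta> t = snd (\<theta> (regime m K G t))"


section \<open>Quasi-likelihood\<close>

definition gauss_dens ::
    "real^'n \<Rightarrow> real^'n^'p \<Rightarrow> real^'p \<Rightarrow> real^'n^'n \<Rightarrow> real" where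
  "gauss_dens y X b V =
     (2 * pi) powr (- (real CARD('n) / 2)) * det V powr (- (1 / 2)) *
     exp (- (1 / 2) * (norm (inv_sqrt V *v (y - transpose X *v b)))\<^sup>2)"

text \<open>\<open>x t\<close> and \<open>y t\<close>, \<open>t = 1, \<dots>, T\<close>, are the observations.\<close>

definition quasi_lik ::
    "nat \<Rightarrow> nat \<Rightarrow> (nat \<Rightarrow> 'p set) \<Rightarrow> real^'p^('q \<times> 'n) \<Rightarrow> nat \<Rightarrow>
     (int \<Rightarrow> real^'q) \<Rightarrow> (int \<Rightarrow> real^'n) \<Rightarrow> dates \<Rightarrow> ('p::finite, 'n::finite) param \<Rightarrow> real" where
  "quasi_lik G m grp S T x y K \<theta> =
     (\<Prod>t\<in>{1..int T}. gauss_dens (y t) (Xmat S (x t)) (beta_at G m grp K \<theta> t) (Sigma_at G m K \<theta> t))"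

definition log_lik_ratio ::
    "nat \<Rightarrow> nat \<Rightarrow> (nat \<Rightarrow> 'p set) \<Rightarrow> real^'p^('q \<times> 'n) \<Rightarrow> nat \<Rightarrow>
     (int \<Rightarrow> real^'q) \<Rightarrow> (int \<Rightarrow> real^'n) \<Rightarrow> dates \<Rightarrow> ('p::finite, 'n::finite) param \<Rightarrow>
     dates \<Rightarrow> ('p::finite, 'n::finite) param \<Rightarrow> real" where
  "log_lik_ratio G m grp S T x y K0 \<theta>0 K \<theta> =
     ln (quasi_lik G m grp S T x y K \<theta>) - ln (quasi_lik G m grp S T x y K0 \<theta>0)"

text \<open>The log-likelihood ratio with the restriction \<open>R\<close> attached by the multiplier \<open>\<gamma>\<close>.\<close>

definition log_lik_ratio_R ::
    "nat \<Rightarrow> nat \<Rightarrow> (nat \<Rightarrow> 'p set) \<Rightarrow> real^'p^('q \<times> 'n) \<Rightarrow> nat \<Rightarrow>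
     (int \<Rightarrow> real^'q) \<Rightarrow> (int \<Rightarrow> real^'n) \<Rightarrow> dates \<Rightarrow> ('p::finite, 'n::finite) param \<Rightarrow>
     (('p::finite, 'n::finite) param \<Rightarrow> real^'r) \<Rightarrow> real^'r \<Rightarrow> dates \<Rightarrow> ('p::finite, 'n::finite) param \<Rightarrow> real" where
  "log_lik_ratio_R G m grp S T x y K0 \<theta>0 R \<gamma> K \<theta> =
     log_lik_ratio G m grp S T x y K0 \<theta>0 K \<theta> + \<gamma> \<bullet> R \<theta>"

definition dates_nbhd ::
    "nat \<Rightarrow> nat \<Rightarrow> real \<Rightarrow> nat \<Rightarrow> dates \<Rightarrow> real \<Rightarrow> real \<Rightarrow> dates set" where
  "dates_nbhd G m \<nu> T K0 v M =
     {K \<in> trimmed_dates G m \<nu> T.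
        \<forall>g\<in>{1..G}. \<forall>j\<in>{1..m}. \<bar>real_of_int (K g j - K0 g j)\<bar> \<le> M * v powr (- 2)}"

definition param_nbhd ::
    "nat \<Rightarrow> nat \<Rightarrow> (nat \<Rightarrow> 'p set) \<Rightarrow> real \<Rightarrow> real \<Rightarrow> real \<Rightarrow> nat \<Rightarrow>
     ('p::finite, 'n::finite) param \<Rightarrow> real \<Rightarrow> ('p::finite, 'n::finite) param set" where
  "param_nbhd G m grp c1 c2 c3 T \<theta>0 M =
     {\<theta> \<in> param_space m c1 c2 c3. \<forall>j\<in>{1..m+1}.
        (\<forall>g\<in>{1..G}. norm (beta_grp grp \<theta> g j - beta_grp grp \<theta>0 g j) \<le> M * real T powr (- (1 / 2))) \<and>
        op_norm (snd (\<theta> j) - snd (\<theta>0 j)) \<le> M * real T powr (- (1 / 2))}"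


section \<open>Assumptions on regressors and errors\<close>

text \<open>Bounded away from zero is meant in probability, the regressors being random, and at each
  sample size: with a constant and a trend among the regressors the minimum eigenvalue over a
  window of \<open>k\<close> observations is \<open>O((k/T)\<^sup>2)\<close>, so for fixed \<open>k\<close> no bound is uniform in \<open>T\<close>.\<close>

definition eigenvalue_condition ::
    "'a measure \<Rightarrow> (nat \<Rightarrow> int \<Rightarrow> 'a \<Rightarrow> real^'q) \<Rightarrow> bool" where
  "eigenvalue_condition P x \<longleftrightarrow>
     (\<exists>k0>0. \<forall>T. \<forall>\<epsilon>>0. \<exists>c>0. \<forall>k>k0. \<forall>s\<in>{1..int T - int k}.
        measure P {\<omega> \<in> space P.
          lam_min ((1 / real k) *\<^sub>R (\<Sum>t\<in>{s..s + int k}. outer (x T t \<omega>) (x T t \<omega>))) < c} \<le> \<epsilon>)"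

definition history ::
    "'a measure \<Rightarrow> (int \<Rightarrow> 'a \<Rightarrow> real^'q) \<Rightarrow> (int \<Rightarrow> 'a \<Rightarrow> real^'q) \<Rightarrow>
     (int \<Rightarrow> 'a \<Rightarrow> real^'n) \<Rightarrow> int \<Rightarrow> 'a measure" where
  "history P z uw \<eta> t = gen_sigma P (\<lambda>s \<omega>. (z s \<omega>, uw s \<omega>, \<eta> s \<omega>)) {..t}"

definition mixing_moments ::
    "'a measure \<Rightarrow> real \<Rightarrow> (int \<Rightarrow> 'a \<Rightarrow> real^'c^'b) \<Rightarrow> bool" where
  "mixing_moments P \<kappa> X \<longleftrightarrow>
     strongly_mixing P ((4 + \<kappa>) / \<kappa>) X \<and> Lr_bounded P (4 + \<kappa>) X"

text \<open>\<open>z t \<omega> + uw t \<omega>\<close> is \<open>\<zeta>\<^sub>t\<close>. The mixing coefficients are those of the \<open>\<sigma>\<close>-fields generated by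
  the sequence itself; the history enters through adaptedness.\<close>

definition mixing_condition ::
    "'a measure \<Rightarrow> ('q \<Rightarrow> regressor) \<Rightarrow> (int \<Rightarrow> 'a \<Rightarrow> real^'q) \<Rightarrow> (int \<Rightarrow> 'a \<Rightarrow> real^'q) \<Rightarrow>
     ('a \<Rightarrow> real^'q) \<Rightarrow> (int \<Rightarrow> 'a \<Rightarrow> real^'n) \<Rightarrow> bool" where
  "mixing_condition P kind z uw w0 \<eta> \<longleftrightarrow>
     (\<exists>i. kind i = Stationary \<and> (\<forall>t. \<forall>\<omega>\<in>space P. z t \<omega> $ i = 1)) \<and>
     (\<forall>t. has_bochner_integral P (\<lambda>\<omega>. kron (z t \<omega>) (col (\<eta> t \<omega>))) 0) \<and>
     (\<exists>\<kappa>. 0 < \<kappa> \<and> \<kappa> < 1 / 2 \<and>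
        (\<forall>t. (\<lambda>\<omega>. kron (z t \<omega> + uw t \<omega>) (col (\<eta> t \<omega>))) \<in> borel_measurable (history P z uw \<eta> t)) \<and>
        mixing_moments P \<kappa> (\<lambda>t \<omega>. kron (z t \<omega> + uw t \<omega>) (col (\<eta> t \<omega>))) \<and>
        mixing_moments P \<kappa> (\<lambda>t \<omega>. outer (\<eta> t \<omega>) (\<eta> t \<omega>) - mat 1) \<and>
        mixing_moments P \<kappa> (\<lambda>t \<omega>. kron (w0 \<omega>) (col (\<eta> t \<omega>)))) \<and>
     w0 \<in> borel_measurable (history P z uw \<eta> 0)"

end

theory Submission
  imports Defs
begin

text \<open>
  The cross difference \<open>\<ell>\<^sub>T(K, \<theta>) - \<ell>\<^sub>T(K, \<theta>\<^sup>0) - \<ell>\<^sub>T(K\<^sup>0, \<theta>)\<close> only involves dates \<open>t\<close> at which \<open>K\<close> and \<open>K\<^sup>0\<close> put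
  some group into different regimes, so dates within \<open>O(v\<^bsub>T\<^esub>\<^bsup>-2\<^esup>)\<close> of a true break. It is shown to be
  \<open>o\<^sub>p(1)\<close> uniformly in \<open>(K, \<theta>)\<close>; the claim on the suprema follows at once. Grouping the dates by
  the regimes under \<open>K\<close> and \<open>K\<^sup>0\<close> gives finitely many intervals on which all parameters are constant,
  and on such an interval a parameter change of order \<open>T\<^bsup>-1/2\<^esup>\<close> moves the log likelihood by at most
  a constant times \<open>T\<^bsup>-1/2\<^esup> \<parallel>\<Sum>(\<eta>\<^sub>t\<eta>\<^sub>t' - I)\<parallel> + T\<^bsup>-1/2\<^esup> \<parallel>\<Sum>x\<^sub>t\<^sub>T\<eta>\<^sub>t'\<parallel> + (v\<^sub>T T\<^bsup>-1/2\<^esup> + 1/T) \<Sum>(1 + \<parallel>x\<^sub>t\<^sub>T\<parallel>\<^sup>2)\<close>.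

  The first two terms require a maximal inequality over all subintervals of a window of length
  \<open>O(v\<^bsub>T\<^esub>\<^bsup>-2\<^esup>)\<close>. Strong mixing gives summable covariances, hence partial sums of variance linear in the
  length, and dyadic chaining bounds their maximum at the price of a factor \<open>log\<^sup>2 T\<close>; this is what
  \<open>\<surd>T v\<^sub>T / log T \<rightarrow> \<infinity>\<close> pays for. No mixing is available for the products of the integrated regressor
  with the errors: \<open>\<Sum>(w\<^sub>t - w\<^sub>a)\<eta>\<^sub>t\<close> is split at dyadic midpoints, and each cross product of an increment
  of \<open>w\<close> with a partial sum of \<open>\<eta>\<close> is bounded by the arithmetic-geometric mean inequality.
\<close>

section \<open>Spectral theorem\<close>

text \<open>Why the price is log^2 T: chaining is done in mean square. A window of 2^k dates has k +
  1 dyadic levels; the squared block sums of each level have total mean of order 2^k, and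
  Cauchy-Schwarz across the levels costs another factor k + 1. The squared maximum divided by T thus
  has mean of order k^2 2^k / T, and with 2^k of order v_T^(-2) and k of order log T this is (log T
  / (sqrt T v_T))^2. The iterated sums of w against the errors are of order k^2 2^k themselves, so
  one rate serves both. Uniformity comes from majorants: for each outcome, one random variable per
  window bounds the sums over all its subintervals. Apart from the terms in w_0, only the mean of
  the majorant is estimated. Suprema over dates and parameters never have to be measurable.
  Probability and likelihood are kept apart: for a fixed outcome the comparison of likelihoods is a
  deterministic inequality in terms of \<open>fluctuation\<close>, and only the size of
  \<open>fluctuation\<close> near a break is a probabilistic matter.\<close>

lemma symmetric_inner: 
  fixes A :: "real^'n^'n" assumes "transpose A = A"
  shows "v \<bullet> (A *v w) = (A *v v) \<bullet> w"
  by (metis assms dot_lmul_matrix vector_transpose_matrix)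

text \<open>The maximiser of the Rayleigh quotient over the unit sphere of \<open>V\<close> is an
  eigenvector: the quotient cannot grow to first order along the residual
  \<open>l *\<^sub>R u - A *v u\<close>, which lies in \<open>V\<close> by invariance.\<close>

lemma symmetric_has_eigenvector:
  fixes A :: "real^'n^'n"
  assumes sym: "transpose A = A" and V: "subspace V" and inv: "\<And>v. v \<in> V \<Longrightarrow> A *v v \<in> V"
    and ne: "\<exists>a\<in>V. a \<noteq> 0"
  obtains u l where "u \<in> V" "norm u = 1" "A *v u = l *\<^sub>R u" "\<And>v. v \<in> V \<Longrightarrow> v \<bullet> (A *v v) \<le> l * (norm v)\<^sup>2"
proof -
  let ?S = "V \<inter> sphere 0 1"
  obtain a where a: "a \<in> V" "a \<noteq> 0" using ne by blast
  have cV: "closed V" using V by (rule closed_subspace)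
  have "compact ?S" using cV by (simp add: closed_Int_compact)
  moreover have "(1 / norm a) *\<^sub>R a \<in> ?S"
    using a V by (simp add: subspace_scale)
  moreover have "continuous_on ?S (\<lambda>v. v \<bullet> (A *v v))"
    by (intro continuous_intros linear_continuous_on matrix_vector_mul_bounded_linear)
  ultimately obtain u where u: "u \<in> ?S" and mx: "\<And>v. v \<in> ?S \<Longrightarrow> v \<bullet> (A *v v) \<le> u \<bullet> (A *v u)"
    using continuous_attains_sup[of ?S "\<lambda>v. v \<bullet> (A *v v)"] by blast
  define l where "l = u \<bullet> (A *v u)"
  have nu: "norm u = 1" and uV: "u \<in> V" using u by auto
  have le: "v \<bullet> (A *v v) \<le> l * (norm v)\<^sup>2" if "v \<in> V" for v
  proof (cases "v = 0")
    case False
    have "(1 / norm v) *\<^sub>R v \<in> ?S" using False that V by (simp add: subspace_scale)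
    from mx[OF this] have "(v \<bullet> (A *v v)) / (norm v)\<^sup>2 \<le> l"
      by (simp add: l_def matrix_vector_mult_scaleR power2_eq_square)
    thus ?thesis using False by (simp add: divide_le_eq)
  qed simp
  define r where "r = l *\<^sub>R u - A *v u"
  have rV: "r \<in> V" unfolding r_def using V uV inv by (simp add: subspace_diff subspace_scale)
  \<comment> \<open>The form l |x|^2 - x . A x is nonnegative on \<open>V\<close>. Expanded at x = u
    + t r, its constant term vanishes and its linear part is 2 t (r . r), since r is the residual
    itself.\<close>
  have key: "0 \<le> 2 * t * (norm r)\<^sup>2 + t\<^sup>2 * (l * (norm r)\<^sup>2 - r \<bullet> (A *v r))" for t
  proof -
    have "u + t *\<^sub>R r \<in> V" using V uV rV by (simp add: subspace_add subspace_scale)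
    from le[OF this]
    have *: "0 \<le> l * ((u + t *\<^sub>R r) \<bullet> (u + t *\<^sub>R r)) - (u + t *\<^sub>R r) \<bullet> (A *v (u + t *\<^sub>R r))"
      by (simp add: power2_norm_eq_inner)
    have "u \<bullet> (A *v r) = (A *v u) \<bullet> r" using sym by (rule symmetric_inner)
    hence "l * ((u + t *\<^sub>R r) \<bullet> (u + t *\<^sub>R r)) - (u + t *\<^sub>R r) \<bullet> (A *v (u + t *\<^sub>R r))
      = (l * (u \<bullet> u) - u \<bullet> (A *v u)) + 2 * t * ((l *\<^sub>R u - A *v u) \<bullet> r) + t\<^sup>2 * (l * (r \<bullet> r) - r \<bullet> (A *v r))"
      by (simp add: matrix_vector_right_distrib matrix_vector_mult_scaleR inner_add_left inner_add_right
         inner_diff_left inner_commute[of r u] inner_commute[of r "A *v u"] algebra_simps power2_eq_square)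
    moreover have "l * (u \<bullet> u) - u \<bullet> (A *v u) = 0" using nu by (simp add: l_def norm_eq_1)
    ultimately show ?thesis using * by (simp add: r_def[symmetric] power2_norm_eq_inner)
  qed
  have "norm r = 0"
  proof (rule ccontr)
    assume "norm r \<noteq> 0"
    define N where "N = (norm r)\<^sup>2" 
    define b where "b = l * (norm r)\<^sup>2 - r \<bullet> (A *v r)"
    have N: "N > 0" using \<open>norm r \<noteq> 0\<close> by (simp add: N_def)
    have b: "b \<ge> 0" using le[OF rV] by (simp add: b_def)
    \<comment> \<open>Negative and small enough for the linear term to outweigh the quadratic one;
      the summand 1 keeps the quotient meaningful when b = 0.\<close>
    define t where "t = - N / (b + 1)"
    have "0 \<le> 2 * t * N + t\<^sup>2 * b" using key[of t] by (simp add: N_def b_def)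
    also have "\<dots> = (N\<^sup>2 / (b+1)\<^sup>2) * (b - 2 * (b + 1))"
    proof -
      define c where "c = b + 1"
      have "c \<noteq> 0" "b = c - 1" using b by (auto simp: c_def)
      thus ?thesis unfolding t_def by (simp add: field_simps power2_eq_square)
    qed
    also have "\<dots> < 0" using N b by (intro mult_pos_neg) auto
    finally show False by simp
  qed
  hence "A *v u = l *\<^sub>R u" by (simp add: r_def)
  thus ?thesis using that uV nu le by blast
qed

text \<open>A set of orthonormal eigenvectors of largest cardinality must span: otherwise the
  vectors orthogonal to it form a nonzero invariant subspace, and an eigenvector found there would
  enlarge the set.\<close>

lemma symmetric_eigenbasis:
  fixes A :: "real^'n^'n"
  assumes sym: "transpose A = A"
  obtains B where "finite B" "card B = CARD('n)" "pairwise orthogonal B" "\<And>b. b \<in> B \<Longrightarrow> norm b = 1"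
    "span B = UNIV" "\<And>b. b \<in> B \<Longrightarrow> \<exists>l. A *v b = l *\<^sub>R b"
proof -
  define good where "good B \<longleftrightarrow> pairwise orthogonal B \<and> (\<forall>b\<in>B. norm b = 1 \<and> (\<exists>l. A *v b = l *\<^sub>R b))"
    for B :: "(real^'n) set"
  have fin: "finite B \<and> independent B \<and> card B \<le> CARD('n)" if "good B" for B
  proof -
    have "independent B"
      using that by (intro pairwise_orthogonal_independent) (auto simp: good_def)
    thus ?thesis using independent_bound[of B] by simp
  qed
  have "good {}" by (simp add: good_def)
  have "\<exists>B. good B \<and> (\<forall>B'. good B' \<longrightarrow> card B' \<le> card B)"
    using ex_has_greatest_nat[of good "{}" card "CARD('n) + 1"] \<open>good {}\<close> fin
    by (meson less_add_one le_less_trans)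
  then obtain B where B: "good B" and mx: "\<And>B'. good B' \<Longrightarrow> card B' \<le> card B" by blast
  have "span B = UNIV"
  proof (rule ccontr)
    assume "span B \<noteq> UNIV"
    then obtain a where a: "a \<noteq> 0" "\<forall>x\<in>span B. a \<bullet> x = 0"
      using span_not_UNIV_orthogonal by blast
    define V where "V = {v. \<forall>b\<in>B. v \<bullet> b = 0}"
    have V: "subspace V" by (auto simp: V_def subspace_def inner_add_left)
    have "A *v v \<in> V" if "v \<in> V" for v
    proof -
      have "(A *v v) \<bullet> b = 0" if b: "b \<in> B" for b
      proof -
        obtain l where "A *v b = l *\<^sub>R b" using B b by (auto simp: good_def)
        hence "(A *v v) \<bullet> b = l * (v \<bullet> b)" using symmetric_inner[OF sym, of v b] by simp
        thus ?thesis using \<open>v \<in> V\<close> b by (simp add: V_def)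
      qed
      thus ?thesis by (simp add: V_def)
    qed
    moreover have "a \<in> V" using a by (auto simp: V_def span_base)
    ultimately obtain u l where u: "u \<in> V" "norm u = 1" "A *v u = l *\<^sub>R u"
      using symmetric_has_eigenvector[OF sym V] a by metis
    have "u \<notin> B"
    proof
      assume "u \<in> B"
      hence "u \<bullet> u = 0" using u by (simp add: V_def)
      thus False using u by simp
    qed
    have "good (insert u B)"
      using B u by (auto simp: good_def pairwise_insert V_def orthogonal_def inner_commute)
    from mx[OF this] show False using \<open>u \<notin> B\<close> fin[OF B] by simp
  qed
  moreover have "card B = CARD('n)"
  proof -
    have "dim (span B) = card B" using fin[OF B] by (simp add: dim_eq_card_independent)
    thus ?thesis using \<open>span B = UNIV\<close> by simp
  qed
  ultimately show ?thesis using that B fin[OF B] by (auto simp: good_def)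
qed

definition diag_mat :: "('n \<Rightarrow> real) \<Rightarrow> real^'n^'n" where
  "diag_mat d = (\<chi> i j. if i = j then d i else 0)"

lemma diag_mat_mult: "diag_mat d ** diag_mat e = diag_mat (\<lambda>i. d i * e i)"
  by (simp add: diag_mat_def matrix_matrix_mult_def vec_eq_iff if_distrib[of "\<lambda>x. x * _"] 
      if_distrib[of "\<lambda>x. _ * x"] cong: if_cong)

lemma transpose_diag_mat: "transpose (diag_mat d) = diag_mat d"
  by (auto simp: diag_mat_def transpose_def vec_eq_iff)

lemma det_diag_mat: "det (diag_mat d) = (\<Prod>i\<in>UNIV. d i)"
  by (subst det_diagonal) (auto simp: diag_mat_def)

lemma trace_diag_mat: "trace (diag_mat d) = (\<Sum>i\<in>UNIV. d i)"
  by (simp add: trace_def diag_mat_def)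

text \<open>Each diagonal entry comes with a unit eigenvector, so that its sign or size can be read
  off from the quadratic form at that vector.\<close>

lemma spectral_theorem:
  fixes A :: "real^'n^'n"
  assumes sym: "transpose A = A"
  obtains Q d where "orthogonal_matrix Q" "A = Q ** diag_mat d ** transpose Q"
    "\<And>i. \<exists>v. norm v = 1 \<and> A *v v = d i *\<^sub>R v"
proof -
  obtain B where B: "finite B" "card B = CARD('n)" "pairwise orthogonal B" "\<And>b. b \<in> B \<Longrightarrow> norm b = 1"
    "span B = UNIV" "\<And>b. b \<in> B \<Longrightarrow> \<exists>l. A *v b = l *\<^sub>R b"
    using symmetric_eigenbasis[OF sym] by metis
  obtain f where f: "bij_betw f (UNIV :: 'n set) B"
    using B finite_same_card_bij[of "UNIV :: 'n set" B] by auto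
  obtain e where e: "\<And>b. b \<in> B \<Longrightarrow> A *v b = e b *\<^sub>R b" using B(6) by metis
  define Q where "Q = (\<chi> i j. f j $ i)"
  define d where "d = e \<circ> f"
  have fB: "f j \<in> B" for j using f by (auto simp: bij_betw_def)
  have col: "column j Q = f j" for j by (simp add: column_def Q_def vec_eq_iff)
  have Q: "orthogonal_matrix Q"
    unfolding orthogonal_matrix_orthonormal_columns col
    using B(3,4) fB f unfolding bij_betw_def inj_on_def pairwise_def by (metis UNIV_I)
  have "(A ** Q) $ i $ j = (Q ** diag_mat d) $ i $ j" for i j
  proof -
    have "(A ** Q) $ i $ j = (A *v f j) $ i"
      by (simp add: matrix_matrix_mult_def matrix_vector_mult_def Q_def)
    also have "\<dots> = d j * f j $ i" using e[OF fB] by (simp add: d_def)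
    also have "\<dots> = (Q ** diag_mat d) $ i $ j"
      by (simp add: matrix_matrix_mult_def diag_mat_def Q_def if_distrib[of "\<lambda>x. _ * x"] cong: if_cong)
    finally show ?thesis .
  qed
  hence "A ** Q = Q ** diag_mat d" by (simp add: vec_eq_iff)
  hence "A ** (Q ** transpose Q) = Q ** diag_mat d ** transpose Q"
    by (simp add: matrix_mul_assoc)
  moreover have "Q ** transpose Q = mat 1" using Q by (simp add: orthogonal_matrix_def)
  ultimately have "A = Q ** diag_mat d ** transpose Q" by simp
  moreover have "\<exists>v. norm v = 1 \<and> A *v v = d i *\<^sub>R v" for i
    using B(4)[OF fB] e[OF fB] by (auto simp: d_def)
  ultimately show ?thesis using that Q by blast
qed

section \<open>Frobenius norm estimates for products and traces\<close>

lemma norm_transpose: "norm (transpose A) = norm (A :: real^'m^'n)"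
  by (simp add: norm_eq_sqrt_inner inner_vec_def transpose_def, subst sum.swap, simp)

lemma norm_vector_matrix_le: "norm (x v* A) \<le> norm x * norm (A :: real^'m^'n)"
proof -
  have "(norm (x v* A))\<^sup>2 = (\<Sum>j\<in>UNIV. (x \<bullet> column j A)\<^sup>2)"
    unfolding power2_norm_eq_inner
    by (simp add: inner_vec_def vector_matrix_mult_def column_def power2_eq_square mult.commute)
  also have "\<dots> \<le> (\<Sum>j\<in>UNIV. (norm x)\<^sup>2 * (norm (column j A))\<^sup>2)"
    by (intro sum_mono) (metis Cauchy_Schwarz_ineq power2_norm_eq_inner)
  also have "\<dots> = (norm x)\<^sup>2 * (norm (transpose A))\<^sup>2"
    by (simp add: sum_distrib_left power2_norm_eq_inner inner_vec_def column_def transpose_def)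
  finally have "(norm (x v* A))\<^sup>2 \<le> (norm x * norm A)\<^sup>2"
    by (simp add: norm_transpose power_mult_distrib)
  thus ?thesis by (rule power2_le_imp_le) simp
qed

lemma norm_matrix_vector_le: "norm (A *v x) \<le> norm (A :: real^'m^'n) * norm x"
  using norm_vector_matrix_le[of x "transpose A"] by (simp add: norm_transpose mult.commute)

lemma norm_matrix_matrix_le: "norm (A ** B) \<le> norm (A :: real^'m^'n) * norm (B :: real^'k^'m)"
proof -
  have row: "(A ** B) $ i = A $ i v* B" for i
    by (simp add: matrix_matrix_mult_def vector_matrix_mult_def vec_eq_iff mult.commute)
  have "norm (A ** B) = L2_set (\<lambda>i. norm (A $ i v* B)) UNIV" by (simp add: norm_vec_def row)
  also have "\<dots> \<le> L2_set (\<lambda>i. norm (A $ i) * norm B) UNIV"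
    by (intro L2_set_mono norm_vector_matrix_le) simp
  also have "\<dots> = norm A * norm B" by (simp add: norm_vec_def L2_set_left_distrib)
  finally show ?thesis .
qed

text \<open>Reads the trace as a Frobenius inner product, which makes Cauchy-Schwarz available for
  traces of products.\<close>

lemma trace_mult_eq_inner: "trace (A ** B) = transpose A \<bullet> (B :: real^'m^'n)"
  by (simp add: trace_def matrix_matrix_mult_def inner_vec_def transpose_def, subst sum.swap, simp)

lemma trace_mult_le: "\<bar>trace (A ** B)\<bar> \<le> norm A * norm (B :: real^'m^'n)"
  by (metis trace_mult_eq_inner Cauchy_Schwarz_ineq2 norm_transpose)

lemma outer_inner: "outer x y \<bullet> A = x \<bullet> (A *v y)"
  by (simp add: outer_def inner_vec_def matrix_vector_mult_def sum_distrib_left mult_ac)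

lemma mat_1_inner: "mat 1 \<bullet> A = trace (A :: real^'n^'n)"
  using trace_mult_eq_inner[of "mat 1" A] by simp

lemma quadratic_form_axis: "axis i 1 \<bullet> (A *v axis i 1) = (A :: real^'n^'n) $ i $ i"
  by (simp add: inner_axis' matrix_vector_mult_basis column_def)

section \<open>Eigenvalue bounds, square roots and inverses of covariance matrices\<close>

lemma diagonalized_quadratic_form:
  fixes d :: "'n::finite \<Rightarrow> real"
  assumes "A = Q ** diag_mat d ** transpose Q"
  shows "v \<bullet> (A *v v) = (\<Sum>i\<in>UNIV. d i * ((transpose Q *v v) $ i)\<^sup>2)"
proof -
  have "v \<bullet> (A *v v) = v \<bullet> (Q *v (diag_mat d *v (transpose Q *v v)))"
    by (simp add: assms matrix_vector_mul_assoc matrix_mul_assoc del: transpose_matrix_vector)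
  also have "\<dots> = (transpose Q *v v) \<bullet> (diag_mat d *v (transpose Q *v v))"
    by (metis dot_lmul_matrix transpose_matrix_vector)
  also have "\<dots> = (\<Sum>i\<in>UNIV. d i * ((transpose Q *v v) $ i)\<^sup>2)"
    by (simp add: inner_vec_def diag_mat_def matrix_vector_mult_def if_distrib[of "\<lambda>x. x * _"] 
        power2_eq_square mult_ac cong: if_cong)
  finally show ?thesis .
qed

lemma norm_orthogonal_matrix_vector:
  assumes "orthogonal_matrix (Q :: real^'n^'n)" shows "norm (Q *v v) = norm v"
proof -
  have "(Q *v v) \<bullet> (Q *v v) = v \<bullet> ((transpose Q ** Q) *v v)"
    by (metis dot_lmul_matrix inner_commute matrix_vector_mul_assoc transpose_matrix_vector)
  thus ?thesis using assms by (simp add: orthogonal_matrix_def norm_eq_sqrt_inner)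
qed

text \<open>Eigenvalue bounds as inequalities of quadratic forms, a I <= V <= b I. The later
  estimates use this form and not the eigenvalues behind \<open>lam_min\<close> and
  \<open>lam_max\<close>.\<close>

definition pd_within :: "real \<Rightarrow> real \<Rightarrow> real^'n^'n \<Rightarrow> bool" where
  "pd_within a b V \<longleftrightarrow> transpose V = V \<and> (\<forall>v. a * (norm v)\<^sup>2 \<le> v \<bullet> (V *v v) \<and> v \<bullet> (V *v v) \<le> b * (norm v)\<^sup>2)"

text \<open>\<open>lam_min\<close> and \<open>lam_max\<close> are a \<open>Min\<close> and a
  \<open>Max\<close>, informative only for a finite set. Finiteness comes from the diagonalization:
  an eigenvector has a nonzero coordinate i in the eigenbasis, and its eigenvalue must then equal
  \<open>d i\<close>.\<close>

lemma pd_within_lam: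
  fixes V :: "real^'n^'n"
  assumes sym: "transpose V = V" and a: "a \<le> lam_min V" and b: "lam_max V \<le> b"
  shows "pd_within a b V"
proof -
  obtain Q d where Q: "orthogonal_matrix Q" "V = Q ** diag_mat d ** transpose Q"
    and d: "\<And>i. \<exists>v. norm v = 1 \<and> V *v v = d i *\<^sub>R v"
    using spectral_theorem[OF sym] by metis
  have QT: "transpose Q ** Q = mat 1" using Q by (simp add: orthogonal_matrix_def)
  have "eigenvals V \<subseteq> range d"
  proof
    fix l assume "l \<in> eigenvals V"
    then obtain v where v: "v \<noteq> 0" "V *v v = l *\<^sub>R v" by (auto simp: eigenvals_def)
    define w where "w = transpose Q *v v"
    have "norm w = norm v" unfolding w_def using Q(1) by (intro norm_orthogonal_matrix_vector) simp
    hence "w \<noteq> 0" using v by auto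
    then obtain i where i: "w $ i \<noteq> 0" by (auto simp: vec_eq_iff)
    have "transpose Q *v (V *v v) = diag_mat d *v w"
      by (simp add: Q(2) w_def matrix_vector_mul_assoc matrix_mul_assoc QT del: transpose_matrix_vector)
    hence "diag_mat d *v w = l *\<^sub>R w" by (simp add: v w_def matrix_vector_mult_scaleR)
    hence "(diag_mat d *v w) $ i = l * w $ i" by simp
    hence "d i * w $ i = l * w $ i" 
      by (simp add: diag_mat_def matrix_vector_mult_def if_distrib[of "\<lambda>x. x * _"] cong: if_cong)
    thus "l \<in> range d" using i by auto
  qed
  hence fin: "finite (eigenvals V)" by (rule finite_subset) simp
  have "d i \<in> eigenvals V" for i
    using d[of i] by (auto simp: eigenvals_def) (metis norm_zero zero_neq_one)
  hence di: "a \<le> d i" "d i \<le> b" for i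
    using Min_le[OF fin, of "d i"] Max_ge[OF fin, of "d i"] a b by (auto simp: lam_min_def lam_max_def)
  have "a * (norm v)\<^sup>2 \<le> v \<bullet> (V *v v) \<and> v \<bullet> (V *v v) \<le> b * (norm v)\<^sup>2" for v
  proof -
    define w where "w = transpose Q *v v"
    have "norm w = norm v" unfolding w_def using Q(1) by (intro norm_orthogonal_matrix_vector) simp
    hence n: "(norm v)\<^sup>2 = (\<Sum>i\<in>UNIV. (w $ i)\<^sup>2)"
      by (metis (mono_tags, lifting) inner_vec_def power2_norm_eq_inner power2_eq_square inner_real_def sum.cong)
    have q: "v \<bullet> (V *v v) = (\<Sum>i\<in>UNIV. d i * (w $ i)\<^sup>2)"
      using diagonalized_quadratic_form[OF Q(2)] by (simp add: w_def)
    show ?thesis unfolding n q sum_distrib_left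
      by (intro conjI sum_mono mult_right_mono di) auto
  qed
  thus ?thesis using sym by (simp add: pd_within_def)
qed

text \<open>Gives content to the choice in \<open>mat_sqrt\<close>. The root is taken on the
  eigenvalues, which are nonnegative since each is the quadratic form at a unit eigenvector.\<close>

lemma psd_sqrt_exists:
  fixes A :: "real^'n^'n"
  assumes "psd A" shows "\<exists>B. psd B \<and> B ** B = A"
proof -
  have sym: "transpose A = A" using assms by (simp add: psd_def)
  obtain Q d where Q: "orthogonal_matrix Q" "A = Q ** diag_mat d ** transpose Q"
    and d: "\<And>i. \<exists>v. norm v = 1 \<and> A *v v = d i *\<^sub>R v"
    using spectral_theorem[OF sym] by metis
  have QT: "transpose Q ** Q = mat 1" using Q by (simp add: orthogonal_matrix_def)
  have d0: "d i \<ge> 0" for i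
  proof -
    obtain v where v: "norm v = 1" "A *v v = d i *\<^sub>R v" using d by blast
    have "0 \<le> v \<bullet> (A *v v)" using assms by (simp add: psd_def)
    thus ?thesis using v by (simp add: norm_eq_1)
  qed
  define B where "B = Q ** diag_mat (\<lambda>i. sqrt (d i)) ** transpose Q"
  have "B ** B = Q ** diag_mat (\<lambda>i. sqrt (d i)) ** (transpose Q ** Q) ** diag_mat (\<lambda>i. sqrt (d i)) ** transpose Q"
    by (simp add: B_def matrix_mul_assoc)
  also have "\<dots> = Q ** (diag_mat (\<lambda>i. sqrt (d i)) ** diag_mat (\<lambda>i. sqrt (d i))) ** transpose Q"
    by (simp add: QT matrix_mul_assoc)
  also have "\<dots> = A" by (simp add: Q(2) diag_mat_mult d0)
  finally have "B ** B = A" .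
  moreover have "transpose B = B"
    by (simp add: B_def matrix_transpose_mul transpose_diag_mat matrix_mul_assoc)
  moreover have "0 \<le> v \<bullet> (B *v v)" for v
    unfolding diagonalized_quadratic_form[OF B_def] by (intro sum_nonneg mult_nonneg_nonneg) (auto simp: d0)
  ultimately show ?thesis by (auto simp: psd_def)
qed

lemma mat_sqrt:
  assumes "psd A" shows "psd (mat_sqrt A)" "mat_sqrt A ** mat_sqrt A = A"
  using someI_ex[OF psd_sqrt_exists[OF assms]] by (auto simp: mat_sqrt_def)

text \<open>The inverse of a positive definite V, written in the form that expanding the squared
  norm in \<open>gauss_dens\<close> produces.\<close>

definition precision :: "real^'n^'n \<Rightarrow> real^'n^'n" where
  "precision V = inv_sqrt V ** inv_sqrt V"

text \<open>The norm bounds hold because the squared Frobenius norms of the two symmetric roots are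
  the traces of their squares, hence sums of \<open>CARD('n)\<close> quadratic forms at unit
  vectors, each at most b or 1 / a.\<close>

lemma pd_within_sqrt:
  fixes V :: "real^'n^'n"
  assumes V: "pd_within a b V" and a: "0 < a"
  shows "transpose (mat_sqrt V) = mat_sqrt V" "transpose (inv_sqrt V) = inv_sqrt V"
    "mat_sqrt V ** mat_sqrt V = V"
    "mat_sqrt V ** inv_sqrt V = mat 1" "inv_sqrt V ** mat_sqrt V = mat 1"
    "precision V ** V = mat 1" "V ** precision V = mat 1"
    "transpose (precision V) = precision V"
    "(norm (mat_sqrt V))\<^sup>2 \<le> real CARD('n) * b" "(norm (inv_sqrt V))\<^sup>2 \<le> real CARD('n) / a"
    "norm (precision V) \<le> real CARD('n) / a"
proof -
  let ?B = "mat_sqrt V" and ?C = "inv_sqrt V"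
  have sym: "transpose V = V" using V by (simp add: pd_within_def)
  have "0 \<le> v \<bullet> (V *v v)" for v
    using V a unfolding pd_within_def by (meson order_trans mult_nonneg_nonneg less_imp_le zero_le_power2)
  hence psd: "psd V" using sym by (simp add: psd_def)
  note B = mat_sqrt[OF psd]
  show Bs: "transpose ?B = ?B" using B by (simp add: psd_def)
  show BB: "?B ** ?B = V" using B by simp
  have "v = 0" if "?B *v v = 0" for v
  proof -
    have "V *v v = 0" using that BB by (metis matrix_vector_mul_assoc matrix_vector_mult_0_right)
    hence "a * (norm v)\<^sup>2 \<le> 0" using V unfolding pd_within_def by (metis inner_zero_right)
    thus ?thesis using a by (simp add: mult_le_0_iff)
  qed
  hence inv: "invertible ?B"
    by (metis invertible_left_inverse matrix_left_invertible_ker)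
  show BC: "?B ** ?C = mat 1" and CB: "?C ** ?B = mat 1"
    using someI_ex[OF inv[unfolded invertible_def]] unfolding inv_sqrt_def matrix_inv_def by auto
  have "transpose ?C ** ?B = mat 1"
    using BC by (metis Bs matrix_transpose_mul transpose_mat)
  hence "transpose ?C ** (?B ** ?C) = ?C" by (simp add: matrix_mul_assoc)
  thus Cs: "transpose ?C = ?C" by (simp add: BC)
  have "precision V ** V = ?C ** (?C ** ?B) ** ?B"
    unfolding precision_def by (metis BB matrix_mul_assoc)
  thus "precision V ** V = mat 1" by (simp add: CB)
  have "V ** precision V = ?B ** (?B ** ?C) ** ?C"
    unfolding precision_def by (metis BB matrix_mul_assoc)
  thus "V ** precision V = mat 1" by (simp add: BC)
  show "transpose (precision V) = precision V"
    by (simp add: precision_def matrix_transpose_mul Cs)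
  have "(norm ?B)\<^sup>2 = trace (transpose ?B ** ?B)"
    by (simp add: trace_mult_eq_inner power2_norm_eq_inner)
  also have "\<dots> = trace V" by (simp add: Bs BB)
  also have "\<dots> = (\<Sum>i\<in>UNIV. axis i 1 \<bullet> (V *v axis i 1))" by (simp add: trace_def quadratic_form_axis)
  also have "\<dots> \<le> (\<Sum>i\<in>(UNIV::'n set). b)"
  proof (intro sum_mono)
    fix i
    have "axis i 1 \<bullet> (V *v axis i 1) \<le> b * (norm (axis i (1::real)))\<^sup>2" using V unfolding pd_within_def by blast
    thus "axis i 1 \<bullet> (V *v axis i 1) \<le> b" by (simp add: norm_axis_1)
  qed
  finally show "(norm ?B)\<^sup>2 \<le> real CARD('n) * b" by simp
  \<comment> \<open>The lower bound on V is used at u = C w, where V u = B w and B u = w.\<close>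
  have Cle: "(norm (?C *v w))\<^sup>2 \<le> (norm w)\<^sup>2 / a" for w
  proof -
    let ?u = "?C *v w"
    have "a * (norm ?u)\<^sup>2 \<le> ?u \<bullet> (V *v ?u)" using V unfolding pd_within_def by blast
    also have "V *v ?u = ?B *v w"
      by (metis BB BC matrix_vector_mul_assoc matrix_vector_mul_lid)
    also have "?u \<bullet> (?B *v w) = (?B *v ?u) \<bullet> w" by (rule symmetric_inner[OF Bs])
    also have "\<dots> = (norm w)\<^sup>2" by (simp add: matrix_vector_mul_assoc BC power2_norm_eq_inner)
    finally show ?thesis using a by (simp add: field_simps)
  qed
  have "(norm ?C)\<^sup>2 = trace (transpose ?C ** ?C)"
    by (simp add: trace_mult_eq_inner power2_norm_eq_inner)
  also have "\<dots> = (\<Sum>i\<in>UNIV. axis i 1 \<bullet> ((?C ** ?C) *v axis i 1))" by (simp add: trace_def quadratic_form_axis Cs)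
  also have "\<dots> = (\<Sum>i\<in>UNIV. (norm (?C *v axis i 1))\<^sup>2)"
    using symmetric_inner[OF Cs] by (simp add: power2_norm_eq_inner flip: matrix_vector_mul_assoc)
  also have "\<dots> \<le> (\<Sum>i\<in>(UNIV::'n set). 1 / a)"
    by (intro sum_mono order_trans[OF Cle]) (simp add: norm_axis_1)
  finally show Cn: "(norm ?C)\<^sup>2 \<le> real CARD('n) / a" by simp
  have "norm (precision V) \<le> norm ?C * norm ?C" unfolding precision_def by (rule norm_matrix_matrix_le)
  thus "norm (precision V) \<le> real CARD('n) / a" using Cn by (simp add: power2_eq_square)
qed

section \<open>Log determinants and the Gaussian log density\<close>

lemma ln_det_le_trace:
  fixes A :: "real^'n^'n"
  assumes sym: "transpose A = A" and pos: "\<And>v. v \<noteq> 0 \<Longrightarrow> 0 < v \<bullet> (A *v v)"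
  shows "0 < det A" "ln (det A) \<le> trace A - real CARD('n)"
proof -
  obtain Q d where Q: "orthogonal_matrix Q" "A = Q ** diag_mat d ** transpose Q"
    and d: "\<And>i. \<exists>v. norm v = 1 \<and> A *v v = d i *\<^sub>R v"
    using spectral_theorem[OF sym] by metis
  have QT: "transpose Q ** Q = mat 1" using Q by (simp add: orthogonal_matrix_def)
  have d0: "d i > 0" for i
  proof -
    obtain v where v: "norm v = 1" "A *v v = d i *\<^sub>R v" using d by blast
    hence "0 < v \<bullet> (A *v v)" by (intro pos) auto
    thus ?thesis using v by (simp add: norm_eq_1)
  qed
  have "det Q * det Q = 1" using arg_cong[OF QT, of det] by (simp add: det_mul)
  hence det: "det A = (\<Prod>i\<in>UNIV. d i)" by (simp add: Q(2) det_mul det_diag_mat)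
  have tr: "trace A = (\<Sum>i\<in>UNIV. d i)"
    unfolding Q(2) by (subst trace_mul_sym) (simp add: matrix_mul_assoc QT trace_diag_mat)
  show "0 < det A" unfolding det by (intro prod_pos) (auto simp: d0)
  \<comment> \<open>The inequality ln d <= d - 1 is applied eigenvalue by eigenvalue.\<close>
  have "ln (det A) = (\<Sum>i\<in>UNIV. ln (d i))" unfolding det by (intro ln_prod) (auto simp: d0 less_imp_neq[OF d0, symmetric])
  also have "\<dots> \<le> (\<Sum>i\<in>UNIV. d i - 1)" by (intro sum_mono ln_le_minus_one d0)
  finally show "ln (det A) \<le> trace A - real CARD('n)" by (simp add: tr sum_subtractf)
qed

lemma pd_within_pos: "pd_within a b V \<Longrightarrow> 0 < a \<Longrightarrow> v \<noteq> 0 \<Longrightarrow> 0 < v \<bullet> (V *v v)"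
  unfolding pd_within_def by (smt (verit, best) zero_less_mult_iff zero_less_norm_iff zero_less_power)

lemma pd_within_det_pos: "pd_within a b V \<Longrightarrow> 0 < a \<Longrightarrow> 0 < det V"
  by (rule ln_det_le_trace(1)) (auto simp: pd_within_def intro: pd_within_pos[unfolded pd_within_def])

text \<open>Nonnegativity of the Kullback-Leibler divergence between centred Gaussian laws with
  covariances V and W. It comes from \<open>ln_det_le_trace\<close> for W^(-1/2) V W^(-1/2), whose
  determinant and trace are those of W^(-1) V.\<close>

lemma ln_det_gibbs:
  fixes V W :: "real^'n^'n"
  assumes V: "pd_within a b V" and W: "pd_within a b W" and a: "0 < a"
  shows "ln (det V) + real CARD('n) \<le> ln (det W) + trace (precision W ** V)"
proof -
  let ?C = "inv_sqrt W"
  note C = pd_within_sqrt[OF W a]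
  define A where "A = ?C ** V ** ?C"
  have "transpose A = A" using V 
    by (simp add: A_def matrix_transpose_mul C pd_within_def matrix_mul_assoc)
  moreover have "0 < v \<bullet> (A *v v)" if "v \<noteq> 0" for v
  proof -
    have "v \<bullet> (A *v v) = (?C *v v) \<bullet> (V *v (?C *v v))"
      using symmetric_inner[OF C(2), of v] by (simp add: A_def flip: matrix_vector_mul_assoc)
    moreover have "?C *v v \<noteq> 0"
      using that C(4) by (metis matrix_vector_mul_assoc matrix_vector_mul_lid matrix_vector_mult_0_right)
    ultimately show ?thesis using pd_within_pos[OF V a] by simp
  qed
  ultimately have le: "ln (det A) \<le> trace A - real CARD('n)" by (rule ln_det_le_trace)
  have tr: "trace A = trace (precision W ** V)"
    unfolding A_def precision_def by (subst trace_mul_sym) (simp add: matrix_mul_assoc)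
  have "(det ?C * det ?C) * det W = 1"
    using arg_cong[OF C(6), of det] by (simp add: precision_def det_mul)
  hence CC: "det ?C * det ?C = 1 / det W" using pd_within_det_pos[OF W a] by (simp add: field_simps)
  have "det A = (det ?C * det ?C) * det V" by (simp add: A_def det_mul)
  hence "det A = det V / det W" by (simp add: CC)
  hence "ln (det A) = ln (det V) - ln (det W)"
    using pd_within_det_pos[OF W a] pd_within_det_pos[OF V a] by (simp add: ln_div)
  thus ?thesis using le tr by simp
qed

lemma ln_gauss_dens:
  fixes V :: "real^'n^'n"
  assumes V: "pd_within a b V" and a: "0 < a"
  shows "0 < gauss_dens y X c V"
    "ln (gauss_dens y X c V) = - (real CARD('n) / 2) * ln (2 * pi) - ln (det V) / 2 
       - (y - transpose X *v c) \<bullet> (precision V *v (y - transpose X *v c)) / 2"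
proof -
  let ?e = "y - transpose X *v c"
  note C = pd_within_sqrt[OF V a]
  have det: "0 < det V" by (rule pd_within_det_pos[OF V a])
  thus "0 < gauss_dens y X c V" by (simp add: gauss_dens_def)
  have "(norm (inv_sqrt V *v ?e))\<^sup>2 = ?e \<bullet> (precision V *v ?e)"
    using symmetric_inner[OF C(2)] by (simp add: power2_norm_eq_inner precision_def flip: matrix_vector_mul_assoc)
  thus "ln (gauss_dens y X c V) = - (real CARD('n) / 2) * ln (2 * pi) - ln (det V) / 2 
       - ?e \<bullet> (precision V *v ?e) / 2"
    using det by (simp add: gauss_dens_def ln_mult ln_powr)
qed

section \<open>Perturbation of the Gaussian log likelihood\<close>

text \<open>The coefficient vector reshaped into a matrix D, so that X' a is the row x' D. The score
  in the coefficients then becomes a Frobenius inner product with the sum of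
  \<open>outer (x t) (\<eta> t)\<close>.\<close>

definition design :: "real^'p^('q \<times> 'n) \<Rightarrow> real^'p \<Rightarrow> real^'n^'q" where
  "design S a = (\<chi> k r. (S *v a) $ (k, r))"

lemma design_diff: "design S (a - b) = design S a - design S b"
  by (simp add: design_def vec_eq_iff matrix_vector_mult_diff_distrib)

lemma norm_design: "norm (design S a) = norm (S *v a)"
proof -
  have "design S a \<bullet> design S a = (S *v a) \<bullet> (S *v a)"
    by (simp add: design_def inner_vec_def sum.cartesian_product UNIV_Times_UNIV case_prod_beta)
  thus ?thesis by (simp add: norm_eq_sqrt_inner)
qed

lemma norm_design_le: "norm (design S a) \<le> norm S * norm a"
  by (simp add: norm_design norm_matrix_vector_le)

lemma Xmat_design:
  fixes S :: "real^'p::finite^('q::finite \<times> 'n::finite)"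
  shows "transpose (Xmat S x) *v a = x v* design S a"
proof -
  have "transpose (Xmat S x) *v a = transpose (kron x (mat 1)) *v (S *v a)"
    by (simp add: Xmat_def matrix_transpose_mul matrix_vector_mul_assoc del: transpose_matrix_vector)
  also have "\<dots> = x v* design S a"
  proof (simp add: vec_eq_iff, intro allI)
    fix r
    have "((S *v a) v* kron x (mat 1)) $ r = (\<Sum>k\<in>UNIV. \<Sum>r'\<in>UNIV. (S *v a) $ (k, r') * (x $ k * (if r' = r then 1 else 0)))"
      by (simp add: vector_matrix_mult_def kron_def mat_def sum.cartesian_product UNIV_Times_UNIV case_prod_beta mult_ac)
    also have "\<dots> = (x v* design S a) $ r"
      by (simp add: vector_matrix_mult_def design_def mult.commute if_distrib[of "\<lambda>x. _ * x"] cong: if_cong)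
    finally show "((S *v a) v* kron x (mat 1)) $ r = (x v* design S a) $ r" .
  qed
  finally show ?thesis .
qed

lemma norm_matrix_matrix_bound:
  assumes "norm (A :: real^'m^'n) \<le> a" "norm (B :: real^'k^'m) \<le> b"
  shows "norm (A ** B) \<le> a * b"
  using norm_matrix_matrix_le[of A B] mult_mono[OF assms order_trans[OF norm_ge_zero assms(1)] norm_ge_zero]
  by linarith

lemma inner_bound:
  assumes "norm (B :: 'a::real_inner) \<le> b" shows "\<bar>A \<bullet> B\<bar> \<le> norm A * b"
  using Cauchy_Schwarz_ineq2[of A B] mult_left_mono[OF assms norm_ge_zero[of A]] by linarith

text \<open>Here \<tau> is the size of a parameter change and v the distance between the point of
  evaluation and the truth. The first two terms majorize the scores of the covariance and of the
  coefficients; the third collects the effects of order v \<tau> and \<tau>^2, for which no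
  cancellation between dates is used.\<close>

definition fluctuation ::
    "real \<Rightarrow> real \<Rightarrow> (int \<Rightarrow> real^'q) \<Rightarrow> (int \<Rightarrow> real^'n) \<Rightarrow> int set \<Rightarrow> real" where
  "fluctuation \<tau> v x \<eta> I = \<tau> * norm (\<Sum>t\<in>I. outer (\<eta> t) (\<eta> t) - mat 1) + \<tau> * norm (\<Sum>t\<in>I. outer (x t) (\<eta> t))
     + (v * \<tau> + \<tau>\<^sup>2) * (\<Sum>t\<in>I. 1 + (norm (x t))\<^sup>2)"

lemma bilinear_form_le:
  assumes "norm q \<le> K" "norm r \<le> L" "norm (A :: real^'m^'n) \<le> C"
  shows "\<bar>q \<bullet> (A *v r)\<bar> \<le> K * (C * L)"
proof -
  have nn: "0 \<le> K" "0 \<le> L" "0 \<le> C" using assms norm_ge_zero order_trans by blast+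
  have "norm (A *v r) \<le> C * L"
    using norm_matrix_vector_le[of A r] mult_mono[OF assms(3) assms(2) nn(3) norm_ge_zero] by linarith
  hence "norm q * norm (A *v r) \<le> K * (C * L)" using assms(1) nn by (intro mult_mono) auto
  thus ?thesis using Cauchy_Schwarz_ineq2[of q "A *v r"] by linarith
qed

text \<open>The left vector, the right vector and the matrix are exchanged one at a time, which
  gives the three summands.\<close>

lemma quadratic_form_diff_le:
  fixes A A' :: "real^'n^'n"
  assumes q: "norm q \<le> K" and q': "norm (q' - q) \<le> K'"
    and A: "norm A' \<le> C" "norm (A' - A) \<le> C'"
  shows "\<bar>q' \<bullet> (A' *v q') - q \<bullet> (A *v q)\<bar> \<le> K' * (C * (K + K')) + K * (C * K') + K * (C' * K)"
proof -
  have n: "norm q' \<le> K + K'" using norm_triangle_ineq[of q "q' - q"] q q' by simp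
  have "q' \<bullet> (A' *v q') - q \<bullet> (A *v q) = (q' - q) \<bullet> (A' *v q') + q \<bullet> (A' *v (q' - q)) + q \<bullet> ((A' - A) *v q)"
    by (simp add: inner_diff_left inner_diff_right matrix_vector_mult_diff_distrib matrix_vector_mult_diff_rdistrib)
  thus ?thesis
    using bilinear_form_le[OF q' n A(1)] bilinear_form_le[OF q q' A(1)] bilinear_form_le[OF q q A(2)] by linarith
qed

lemma matrix_diff_ldistrib: "A ** (B - C) = A ** B - A ** (C :: real^'k^'m)"
  by (simp add: vec_eq_iff matrix_matrix_mult_def right_diff_distrib sum_subtractf)

lemma matrix_diff_rdistrib: "(A - B) ** C = A ** C - B ** (C :: real^'k^'m)"
  by (simp add: vec_eq_iff matrix_matrix_mult_def left_diff_distrib sum_subtractf)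

lemma vector_matrix_diff_distrib: "x v* (A - B) = x v* A - x v* (B :: real^'m^'n)"
  by (simp add: vec_eq_iff vector_matrix_mult_def right_diff_distrib sum_subtractf)

text \<open>The residual is B \<eta> - x' D, so the errors enter only through two aggregated
  matrices. Centring \<open>outer (\<eta> t) (\<eta> t)\<close> at the identity moves tr (A V0) next
  to ln det V, the pair to which Gibbs' inequality applies.\<close>

lemma gauss_loglik_sum:
  fixes S :: "real^'p::finite^('q::finite \<times> 'n::finite)" and x :: "int \<Rightarrow> real^'q" and \<eta> :: "int \<Rightarrow> real^'n"
    and b b0 :: "real^'p"
  assumes V: "pd_within c2 c3 V" and V0: "pd_within c2 c3 V0" and c2: "0 < c2"
    and y: "\<And>t. t \<in> I \<Longrightarrow> y t = transpose (Xmat S (x t)) *v b0 + mat_sqrt V0 *v \<eta> t"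
  defines "A \<equiv> precision V" and "B \<equiv> mat_sqrt V0" and "D \<equiv> design S (b - b0)"
  shows "(\<Sum>t\<in>I. ln (gauss_dens (y t) (Xmat S (x t)) b V)) = 
     (\<Sum>t\<in>I. outer (x t) (\<eta> t)) \<bullet> (D ** A ** B)
     - (\<Sum>t\<in>I. outer (\<eta> t) (\<eta> t) - mat 1) \<bullet> (B ** A ** B) / 2
     - real (card I) / 2 * (ln (det V) + trace (A ** V0))
     - (\<Sum>t\<in>I. (x t v* D) \<bullet> (A *v (x t v* D))) / 2
     - real (card I) * (real CARD('n) / 2 * ln (2 * pi))"
proof -
  note As = pd_within_sqrt(8)[OF V c2, folded A_def]
  note B = pd_within_sqrt(1)[OF V0 c2, folded B_def] pd_within_sqrt(3)[OF V0 c2, folded B_def]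
  have tr: "mat 1 \<bullet> (B ** A ** B) = trace (A ** V0)"
    unfolding mat_1_inner by (metis B(2) matrix_mul_assoc trace_mul_sym)
  have "ln (gauss_dens (y t) (Xmat S (x t)) b V) = 
     outer (x t) (\<eta> t) \<bullet> (D ** A ** B)
     - (outer (\<eta> t) (\<eta> t) - mat 1) \<bullet> (B ** A ** B) / 2
     - 1 / 2 * (ln (det V) + trace (A ** V0))
     - ((x t v* D) \<bullet> (A *v (x t v* D))) / 2
     - (real CARD('n) / 2 * ln (2 * pi))" if t: "t \<in> I" for t
  proof -
    define r s where "r = B *v \<eta> t" and "s = x t v* D"
    have e: "y t - transpose (Xmat S (x t)) *v b = r - s"
      unfolding r_def s_def D_def y[OF t] Xmat_design design_diff B_def vector_matrix_diff_distrib by simp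
    have "r \<bullet> (A *v r) = outer (\<eta> t) (\<eta> t) \<bullet> (B ** A ** B)"
      unfolding outer_inner r_def using symmetric_inner[OF B(1)] by (simp flip: matrix_vector_mul_assoc)
    moreover have "s \<bullet> (A *v r) = outer (x t) (\<eta> t) \<bullet> (D ** A ** B)"
      unfolding outer_inner r_def s_def by (simp add: dot_lmul_matrix flip: matrix_vector_mul_assoc)
    moreover have "r \<bullet> (A *v s) = s \<bullet> (A *v r)"
      using symmetric_inner[OF As, of r s] by (simp add: inner_commute)
    ultimately have q: "(r - s) \<bullet> (A *v (r - s)) = outer (\<eta> t) (\<eta> t) \<bullet> (B ** A ** B) 
        - 2 * (outer (x t) (\<eta> t) \<bullet> (D ** A ** B)) + s \<bullet> (A *v s)"
      by (simp add: matrix_vector_mult_diff_distrib inner_diff_left inner_diff_right)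
    show ?thesis unfolding ln_gauss_dens(2)[OF V c2] e A_def[symmetric] q
      by (simp add: inner_diff_left tr s_def field_simps)
  qed
  note * = sum.cong[OF refl this]
  \<comment> \<open>Sealing the centred products as \<open>E\<close> keeps
    \<open>sum_subtractf\<close> from splitting the identity matrix off again.\<close>
  define E where "E t = outer (\<eta> t) (\<eta> t) - mat 1" for t
  show ?thesis unfolding E_def[symmetric]
    by (simp only: * E_def[symmetric] sum_subtractf sum_constant sum_divide_distrib[symmetric]) 
       (simp only: inner_sum_left[symmetric] times_divide_eq_left times_divide_eq_right mult.assoc mult_1)
qed

text \<open>
  The determinant is never differentiated: applying Gibbs' inequality to \<open>(V, V')\<close> and to \<open>(V', V)\<close>
  pins the second-order remainder of \<open>ln det\<close> between 0 and \<open>- tr ((A' - A) (V' - V))\<close>.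
\<close>

lemma gauss_loglik_diff_le:
  fixes S :: "real^'p::finite^('q::finite \<times> 'n::finite)" and x :: "int \<Rightarrow> real^'q" and \<eta> :: "int \<Rightarrow> real^'n"
  assumes V: "pd_within c2 c3 V" and V': "pd_within c2 c3 V'" and V0: "pd_within c2 c3 V0" and c2: "0 < c2"
    and y: "\<And>t. t \<in> I \<Longrightarrow> y t = transpose (Xmat S (x t)) *v b0 + mat_sqrt V0 *v \<eta> t"
    and C: "1 \<le> C" "real CARD('n) / c2 \<le> C" "real CARD('n) * c3 \<le> C\<^sup>2"
    and \<tau>: "0 \<le> \<tau>" and v: "0 \<le> v" "v \<le> 1"
    and dV: "norm (V' - V) \<le> C * \<tau>" "norm (V - V0) \<le> C * v"
    and db: "norm S * norm (b' - b) \<le> C * \<tau>" "norm S * norm (b - b0) \<le> C * v"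
  shows "\<bar>(\<Sum>t\<in>I. ln (gauss_dens (y t) (Xmat S (x t)) b' V')) - (\<Sum>t\<in>I. ln (gauss_dens (y t) (Xmat S (x t)) b V))\<bar>
    \<le> 2 * C ^ 5 * fluctuation \<tau> v x \<eta> I"
proof -
  define A A' B where "A = precision V" and "A' = precision V'" and "B = mat_sqrt V0"
  define D D' where "D = design S (b - b0)" and "D' = design S (b' - b0)"
  define E where "E = (\<Sum>t\<in>I. outer (\<eta> t) (\<eta> t) - mat 1)"
  define H where "H = (\<Sum>t\<in>I. outer (x t) (\<eta> t))"
  note A = pd_within_sqrt(6,7,8)[OF V c2, folded A_def] and A' = pd_within_sqrt(6,7,8)[OF V' c2, folded A'_def]
  have C0: "0 \<le> C" using C by simp
  have nA: "norm A \<le> C" "norm A' \<le> C"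
    using pd_within_sqrt(11)[OF V c2] pd_within_sqrt(11)[OF V' c2] C by (auto simp: A_def A'_def)
  have nB: "norm B \<le> C"
    unfolding B_def using order_trans[OF pd_within_sqrt(9)[OF V0 c2] C(3)] C0 by (rule power2_le_imp_le)
  \<comment> \<open>Resolvent identity: the precision changes by A' (V - V') A, hence by the order
    of V' - V.\<close>
  have "A' ** (V - V') ** A = A' ** (V ** A) - (A' ** V') ** A"
    by (simp add: matrix_diff_ldistrib matrix_diff_rdistrib matrix_mul_assoc)
  hence dA: "A' - A = A' ** (V - V') ** A" using A A' by simp
  have "norm (V - V') \<le> C * \<tau>" using dV(1) by (simp add: norm_minus_commute)
  hence "norm (A' - A) \<le> (C * (C * \<tau>)) * C"
    unfolding dA by (intro norm_matrix_matrix_bound nA)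
  hence dA: "norm (A' - A) \<le> C ^ 3 * \<tau>" by (simp add: power3_eq_cube mult_ac)
  have nD: "norm D \<le> C * v" unfolding D_def by (rule order_trans[OF norm_design_le db(2)])
  have "D' - D = design S (b' - b)" by (simp add: D_def D'_def flip: design_diff)
  hence dD: "norm (D' - D) \<le> C * \<tau>" using order_trans[OF norm_design_le db(1)] by simp

  have pw: "C ^ 3 \<le> C ^ 5" "C ^ 4 \<le> C ^ 5" using C by (auto intro: power_increasing)

  define X where "X = (ln (det V') + trace (A' ** V0)) - (ln (det V) + trace (A ** V0))"
  have tr: "trace (A ** V) = real CARD('n)" "trace (A' ** V') = real CARD('n)"
    using A A' by (simp_all add: trace_I)
  \<comment> \<open>Twice a Gaussian divergence between the covariances V and V', hence of second
    order in V' - V.\<close>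
  define g where "g = ln (det V') + trace (A' ** V) - ln (det V) - real CARD('n)"
  have "0 \<le> g" using ln_det_gibbs[OF V V' c2] by (simp add: g_def A'_def)
  moreover have "g \<le> - trace ((A' - A) ** (V' - V))"
    using ln_det_gibbs[OF V' V c2] tr 
    by (simp add: g_def A_def A'_def matrix_diff_ldistrib matrix_diff_rdistrib trace_sub)
  ultimately have "\<bar>g\<bar> \<le> norm (A' - A) * norm (V' - V)"
    using trace_mult_le[of "A' - A" "V' - V"] by linarith
  also have "\<dots> \<le> (C ^ 3 * \<tau>) * (C * \<tau>)"
    by (rule mult_mono[OF dA dV(1) order_trans[OF norm_ge_zero dA] norm_ge_zero])
  finally have g: "\<bar>g\<bar> \<le> C ^ 4 * \<tau>\<^sup>2" by (simp add: power2_eq_square power4_eq_xxxx power3_eq_cube mult_ac)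
  \<comment> \<open>The rest of X pairs the change of the precision with the distance V0 - V from
    the truth; this is one origin of the product v \<tau>.\<close>
  have "X = g + trace ((A' - A) ** (V0 - V))"
    using tr by (simp add: X_def g_def matrix_diff_ldistrib matrix_diff_rdistrib trace_sub)
  moreover have dV0: "norm (V0 - V) \<le> C * v" using dV(2) by (simp add: norm_minus_commute)
  have "\<bar>trace ((A' - A) ** (V0 - V))\<bar> \<le> (C ^ 3 * \<tau>) * (C * v)"
    by (rule order_trans[OF trace_mult_le 
       mult_mono[OF dA dV0 order_trans[OF norm_ge_zero dA] norm_ge_zero]])
  hence "\<bar>trace ((A' - A) ** (V0 - V))\<bar> \<le> C ^ 4 * (v * \<tau>)"
    by (simp add: power4_eq_xxxx power3_eq_cube mult_ac)
  ultimately have "\<bar>X\<bar> \<le> C ^ 4 * (v * \<tau> + \<tau>\<^sup>2)" using g by (simp add: distrib_left)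
  also have "\<dots> \<le> C ^ 5 * (v * \<tau> + \<tau>\<^sup>2)" using pw \<tau> v by (intro mult_right_mono) auto
  finally have X: "\<bar>X\<bar> \<le> C ^ 5 * (v * \<tau> + \<tau>\<^sup>2)" .

  have "\<bar>E \<bullet> (B ** (A' - A) ** B)\<bar> \<le> norm E * ((C * (C ^ 3 * \<tau>)) * C)"
    by (intro inner_bound norm_matrix_matrix_bound nB dA)
  hence E: "\<bar>E \<bullet> (B ** (A' - A) ** B)\<bar> \<le> C ^ 5 * (\<tau> * norm E)" 
    by (simp add: eval_nat_numeral mult_ac)

  have "norm (D' ** A' - D ** A) \<le> 2 * C ^ 4 * \<tau>"
  proof -
    have "D' ** A' - D ** A = (D' - D) ** A' + D ** (A' - A)" by (simp add: matrix_diff_ldistrib matrix_diff_rdistrib)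
    hence "norm (D' ** A' - D ** A) \<le> (C * \<tau>) * C + (C * v) * (C ^ 3 * \<tau>)"
      using norm_triangle_ineq[of "(D' - D) ** A'" "D ** (A' - A)"]
        norm_matrix_matrix_bound[OF dD nA(2)] norm_matrix_matrix_bound[OF nD dA] by simp
    also have "\<dots> = C\<^sup>2 * \<tau> + C ^ 4 * \<tau> * v" by (simp add: eval_nat_numeral mult_ac)
    also have "\<dots> \<le> C ^ 4 * \<tau> + C ^ 4 * \<tau> * 1"
      using v \<tau> C C0 by (intro add_mono mult_right_mono mult_left_mono) (auto intro: power_increasing)
    finally show ?thesis by (simp add: mult_ac)
  qed
  hence "\<bar>H \<bullet> ((D' ** A' - D ** A) ** B)\<bar> \<le> norm H * ((2 * C ^ 4 * \<tau>) * C)"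
    by (intro inner_bound norm_matrix_matrix_bound nB)
  hence H: "\<bar>H \<bullet> ((D' ** A' - D ** A) ** B)\<bar> \<le> 2 * C ^ 5 * (\<tau> * norm H)"
    by (simp add: eval_nat_numeral mult_ac)

  define Q where "Q = (\<Sum>t\<in>I. (x t v* D') \<bullet> (A' *v (x t v* D'))) - (\<Sum>t\<in>I. (x t v* D) \<bullet> (A *v (x t v* D)))"
  have "\<bar>(x t v* D') \<bullet> (A' *v (x t v* D')) - (x t v* D) \<bullet> (A *v (x t v* D))\<bar> \<le> 3 * C ^ 5 * (v * \<tau> + \<tau>\<^sup>2) * (norm (x t))\<^sup>2" for t
  proof -
    have *: "norm (x t v* D) \<le> norm (x t) * (C * v)"
      by (rule order_trans[OF norm_vector_matrix_le]) (use nD in \<open>auto intro: mult_left_mono\<close>)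
    have "x t v* D' - x t v* D = x t v* (D' - D)" 
      by (simp add: vector_matrix_diff_distrib)
    hence **: "norm (x t v* D' - x t v* D) \<le> norm (x t) * (C * \<tau>)"
      using order_trans[OF norm_vector_matrix_le mult_left_mono[OF dD]] by simp
    have "\<bar>(x t v* D') \<bullet> (A' *v (x t v* D')) - (x t v* D) \<bullet> (A *v (x t v* D))\<bar> \<le>
      norm (x t) * (C * \<tau>) * (C * (norm (x t) * (C * v) + norm (x t) * (C * \<tau>))) +
      norm (x t) * (C * v) * (C * (norm (x t) * (C * \<tau>))) + norm (x t) * (C * v) * (C ^ 3 * \<tau> * (norm (x t) * (C * v)))"
      by (rule quadratic_form_diff_le[OF * ** nA(2) dA])
    also have "\<dots> = (norm (x t))\<^sup>2 * (2 * C ^ 3 * (v * \<tau>) + C ^ 3 * \<tau>\<^sup>2 + C ^ 5 * (v * \<tau>) * v)"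
      by (simp add: eval_nat_numeral algebra_simps)
    \<comment> \<open>C^3 is raised to C^5 and a factor v <= 1 is dropped, so that one constant
      serves both orders.\<close>
    also have "\<dots> \<le> (norm (x t))\<^sup>2 * (2 * C ^ 5 * (v * \<tau>) + C ^ 5 * \<tau>\<^sup>2 + C ^ 5 * (v * \<tau>) * 1)"
      using v \<tau> C0 pw by (intro mult_left_mono add_mono mult_right_mono) auto
    also have "\<dots> \<le> (norm (x t))\<^sup>2 * (3 * C ^ 5 * (v * \<tau> + \<tau>\<^sup>2))"
      using C0 by (intro mult_left_mono) (auto simp: algebra_simps)
    finally show ?thesis by (simp add: mult_ac)
  qed
  hence "\<bar>Q\<bar> \<le> (\<Sum>t\<in>I. 3 * C ^ 5 * (v * \<tau> + \<tau>\<^sup>2) * (norm (x t))\<^sup>2)"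
    unfolding Q_def sum_subtractf[symmetric] by (intro order_trans[OF sum_abs] sum_mono) auto
  hence Q: "\<bar>Q\<bar> \<le> 3 * C ^ 5 * ((v * \<tau> + \<tau>\<^sup>2) * (\<Sum>t\<in>I. (norm (x t))\<^sup>2))"
    by (simp add: sum_distrib_left mult_ac)

  \<comment> \<open>The bounds contribute C^5 with coefficient 2 for H, 1/2 for E and for X, and 3/2
    for Q; all are covered by 2.\<close>
  have "(\<Sum>t\<in>I. ln (gauss_dens (y t) (Xmat S (x t)) b' V')) - (\<Sum>t\<in>I. ln (gauss_dens (y t) (Xmat S (x t)) b V))
    = H \<bullet> ((D' ** A' - D ** A) ** B) - E \<bullet> (B ** (A' - A) ** B) / 2 - real (card I) / 2 * X - Q / 2"
    using gauss_loglik_sum[OF V V0 c2, of I y S x b0 \<eta> b] gauss_loglik_sum[OF V' V0 c2, of I y S x b0 \<eta> b'] y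
    unfolding X_def Q_def
    by (simp add: A_def A'_def B_def D_def D'_def E_def H_def matrix_diff_ldistrib matrix_diff_rdistrib inner_diff_right
        diff_divide_distrib right_diff_distrib algebra_simps)
  moreover have "real (card I) / 2 * \<bar>X\<bar> \<le> real (card I) / 2 * (C ^ 5 * (v * \<tau> + \<tau>\<^sup>2))"
    using X by (intro mult_left_mono) auto
  hence "\<bar>real (card I) / 2 * X\<bar> \<le> C ^ 5 * ((v * \<tau> + \<tau>\<^sup>2) * real (card I)) / 2" by (simp add: abs_mult mult_ac)
  moreover define U1 U2 where "U1 = C ^ 5 * ((v * \<tau> + \<tau>\<^sup>2) * real (card I))" 
    and "U2 = C ^ 5 * ((v * \<tau> + \<tau>\<^sup>2) * (\<Sum>t\<in>I. (norm (x t))\<^sup>2))"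
  moreover have "U1 \<ge> 0" "U2 \<ge> 0" "C ^ 5 * (\<tau> * norm E) \<ge> 0" using C0 v \<tau> by (auto simp: U1_def U2_def sum_nonneg)
  moreover have "2 * C ^ 5 * (\<tau> * norm E + \<tau> * norm H + (v * \<tau> + \<tau>\<^sup>2) * (\<Sum>t\<in>I. 1 + (norm (x t))\<^sup>2))
    = 2 * (C ^ 5 * (\<tau> * norm E)) + 2 * C ^ 5 * (\<tau> * norm H) + 2 * U1 + 2 * U2"
    by (simp add: U1_def U2_def sum.distrib algebra_simps)
  ultimately show ?thesis using E H Q unfolding fluctuation_def E_def[symmetric] H_def[symmetric] by linarith
qed

section \<open>Dyadic chaining\<close>

definition psum :: "(int \<Rightarrow> real) \<Rightarrow> int \<Rightarrow> nat \<Rightarrow> real" where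
  "psum f a l = (\<Sum>i<l. f (a + int i))"

text \<open>
  Sums of squared increments over all dyadic blocks of \<open>{a..<a + 2 ^ k}\<close>. The weights \<open>1\<close> and \<open>1 / (k + 1)\<close> in
  \<open>(s + t)\<^sup>2 \<le> (k + 2) (s\<^sup>2 + t\<^sup>2 / (k + 1))\<close> make the constants of the successive levels telescope.
\<close>

primrec dyadic_sq :: "(int \<Rightarrow> real) \<Rightarrow> nat \<Rightarrow> int \<Rightarrow> real" where
  "dyadic_sq f 0 a = (f a)\<^sup>2"
| "dyadic_sq f (Suc k) a = dyadic_sq f k a + dyadic_sq f k (a + 2 ^ k) + (psum f a (2 ^ k))\<^sup>2"

text \<open>A discrete iterated integral: \<open>psum g a i\<close> stops before the current date.
  With g the shifted increments of w, this factor is w_t - w_a.\<close>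

definition iter_sum :: "(int \<Rightarrow> real) \<Rightarrow> (int \<Rightarrow> real) \<Rightarrow> int \<Rightarrow> nat \<Rightarrow> real" where
  "iter_sum g f a l = (\<Sum>i<l. psum g a i * f (a + int i))"

text \<open>Majorant for \<open>iter_sum\<close>. The last summand bounds the cross product of the
  left block sum of g and a right partial sum of f; the weight k + 1 makes its two squares of equal
  order in mean, since \<open>dyadic_sq\<close> on a block of length 2^k has mean of order (k + 1)
  2^k.\<close>

primrec dyadic_iter :: "(int \<Rightarrow> real) \<Rightarrow> (int \<Rightarrow> real) \<Rightarrow> nat \<Rightarrow> int \<Rightarrow> real" where
  "dyadic_iter g f 0 a = 0"
| "dyadic_iter g f (Suc k) a = dyadic_iter g f k a + dyadic_iter g f k (a + 2 ^ k)
     + (real (k + 1) * (psum g a (2 ^ k))\<^sup>2 + dyadic_sq f k (a + 2 ^ k)) / 2"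

lemma sum_lessThan_add: "(\<Sum>i<m + n. f i) = (\<Sum>i<m. f i) + (\<Sum>i<n. f (m + i :: nat))" for f :: "nat \<Rightarrow> real"
  by (induction n) (auto simp: add.assoc)

lemma psum_add: "psum f a (m + n) = psum f a m + psum f (a + int m) n"
  by (simp add: psum_def sum_lessThan_add add.assoc)

text \<open>Chen's relation: splitting an iterated sum leaves one cross product of plain
  sums.\<close>

lemma iter_sum_add: "iter_sum g f a (m + n) = iter_sum g f a m + psum g a m * psum f (a + int m) n + iter_sum g f (a + int m) n"
  by (simp add: iter_sum_def sum_lessThan_add psum_add psum_def[of f] distrib_right sum.distrib sum_distrib_left add.assoc)

lemma dyadic_sq_nonneg: "0 \<le> dyadic_sq f k a"
  by (induction k arbitrary: a) auto

lemma dyadic_iter_nonneg: "0 \<le> dyadic_iter g f k a"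
  by (induction k arbitrary: a) (auto simp: dyadic_sq_nonneg)

text \<open>The right side is free of l, so it bounds the maximum over l. A length beyond the
  midpoint is the whole left block followed by an initial piece of the right one, so at most one
  block per level is used.\<close>

lemma psum_le_dyadic_sq: "l \<le> 2 ^ k \<Longrightarrow> (psum f a l)\<^sup>2 \<le> real (k + 1) * dyadic_sq f k a"
proof (induction k arbitrary: a l)
  case 0
  hence "l = 0 \<or> l = 1" by auto
  thus ?case by (auto simp: psum_def)
next
  case (Suc k)
  show ?case
  proof (cases "l \<le> 2 ^ k")
    case True
    have "(psum f a l)\<^sup>2 \<le> real (k + 1) * dyadic_sq f k a" by (rule Suc.IH[OF True])
    also have "\<dots> \<le> real (Suc k + 1) * dyadic_sq f (Suc k) a"
      using dyadic_sq_nonneg by (intro mult_mono) auto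
    finally show ?thesis .
  next
    case False
    define r where "r = l - 2 ^ k"
    have r: "l = 2 ^ k + r" "r \<le> 2 ^ k" using False Suc.prems by (auto simp: r_def)
    define s where "s = psum f a (2 ^ k)"
    define t where "t = psum f (a + 2 ^ k) r"
    define N where "N = real (k + 1)"
    have N: "N > 0" by (simp add: N_def)
    have t: "t\<^sup>2 \<le> N * dyadic_sq f k (a + 2 ^ k)" using Suc.IH[OF r(2)] by (simp add: t_def N_def)
    have "(s + t)\<^sup>2 \<le> (N + 1) * (s\<^sup>2 + t\<^sup>2 / N)"
    proof -
      have "(N + 1) * (s\<^sup>2 + t\<^sup>2 / N) - (s + t)\<^sup>2 = (N * s - t)\<^sup>2 / N"
        using N by (simp add: field_simps power2_eq_square)
      also have "\<dots> \<ge> 0" using N by simp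
      finally show ?thesis by simp
    qed
    also have "\<dots> \<le> (N + 1) * (s\<^sup>2 + dyadic_sq f k (a + 2 ^ k))"
      using t N by (intro mult_left_mono add_left_mono) (auto simp: field_simps)
    also have "\<dots> \<le> (N + 1) * dyadic_sq f (Suc k) a"
      using N dyadic_sq_nonneg[of f k a] by (intro mult_left_mono) (auto simp: s_def)
    finally have "(s + t)\<^sup>2 \<le> (N + 1) * dyadic_sq f (Suc k) a" .
    moreover have "psum f a l = s + t" unfolding r(1) psum_add by (simp add: s_def t_def)
    moreover have "real (Suc k + 1) = N + 1" by (simp add: N_def)
    ultimately show ?thesis by (simp only:)
  qed
qed

text \<open>The same bisection as for plain sums; what is new at each split is the cross product,
  whose two factors are separated from each other.\<close>

lemma iter_sum_le_dyadic_iter: "l \<le> 2 ^ k \<Longrightarrow> \<bar>iter_sum g f a l\<bar> \<le> dyadic_iter g f k a"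
proof (induction k arbitrary: a l)
  case 0
  hence "l = 0 \<or> l = 1" by auto
  thus ?case by (auto simp: iter_sum_def psum_def)
next
  case (Suc k)
  show ?case
  proof (cases "l \<le> 2 ^ k")
    case True
    have "\<bar>iter_sum g f a l\<bar> \<le> dyadic_iter g f k a" by (rule Suc.IH[OF True])
    also have "\<dots> \<le> dyadic_iter g f (Suc k) a"
      using dyadic_sq_nonneg dyadic_iter_nonneg by (auto intro!: add_nonneg_nonneg)
    finally show ?thesis .
  next
    case False
    define r where "r = l - 2 ^ k"
    have r: "l = 2 ^ k + r" "r \<le> 2 ^ k" using False Suc.prems by (auto simp: r_def)
    define s where "s = psum g a (2 ^ k)"
    define t where "t = psum f (a + 2 ^ k) r"
    define N where "N = real (k + 1)"
    have N: "N > 0" by (simp add: N_def)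
    have t: "t\<^sup>2 \<le> N * dyadic_sq f k (a + 2 ^ k)" using psum_le_dyadic_sq[OF r(2)] by (simp add: t_def N_def)
    \<comment> \<open>The weight N offsets the factor N with which \<open>psum_le_dyadic_sq\<close>
      bounds the square of t.\<close>
    have "\<bar>s * t\<bar> \<le> (N * s\<^sup>2 + t\<^sup>2 / N) / 2"
    proof -
      have "N * s\<^sup>2 + t\<^sup>2 / N - 2 * \<bar>s * t\<bar> = (N * \<bar>s\<bar> - \<bar>t\<bar>)\<^sup>2 / N"
        using N by (simp add: field_simps power2_eq_square abs_mult)
      also have "\<dots> \<ge> 0" using N by simp
      finally show ?thesis by simp
    qed
    also have "\<dots> \<le> (N * s\<^sup>2 + dyadic_sq f k (a + 2 ^ k)) / 2"
      using t N by (auto simp: field_simps)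
    finally have st: "\<bar>s * t\<bar> \<le> (N * s\<^sup>2 + dyadic_sq f k (a + 2 ^ k)) / 2" .
    have "iter_sum g f a l = iter_sum g f a (2 ^ k) + s * t + iter_sum g f (a + 2 ^ k) r"
      by (simp add: r iter_sum_add s_def t_def)
    moreover define Z where "Z = (N * s\<^sup>2 + dyadic_sq f k (a + 2 ^ k)) / 2"
    moreover have "dyadic_iter g f (Suc k) a = dyadic_iter g f k a + dyadic_iter g f k (a + 2 ^ k) + Z"
      by (simp add: Z_def s_def N_def)
    moreover have "\<bar>iter_sum g f a (2 ^ k)\<bar> \<le> dyadic_iter g f k a" by (rule Suc.IH) simp
    moreover have "\<bar>iter_sum g f (a + 2 ^ k) r\<bar> \<le> dyadic_iter g f k (a + 2 ^ k)" by (rule Suc.IH[OF r(2)])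
    ultimately show ?thesis using st by linarith
  qed
qed

section \<open>Expected size of the dyadic majorants\<close>

definition linear_variance :: "'a measure \<Rightarrow> real \<Rightarrow> ('a \<Rightarrow> int \<Rightarrow> real) \<Rightarrow> bool" where
  "linear_variance P C Y \<longleftrightarrow> (\<forall>a l. integrable P (\<lambda>\<omega>. (psum (Y \<omega>) a l)\<^sup>2) \<and>
     (LINT \<omega>|P. (psum (Y \<omega>) a l)\<^sup>2) \<le> C * real l)"

lemma linear_varianceD:
  assumes "linear_variance P C Y"
  shows "integrable P (\<lambda>\<omega>. (psum (Y \<omega>) a l)\<^sup>2)" "(LINT \<omega>|P. (psum (Y \<omega>) a l)\<^sup>2) \<le> C * real l"
  using assms by (auto simp: linear_variance_def)

lemma linear_variance_nonneg:
  assumes "linear_variance P C Y" shows "0 \<le> C"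
proof -
  have "0 \<le> (LINT \<omega>|P. (psum (Y \<omega>) 0 1)\<^sup>2)" by simp
  also have "\<dots> \<le> C * real 1" by (rule linear_varianceD(2)[OF assms])
  finally show ?thesis by simp
qed

lemma linear_variance_mono: "linear_variance P C Y \<Longrightarrow> C \<le> C' \<Longrightarrow> linear_variance P C' Y"
  unfolding linear_variance_def by (meson mult_right_mono of_nat_0_le_iff order_trans)

text \<open>The blocks of one level are disjoint with total length at most 2^k, so linear variance
  gives at most C 2^k per level, and there are k + 1 levels.\<close>

lemma dyadic_sq_expectation:
  assumes "linear_variance P C Y"
  shows "integrable P (\<lambda>\<omega>. dyadic_sq (Y \<omega>) k a) \<and> (LINT \<omega>|P. dyadic_sq (Y \<omega>) k a) \<le> C * (real (k + 1) * 2 ^ k)"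
proof (induction k arbitrary: a)
  case 0
  show ?case using linear_varianceD[OF assms, of a 1] by (simp add: psum_def)
next
  case (Suc k)
  have "(LINT \<omega>|P. dyadic_sq (Y \<omega>) (Suc k) a) \<le> C * (real (k + 1) * 2 ^ k) + C * (real (k + 1) * 2 ^ k) + C * real (2 ^ k)"
    using Suc[of a] Suc[of "a + 2 ^ k"] linear_varianceD[OF assms, of a "2 ^ k"] by simp
  also have "\<dots> \<le> C * (real (Suc k + 1) * 2 ^ Suc k)"
  proof -
    have "C \<ge> 0" by (rule linear_variance_nonneg[OF assms])
    thus ?thesis by (simp add: algebra_simps)
  qed
  finally show ?case using Suc[of a] Suc[of "a + 2 ^ k"] linear_varianceD(1)[OF assms, of a "2 ^ k"] by simp
qed

text \<open>The cross products of one level have total mean at most C (k + 1) 2^k, and there are at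
  most k + 1 levels. Y and Z enter only through their own variances, which is why any dependence
  between them is allowed.\<close>

lemma dyadic_iter_expectation:
  assumes Y: "linear_variance P C Y" and Z: "linear_variance P C Z"
  shows "integrable P (\<lambda>\<omega>. dyadic_iter (Z \<omega>) (Y \<omega>) k a) \<and> 
    (LINT \<omega>|P. dyadic_iter (Z \<omega>) (Y \<omega>) k a) \<le> C * ((real (k + 1))\<^sup>2 * 2 ^ k)"
proof (induction k arbitrary: a)
  case 0
  have "C \<ge> 0" by (rule linear_variance_nonneg[OF Y])
  thus ?case by simp
next
  case (Suc k)
  have C: "C \<ge> 0" by (rule linear_variance_nonneg[OF Y])
  note D = dyadic_sq_expectation[OF Y, of k "a + 2 ^ k"]
  have eq: "(LINT \<omega>|P. dyadic_iter (Z \<omega>) (Y \<omega>) (Suc k) a) = (LINT \<omega>|P. dyadic_iter (Z \<omega>) (Y \<omega>) k a)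
      + (LINT \<omega>|P. dyadic_iter (Z \<omega>) (Y \<omega>) k (a + 2 ^ k))
      + (real (k + 1) * (LINT \<omega>|P. (psum (Z \<omega>) a (2 ^ k))\<^sup>2) + (LINT \<omega>|P. dyadic_sq (Y \<omega>) k (a + 2 ^ k))) / 2"
    using Suc[of a] Suc[of "a + 2 ^ k"] D linear_varianceD(1)[OF Z, of a "2 ^ k"] by simp
  define V where "V = real (k + 1) * (LINT \<omega>|P. (psum (Z \<omega>) a (2 ^ k))\<^sup>2)"
  define A B where "A = C * ((real (k + 1))\<^sup>2 * 2 ^ k)" and "B = C * (real (k + 1) * 2 ^ k)"
  have "V \<le> real (k + 1) * (C * 2 ^ k)"
    unfolding V_def using linear_varianceD(2)[OF Z, of a "2 ^ k"] by (intro mult_left_mono) auto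
  hence V: "V \<le> B" by (simp add: B_def mult_ac)
  have "(LINT \<omega>|P. dyadic_iter (Z \<omega>) (Y \<omega>) (Suc k) a) \<le> A + A + (B + B) / 2"
    unfolding eq V_def[symmetric] 
    using V conjunct2[OF Suc[of a], folded A_def] conjunct2[OF Suc[of "a + 2 ^ k"], folded A_def] conjunct2[OF D, folded B_def]
    by argo
  also have "\<dots> = C * ((real (k + 1))\<^sup>2 * 2 ^ k) + C * ((real (k + 1))\<^sup>2 * 2 ^ k) + (real (k + 1) * (C * 2 ^ k) + C * (real (k + 1) * 2 ^ k)) / 2"
    by (simp add: A_def B_def mult_ac)
  also have "\<dots> \<le> C * ((real (Suc k + 1))\<^sup>2 * 2 ^ Suc k)"
  proof -
    define N p where "N = real (k + 1)" and "p = (2 :: real) ^ k"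
    have "C * (N\<^sup>2 * p) + C * (N\<^sup>2 * p) + (N * (C * p) + C * (N * p)) / 2 + (C * p) * (3 * N + 2) = C * ((N + 1)\<^sup>2 * (2 * p))"
      by (simp add: field_simps power2_eq_square)
    moreover have "0 \<le> (C * p) * (3 * N + 2)" using C by (auto simp: N_def p_def)
    moreover have *: "real (Suc k + 1) = N + 1" "(2 :: real) ^ Suc k = 2 * p" by (simp_all add: N_def p_def)
    ultimately show ?thesis unfolding * N_def[symmetric] p_def[symmetric] by linarith
  qed
  finally have le: "(LINT \<omega>|P. dyadic_iter (Z \<omega>) (Y \<omega>) (Suc k) a) \<le> C * ((real (Suc k + 1))\<^sup>2 * 2 ^ Suc k)" .
  have "integrable P (\<lambda>\<omega>. dyadic_iter (Z \<omega>) (Y \<omega>) (Suc k) a)"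
    using conjunct1[OF Suc[of a]] conjunct1[OF Suc[of "a + 2 ^ k"]] conjunct1[OF D] linear_varianceD(1)[OF Z, of a "2 ^ k"] by simp
  thus ?case using le by (rule conjI)
qed

section \<open>Strong mixing\<close>

text \<open>Mixing seen through upper level sets alone. This form passes to increasing
  transformations such as scaling and truncation, and suffices for averages of indicators of level
  sets.\<close>

definition level_dependence :: "'a measure \<Rightarrow> ('a \<Rightarrow> real) \<Rightarrow> ('a \<Rightarrow> real) \<Rightarrow> real \<Rightarrow> bool" where
  "level_dependence P X Y \<alpha> \<longleftrightarrow>
     (\<forall>s t. \<bar>measure P ({\<omega> \<in> space P. s \<le> X \<omega>} \<inter> {\<omega> \<in> space P. t \<le> Y \<omega>})
        - measure P {\<omega> \<in> space P. s \<le> X \<omega>} * measure P {\<omega> \<in> space P. t \<le> Y \<omega>}\<bar> \<le> \<alpha>)"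

text \<open>\<open>X\<close> is approximated by \<open>\<lfloor>k X\<rfloor> / k\<close>, which is an average of indicators of upper level sets.\<close>

lemma covariance_unit_interval:
  fixes X Y :: "'a \<Rightarrow> real"
  assumes P: "prob_space P" and X: "X \<in> borel_measurable P" and Y: "Y \<in> borel_measurable P"
    and bd: "\<And>\<omega>. \<omega> \<in> space P \<Longrightarrow> 0 \<le> X \<omega> \<and> X \<omega> \<le> 1" "\<And>\<omega>. \<omega> \<in> space P \<Longrightarrow> 0 \<le> Y \<omega> \<and> Y \<omega> \<le> 1"
    and dep: "level_dependence P X Y \<alpha>"
  shows "\<bar>(LINT \<omega>|P. X \<omega> * Y \<omega>) - (LINT \<omega>|P. X \<omega>) * (LINT \<omega>|P. Y \<omega>)\<bar> \<le> \<alpha>"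
proof (rule field_le_epsilon)
  interpret prob_space P by (rule P)
  fix e :: real assume "e > 0"
  obtain k :: nat where k: "k > 0" "4 / real k < e"
  proof -
    obtain n :: nat where "4 / e < real n" using reals_Archimedean2 by blast
    moreover have "0 < 4 / e" using \<open>e > 0\<close> by simp
    ultimately have "n > 0" by (metis of_nat_0 not_gr_zero order_less_asym)
    thus ?thesis using that[of n] \<open>e > 0\<close> \<open>4 / e < real n\<close> by (simp add: field_simps)
  qed
  define ap where "ap Z \<omega> = (\<Sum>i<k. indicator {\<omega> \<in> space P. real (i + 1) / real k \<le> Z \<omega>} \<omega>) / real k"
    for Z :: "'a \<Rightarrow> real" and \<omega>
  have ap: "0 \<le> ap Z \<omega> \<and> ap Z \<omega> \<le> Z \<omega> \<and> Z \<omega> \<le> ap Z \<omega> + 1 / real k" if "0 \<le> Z \<omega>" "Z \<omega> \<le> 1" "\<omega> \<in> space P" for Z \<omega>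
  proof -
    \<comment> \<open>Of the grid points 1/k, 2/k, ..., 1 exactly N lie at or below the value, so
      the average of indicators is the value rounded down to the grid.\<close>
    define N where "N = nat \<lfloor>real k * Z \<omega>\<rfloor>"
    have kZ: "0 \<le> real k * Z \<omega>" "real k * Z \<omega> \<le> real k" using that k by (auto simp: mult_left_le)
    have N: "real N \<le> real k * Z \<omega>" "real k * Z \<omega> < real N + 1" using kZ by (auto simp: N_def)
    have "{i \<in> {..<k}. real (i + 1) / real k \<le> Z \<omega>} = {..<N}"
    proof (intro set_eqI iffI)
      fix i assume "i \<in> {i \<in> {..<k}. real (i + 1) / real k \<le> Z \<omega>}"
      hence "real (i + 1) \<le> real k * Z \<omega>" using k by (simp add: divide_le_eq mult.commute)
      hence "real (i + 1) < real N + 1" using N(2) by linarith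
      thus "i \<in> {..<N}" by simp
    next
      fix i assume "i \<in> {..<N}"
      hence "real (i + 1) \<le> real N" by simp
      hence "real (i + 1) \<le> real k * Z \<omega>" using N(1) by linarith
      moreover from this have "real (i + 1) \<le> real k" using kZ(2) by linarith
      ultimately show "i \<in> {i \<in> {..<k}. real (i + 1) / real k \<le> Z \<omega>}" using k by (simp add: divide_le_eq mult.commute)
    qed
    moreover have "ap Z \<omega> = real (card {i \<in> {..<k}. real (i + 1) / real k \<le> Z \<omega>}) / real k"
      using that(3) by (simp add: ap_def indicator_def sum.If_cases Int_def)
    ultimately have "ap Z \<omega> = real N / real k" by simp
    moreover have "real N / real k \<le> Z \<omega>" "Z \<omega> \<le> real N / real k + 1 / real k"
      using N k by (simp_all add: field_simps)
    ultimately show ?thesis by simp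
  qed
  have apm: "ap Z \<in> borel_measurable P" if [measurable]: "Z \<in> borel_measurable P" for Z
    unfolding ap_def by measurable
  have int: "integrable P Z" if "Z \<in> borel_measurable P" "\<And>\<omega>. \<omega> \<in> space P \<Longrightarrow> 0 \<le> Z \<omega> \<and> Z \<omega> \<le> 1" for Z :: "'a \<Rightarrow> real"
    by (rule integrable_const_bound[of _ 1]) (use that in \<open>auto intro!: AE_I2\<close>)
  note apm[OF X, measurable] apm[OF Y, measurable]
  note [measurable] = X Y
  have apX: "ap X \<omega> \<le> 1 \<and> 0 \<le> ap X \<omega> \<and> ap X \<omega> \<le> X \<omega> \<and> X \<omega> \<le> ap X \<omega> + 1 / real k"
    and apY: "ap Y \<omega> \<le> 1 \<and> 0 \<le> ap Y \<omega> \<and> ap Y \<omega> \<le> Y \<omega> \<and> Y \<omega> \<le> ap Y \<omega> + 1 / real k" if "\<omega> \<in> space P" for \<omega>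
    using ap bd that order_trans by blast+
  have prod1: "\<bar>x * y - x' * y'\<bar> \<le> 2 / real k" 
    if "0 \<le> x'" "x' \<le> x" "x \<le> x' + 1 / real k" "x \<le> 1" "0 \<le> y'" "y' \<le> y" "y \<le> y' + 1 / real k" "y \<le> 1" for x y x' y' :: real
  proof -
    have "x * y - x' * y' = (x - x') * y + x' * (y - y')" by (simp add: algebra_simps)
    moreover have "0 \<le> (x - x') * y" "0 \<le> x' * (y - y')" using that by auto
    moreover have "(x - x') * y \<le> (1 / real k) * 1" using that by (intro mult_mono) auto
    moreover have "x' * (y - y') \<le> 1 * (1 / real k)" using that by (intro mult_mono) auto
    ultimately show ?thesis by simp
  qed
  have iX: "integrable P X" and iY: "integrable P Y" and iXY: "integrable P (\<lambda>\<omega>. X \<omega> * Y \<omega>)"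
    using bd by (auto intro!: int mult_le_one)
  have iaX: "integrable P (ap X)" and iaY: "integrable P (ap Y)" and iaXY: "integrable P (\<lambda>\<omega>. ap X \<omega> * ap Y \<omega>)"
    using apX apY bd by (auto intro!: int mult_le_one)
  have "\<bar>(LINT \<omega>|P. X \<omega> * Y \<omega>) - (LINT \<omega>|P. ap X \<omega> * ap Y \<omega>)\<bar> = \<bar>LINT \<omega>|P. X \<omega> * Y \<omega> - ap X \<omega> * ap Y \<omega>\<bar>"
    using iXY iaXY by simp
  also have "\<dots> \<le> (LINT \<omega>|P. \<bar>X \<omega> * Y \<omega> - ap X \<omega> * ap Y \<omega>\<bar>)" by (rule integral_abs_bound)
  also have "\<dots> \<le> (LINT \<omega>|P. 2 / real k)"
    using iXY iaXY apX apY bd by (intro integral_mono) (auto intro!: prod1)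
  finally have 1: "\<bar>(LINT \<omega>|P. X \<omega> * Y \<omega>) - (LINT \<omega>|P. ap X \<omega> * ap Y \<omega>)\<bar> \<le> 2 / real k" by (simp add: prob_space)
  have m: "0 \<le> (LINT \<omega>|P. ap Z \<omega>) \<and> (LINT \<omega>|P. ap Z \<omega>) \<le> (LINT \<omega>|P. Z \<omega>) \<and> (LINT \<omega>|P. Z \<omega>) \<le> (LINT \<omega>|P. ap Z \<omega>) + 1 / real k \<and> (LINT \<omega>|P. Z \<omega>) \<le> 1"
    if i: "integrable P Z" "integrable P (ap Z)" and b: "\<And>\<omega>. \<omega> \<in> space P \<Longrightarrow> 0 \<le> Z \<omega> \<and> Z \<omega> \<le> 1" for Z
  proof (intro conjI)
    show "0 \<le> (LINT \<omega>|P. ap Z \<omega>)" by (rule integral_nonneg_AE) (use ap b in \<open>auto intro!: AE_I2\<close>)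
    show "(LINT \<omega>|P. ap Z \<omega>) \<le> (LINT \<omega>|P. Z \<omega>)" by (rule integral_mono) (use ap b i in auto)
    have "(LINT \<omega>|P. Z \<omega>) \<le> (LINT \<omega>|P. ap Z \<omega> + 1 / real k)" by (rule integral_mono) (use ap b i in auto)
    thus "(LINT \<omega>|P. Z \<omega>) \<le> (LINT \<omega>|P. ap Z \<omega>) + 1 / real k" using i by (simp add: prob_space)
    have "(LINT \<omega>|P. Z \<omega>) \<le> (LINT \<omega>|P. 1)" by (rule integral_mono) (use b i in auto)
    thus "(LINT \<omega>|P. Z \<omega>) \<le> 1" by (simp add: prob_space)
  qed
  have 2: "\<bar>(LINT \<omega>|P. X \<omega>) * (LINT \<omega>|P. Y \<omega>) - (LINT \<omega>|P. ap X \<omega>) * (LINT \<omega>|P. ap Y \<omega>)\<bar> \<le> 2 / real k"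
    using m[OF iX iaX bd(1)] m[OF iY iaY bd(2)] by (intro prod1) auto
  define A where "A i = {\<omega> \<in> space P. real (i + 1) / real k \<le> X \<omega>}" for i :: nat
  define B where "B i = {\<omega> \<in> space P. real (i + 1) / real k \<le> Y \<omega>}" for i :: nat
  have [measurable]: "A i \<in> sets P" "B i \<in> sets P" for i unfolding A_def B_def by measurable
  have AB: "A i \<subseteq> space P" "B i \<subseteq> space P" for i by (auto simp: A_def B_def)
  have apA: "ap X \<omega> = (\<Sum>i<k. indicator (A i) \<omega>) / real k" and apB: "ap Y \<omega> = (\<Sum>i<k. indicator (B i) \<omega>) / real k" for \<omega>
    by (simp_all only: ap_def A_def B_def)
  have "ap X \<omega> * ap Y \<omega> = (\<Sum>i<k. \<Sum>j<k. indicator (A i \<inter> B j) \<omega>) / (real k)\<^sup>2" for \<omega>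
    unfolding apA apB by (simp add: sum_product indicator_inter_arith power2_eq_square)
  hence "(LINT \<omega>|P. ap X \<omega> * ap Y \<omega>) = (\<Sum>i<k. \<Sum>j<k. measure P (A i \<inter> B j)) / (real k)\<^sup>2"
    using AB by (simp add: Int_absorb2 integrable_real_indicator emeasure_eq_measure inf.absorb1 le_infI1)
  moreover have "(LINT \<omega>|P. ap X \<omega>) * (LINT \<omega>|P. ap Y \<omega>) = (\<Sum>i<k. \<Sum>j<k. measure P (A i) * measure P (B j)) / (real k)\<^sup>2"
    unfolding apA apB using AB by (simp add: sum_product power2_eq_square emeasure_eq_measure inf.absorb1)
  ultimately have "\<bar>(LINT \<omega>|P. ap X \<omega> * ap Y \<omega>) - (LINT \<omega>|P. ap X \<omega>) * (LINT \<omega>|P. ap Y \<omega>)\<bar>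
     = \<bar>\<Sum>i<k. \<Sum>j<k. measure P (A i \<inter> B j) - measure P (A i) * measure P (B j)\<bar> / (real k)\<^sup>2"
    by (simp add: sum_subtractf diff_divide_distrib[symmetric])
  \<comment> \<open>The covariance of the two averages is itself an average of k^2 differences, each
    bounded by \<alpha>.\<close>
  also have "\<dots> \<le> (\<Sum>i<k. \<Sum>j<k. \<alpha>) / (real k)\<^sup>2"
    using dep unfolding A_def B_def level_dependence_def
    by (intro divide_right_mono order_trans[OF sum_abs] sum_mono) auto
  also have "\<dots> = \<alpha>" using k by (simp add: power2_eq_square)
  finally have 3: "\<bar>(LINT \<omega>|P. ap X \<omega> * ap Y \<omega>) - (LINT \<omega>|P. ap X \<omega>) * (LINT \<omega>|P. ap Y \<omega>)\<bar> \<le> \<alpha>" .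
  show "\<bar>(LINT \<omega>|P. X \<omega> * Y \<omega>) - (LINT \<omega>|P. X \<omega>) * (LINT \<omega>|P. Y \<omega>)\<bar> \<le> \<alpha> + e"
  proof -
    have "4 / real k = 2 / real k + 2 / real k" by simp
    thus ?thesis using 1 2 3 k(2) by linarith
  qed
qed

text \<open>An affine map carries [-c, c] onto [0, 1] and level sets to level sets; it divides the
  covariance by 4 c^2.\<close>

lemma covariance_bounded:
  fixes X Y :: "'a \<Rightarrow> real"
  assumes P: "prob_space P" and X: "X \<in> borel_measurable P" and Y: "Y \<in> borel_measurable P"
    and c: "c > 0" and bd: "\<And>\<omega>. \<bar>X \<omega>\<bar> \<le> c" "\<And>\<omega>. \<bar>Y \<omega>\<bar> \<le> c"
    and dep: "level_dependence P X Y \<alpha>"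
  shows "\<bar>(LINT \<omega>|P. X \<omega> * Y \<omega>) - (LINT \<omega>|P. X \<omega>) * (LINT \<omega>|P. Y \<omega>)\<bar> \<le> 4 * c\<^sup>2 * \<alpha>"
proof -
  interpret prob_space P by (rule P)
  define U V where "U \<omega> = (X \<omega> + c) / (2 * c)" and "V \<omega> = (Y \<omega> + c) / (2 * c)" for \<omega>
  have lev: "{\<omega> \<in> space P. s \<le> U \<omega>} = {\<omega> \<in> space P. 2 * c * s - c \<le> X \<omega>}"
    "{\<omega> \<in> space P. s \<le> V \<omega>} = {\<omega> \<in> space P. 2 * c * s - c \<le> Y \<omega>}" for s
    using c by (auto simp: U_def V_def field_simps)
  have bX: "X \<omega> \<le> c" "- c \<le> X \<omega>" and bY: "Y \<omega> \<le> c" "- c \<le> Y \<omega>" for \<omega>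
    using bd[of \<omega>] by auto
  have *: "\<bar>(LINT \<omega>|P. U \<omega> * V \<omega>) - (LINT \<omega>|P. U \<omega>) * (LINT \<omega>|P. V \<omega>)\<bar> \<le> \<alpha>"
  proof (rule covariance_unit_interval[OF P])
    show "U \<in> borel_measurable P" "V \<in> borel_measurable P" using X Y unfolding U_def[abs_def] V_def[abs_def] by measurable
    show "0 \<le> U \<omega> \<and> U \<omega> \<le> 1" "0 \<le> V \<omega> \<and> V \<omega> \<le> 1" for \<omega>
      using bX[of \<omega>] bY[of \<omega>] c by (auto simp: U_def V_def field_simps)
  qed (use dep in \<open>simp add: level_dependence_def lev\<close>)
  have iX: "integrable P X" and iY: "integrable P Y"
    by (rule integrable_const_bound[of _ c]; use X Y bd in auto)+
  have iXY: "integrable P (\<lambda>\<omega>. X \<omega> * Y \<omega>)"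
    by (rule integrable_const_bound[of _ "c * c"]) (use X Y bd c in \<open>auto simp: abs_mult intro!: mult_mono\<close>)
  have "U \<omega> * V \<omega> = (X \<omega> * Y \<omega> + c * X \<omega> + c * Y \<omega> + c\<^sup>2) / (4 * c\<^sup>2)" for \<omega>
    using c by (simp add: U_def V_def field_simps power2_eq_square)
  hence "(LINT \<omega>|P. U \<omega> * V \<omega>) = ((LINT \<omega>|P. X \<omega> * Y \<omega>) + c * (LINT \<omega>|P. X \<omega>) + c * (LINT \<omega>|P. Y \<omega>) + c\<^sup>2) / (4 * c\<^sup>2)"
    using iX iY iXY by (simp add: prob_space)
  moreover have "(LINT \<omega>|P. U \<omega>) = ((LINT \<omega>|P. X \<omega>) + c) / (2 * c)" "(LINT \<omega>|P. V \<omega>) = ((LINT \<omega>|P. Y \<omega>) + c) / (2 * c)"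
    using iX iY by (simp_all add: U_def V_def prob_space)
  ultimately have "(LINT \<omega>|P. U \<omega> * V \<omega>) - (LINT \<omega>|P. U \<omega>) * (LINT \<omega>|P. V \<omega>)
      = ((LINT \<omega>|P. X \<omega> * Y \<omega>) - (LINT \<omega>|P. X \<omega>) * (LINT \<omega>|P. Y \<omega>)) / (4 * c\<^sup>2)"
  proof -
    have *: "(p + c * x + c * y + c\<^sup>2) / (4 * c\<^sup>2) - (x + c) / (2 * c) * ((y + c) / (2 * c)) = (p - x * y) / (4 * c\<^sup>2)" for p x y :: real
      using c by (simp add: field_simps power2_eq_square)
    show ?thesis unfolding \<open>(LINT \<omega>|P. U \<omega> * V \<omega>) = _\<close> \<open>(LINT \<omega>|P. U \<omega>) = _\<close> \<open>(LINT \<omega>|P. V \<omega>) = _\<close> by (rule *)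
  qed
  hence "\<bar>(LINT \<omega>|P. X \<omega> * Y \<omega>) - (LINT \<omega>|P. X \<omega>) * (LINT \<omega>|P. Y \<omega>)\<bar> / (4 * c\<^sup>2) \<le> \<alpha>"
    using * by simp
  thus ?thesis using c by (simp add: divide_le_eq mult_ac)
qed

section \<open>Truncation and covariances under fourth moments\<close>

definition cut_off :: "real \<Rightarrow> real \<Rightarrow> real" where "cut_off c x = max (- c) (min c x)"

text \<open>The error vanishes for |x| <= c; beyond that, powers of |x| / c >= 1 raise it to a
  fourth power.\<close>

lemma cut_off_error:
  assumes "c > 0"
  shows "\<bar>cut_off c x\<bar> \<le> c" "\<bar>cut_off c x\<bar> \<le> \<bar>x\<bar>" "\<bar>x - cut_off c x\<bar> \<le> x ^ 4 / c ^ 3"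
    "\<bar>x - cut_off c x\<bar> * \<bar>y\<bar> \<le> (x ^ 4 + y ^ 4) / c\<^sup>2"
proof -
  show "\<bar>cut_off c x\<bar> \<le> c" "\<bar>cut_off c x\<bar> \<le> \<bar>x\<bar>" using assms by (auto simp: cut_off_def)
  have e: "\<bar>x - cut_off c x\<bar> \<le> \<bar>x\<bar>" "\<bar>x\<bar> \<le> c \<Longrightarrow> x - cut_off c x = 0" using assms by (auto simp: cut_off_def)
  have even: "x ^ 4 = \<bar>x\<bar> ^ 4" for x :: real by simp
  show "\<bar>x - cut_off c x\<bar> \<le> x ^ 4 / c ^ 3"
  proof (cases "\<bar>x\<bar> \<le> c")
    case False
    hence "\<bar>x\<bar> * c ^ 3 \<le> \<bar>x\<bar> * \<bar>x\<bar> ^ 3" using assms by (intro mult_left_mono power_mono) auto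
    also have "\<dots> = x ^ 4" unfolding even[of x] by (simp add: eval_nat_numeral)
    finally have "\<bar>x\<bar> \<le> x ^ 4 / c ^ 3" using assms by (simp add: field_simps)
    thus ?thesis using e by simp
  qed (use e assms in auto)
  show "\<bar>x - cut_off c x\<bar> * \<bar>y\<bar> \<le> (x ^ 4 + y ^ 4) / c\<^sup>2"
  proof (cases "\<bar>x\<bar> \<le> c")
    case False
    \<comment> \<open>Both factors and c are at most m, and m^4 is one of the two fourth
      powers.\<close>
    define m where "m = max \<bar>x\<bar> \<bar>y\<bar>"
    have m: "\<bar>x\<bar> \<le> m" "\<bar>y\<bar> \<le> m" "c \<le> m" "0 \<le> m" using False by (auto simp: m_def)
    have "(\<bar>x\<bar> * \<bar>y\<bar>) * c\<^sup>2 \<le> (m * m) * m\<^sup>2" using m assms by (intro mult_mono power_mono) auto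
    also have "\<dots> = m ^ 4" by (simp add: eval_nat_numeral)
    also have "\<dots> \<le> \<bar>x\<bar> ^ 4 + \<bar>y\<bar> ^ 4" by (cases "\<bar>x\<bar> \<le> \<bar>y\<bar>") (auto simp: m_def max_def)
    finally have "\<bar>x\<bar> * \<bar>y\<bar> \<le> (x ^ 4 + y ^ 4) / c\<^sup>2" using assms by (simp add: field_simps)
    moreover have "\<bar>x - cut_off c x\<bar> * \<bar>y\<bar> \<le> \<bar>x\<bar> * \<bar>y\<bar>" using e by (intro mult_right_mono) auto
    ultimately show ?thesis by simp
  qed (use e assms in auto)
qed

lemma mult_le_fourth_powers: "\<bar>x * y\<bar> \<le> 1 + x ^ 4 + y ^ (4::nat)" for x y :: real
proof -
  have sq: "z\<^sup>2 \<le> (1 + z ^ 4) / 2" for z :: real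
  proof -
    have "0 \<le> (z\<^sup>2 - 1)\<^sup>2" by simp
    also have "\<dots> = z ^ 4 - 2 * z\<^sup>2 + 1" by (simp add: eval_nat_numeral algebra_simps)
    finally show ?thesis by simp
  qed
  have "0 \<le> (\<bar>x\<bar> - \<bar>y\<bar>)\<^sup>2" by simp
  also have "\<dots> = x\<^sup>2 + y\<^sup>2 - 2 * \<bar>x * y\<bar>" by (simp add: power2_diff abs_mult)
  finally have "2 * \<bar>x * y\<bar> \<le> x\<^sup>2 + y\<^sup>2" by simp
  moreover have "0 \<le> x ^ 4" "0 \<le> y ^ 4" by auto
  ultimately show ?thesis using sq[of x] sq[of y] by argo
qed

text \<open>Both variables are truncated at c. Replacing the product costs 4 K / c^2, the product of
  the truncated means K / c^2, and the truncated covariance is at most 4 c^2 \<alpha>. The balance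
  between the two orders in c is left to the caller.\<close>

lemma covariance_fourth_moments:
  fixes X Y :: "'a \<Rightarrow> real"
  assumes P: "prob_space P" and X: "X \<in> borel_measurable P" and Y: "Y \<in> borel_measurable P"
    and c: "c > 0" and \<alpha>: "\<alpha> \<ge> 0"
    and i4: "integrable P (\<lambda>\<omega>. X \<omega> ^ 4)" "integrable P (\<lambda>\<omega>. Y \<omega> ^ 4)"
    and K: "(LINT \<omega>|P. X \<omega> ^ 4) \<le> K" "(LINT \<omega>|P. Y \<omega> ^ 4) \<le> K"
    and mean: "(LINT \<omega>|P. X \<omega>) = 0" "(LINT \<omega>|P. Y \<omega>) = 0"
    and dep: "level_dependence P X Y \<alpha>"
  shows "\<bar>LINT \<omega>|P. X \<omega> * Y \<omega>\<bar> \<le> 4 * c\<^sup>2 * \<alpha> + 5 * K / c\<^sup>2"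
proof -
  interpret prob_space P by (rule P)
  note [measurable] = X Y
  define U V where "U \<omega> = cut_off c (X \<omega>)" and "V \<omega> = cut_off c (Y \<omega>)" for \<omega>
  have UVm [measurable]: "U \<in> borel_measurable P" "V \<in> borel_measurable P"
    unfolding U_def V_def cut_off_def by measurable
  have bd: "\<bar>U \<omega>\<bar> \<le> c" "\<bar>V \<omega>\<bar> \<le> c" for \<omega> unfolding U_def V_def using cut_off_error(1)[OF c] by auto
  have cl: "t \<le> cut_off c x \<longleftrightarrow> t \<le> - c \<or> t \<le> c \<and> t \<le> x" for t x
    using c by (auto simp: cut_off_def)
  \<comment> \<open>The level sets of the truncated variable are those of the original one or
    trivial. For a trivial one the difference is 0, which is where \<alpha> >= 0 enters.\<close>
  have lev: "{\<omega> \<in> space P. s \<le> cut_off c (Z \<omega>)} = (if s \<le> - c then space P else if s \<le> c then {\<omega> \<in> space P. s \<le> Z \<omega>} else {})"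
    for s and Z :: "'a \<Rightarrow> real" using c by (auto simp: cl)
  have depUV: "level_dependence P U V \<alpha>"
    using dep \<alpha> unfolding level_dependence_def U_def V_def lev
    by (auto simp: prob_space inf.absorb1 inf.absorb2)
  note cov = covariance_bounded[OF P UVm c bd depUV]
  have int1: "integrable P Z" if [measurable]: "Z \<in> borel_measurable P" and "integrable P (\<lambda>\<omega>. Z \<omega> ^ 4)" for Z :: "'a \<Rightarrow> real"
  proof (rule Bochner_Integration.integrable_bound[of P "\<lambda>\<omega>. 1 + Z \<omega> ^ 4 + 1 ^ 4"])
    have "norm (Z \<omega>) \<le> norm (1 + Z \<omega> ^ 4 + 1 ^ 4)" for \<omega>
      using mult_le_fourth_powers[of "Z \<omega>" 1] by simp
    thus "AE \<omega> in P. norm (Z \<omega>) \<le> norm (1 + Z \<omega> ^ 4 + 1 ^ 4)" by simp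
  qed (use that in auto)
  have iX: "integrable P X" and iY: "integrable P Y" using int1[OF X i4(1)] int1[OF Y i4(2)] by auto
  have iXY: "integrable P (\<lambda>\<omega>. X \<omega> * Y \<omega>)"
  proof (rule Bochner_Integration.integrable_bound[of P "\<lambda>\<omega>. 1 + X \<omega> ^ 4 + Y \<omega> ^ 4"])
    have "norm (X \<omega> * Y \<omega>) \<le> norm (1 + X \<omega> ^ 4 + Y \<omega> ^ 4)" for \<omega>
      unfolding real_norm_def by (rule order_trans[OF mult_le_fourth_powers abs_ge_self])
    thus "AE \<omega> in P. norm (X \<omega> * Y \<omega>) \<le> norm (1 + X \<omega> ^ 4 + Y \<omega> ^ 4)" by simp
  qed (use i4 in auto)
  have iU: "integrable P U" and iV: "integrable P V"
    by (rule integrable_const_bound[of _ c]; use bd in auto)+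
  have iUV: "integrable P (\<lambda>\<omega>. U \<omega> * V \<omega>)"
    by (rule integrable_const_bound[of _ "c * c"]) (use bd c in \<open>auto simp: abs_mult intro!: mult_mono\<close>)
  have "\<bar>X \<omega> * Y \<omega> - U \<omega> * V \<omega>\<bar> \<le> 2 * (X \<omega> ^ 4 + Y \<omega> ^ 4) / c\<^sup>2" for \<omega>
  proof -
    have "X \<omega> * Y \<omega> - U \<omega> * V \<omega> = (X \<omega> - U \<omega>) * Y \<omega> + (Y \<omega> - V \<omega>) * U \<omega>" by (simp add: algebra_simps)
    hence "\<bar>X \<omega> * Y \<omega> - U \<omega> * V \<omega>\<bar> \<le> \<bar>X \<omega> - U \<omega>\<bar> * \<bar>Y \<omega>\<bar> + \<bar>Y \<omega> - V \<omega>\<bar> * \<bar>U \<omega>\<bar>"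
      by (simp add: abs_mult[symmetric])
    also have "\<dots> \<le> \<bar>X \<omega> - U \<omega>\<bar> * \<bar>Y \<omega>\<bar> + \<bar>Y \<omega> - V \<omega>\<bar> * \<bar>X \<omega>\<bar>"
      using cut_off_error(2)[OF c] by (auto simp: U_def intro!: mult_left_mono)
    also have "\<dots> \<le> (X \<omega> ^ 4 + Y \<omega> ^ 4) / c\<^sup>2 + (Y \<omega> ^ 4 + X \<omega> ^ 4) / c\<^sup>2"
      unfolding U_def V_def by (intro add_mono cut_off_error(4)[OF c])
    finally show ?thesis by (simp add: field_simps)
  qed
  hence "(LINT \<omega>|P. \<bar>X \<omega> * Y \<omega> - U \<omega> * V \<omega>\<bar>) \<le> (LINT \<omega>|P. 2 * (X \<omega> ^ 4 + Y \<omega> ^ 4) / c\<^sup>2)"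
    using iXY iUV i4 by (intro integral_mono) auto
  also have "\<dots> = 2 * ((LINT \<omega>|P. X \<omega> ^ 4) + (LINT \<omega>|P. Y \<omega> ^ 4)) / c\<^sup>2" using i4 by simp
  also have "\<dots> \<le> 4 * K / c\<^sup>2" using K c by (intro divide_right_mono) auto
  finally have "\<bar>LINT \<omega>|P. X \<omega> * Y \<omega> - U \<omega> * V \<omega>\<bar> \<le> 4 * K / c\<^sup>2"
    using integral_abs_bound[of P "\<lambda>\<omega>. X \<omega> * Y \<omega> - U \<omega> * V \<omega>"] by linarith
  hence 1: "\<bar>(LINT \<omega>|P. X \<omega> * Y \<omega>) - (LINT \<omega>|P. U \<omega> * V \<omega>)\<bar> \<le> 4 * K / c\<^sup>2" using iXY iUV by simp
  have "(LINT \<omega>|P. \<bar>X \<omega> - U \<omega>\<bar>) \<le> (LINT \<omega>|P. X \<omega> ^ 4 / c ^ 3)"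
    using iX iU i4 cut_off_error(3)[OF c, of "X _", folded U_def] by (intro integral_mono) auto
  also have "\<dots> \<le> K / c ^ 3" using K c i4 by (simp add: divide_right_mono)
  finally have "\<bar>LINT \<omega>|P. X \<omega> - U \<omega>\<bar> \<le> K / c ^ 3"
    using integral_abs_bound[of P "\<lambda>\<omega>. X \<omega> - U \<omega>"] by linarith
  hence EU: "\<bar>LINT \<omega>|P. U \<omega>\<bar> \<le> K / c ^ 3" using iX iU mean by simp
  \<comment> \<open>Smallness of one mean is enough; for the other the trivial bound c is
    taken.\<close>
  have "\<bar>LINT \<omega>|P. V \<omega>\<bar> \<le> (LINT \<omega>|P. \<bar>V \<omega>\<bar>)" by (rule integral_abs_bound)
  also have "\<dots> \<le> (LINT \<omega>|P. c)" using iV bd by (intro integral_mono) auto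
  finally have EV: "\<bar>LINT \<omega>|P. V \<omega>\<bar> \<le> c" by (simp add: prob_space)
  have "\<bar>(LINT \<omega>|P. U \<omega>) * (LINT \<omega>|P. V \<omega>)\<bar> \<le> K / c ^ 3 * c"
    unfolding abs_mult using EU EV order_trans[OF abs_ge_zero EU] by (intro mult_mono) auto
  also have "\<dots> = K / c\<^sup>2" using c by (simp add: field_simps eval_nat_numeral)
  finally have 2: "\<bar>(LINT \<omega>|P. U \<omega>) * (LINT \<omega>|P. V \<omega>)\<bar> \<le> K / c\<^sup>2" .
  have "5 * K / c\<^sup>2 = 4 * K / c\<^sup>2 + K / c\<^sup>2" by (simp add: field_simps)
  thus ?thesis using 1 2 cov by linarith
qed

section \<open>From mixing coefficients to covariance decay\<close>

lemma (in prob_space) mixing_coeff_ge: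
  assumes "A \<in> sets (gen_sigma M X {..t})" "B \<in> sets (gen_sigma M X {t + int h..})"
  shows "\<bar>measure M (A \<inter> B) - measure M A * measure M B\<bar> \<le> mixing_coeff M X h"
  unfolding mixing_coeff_def
proof (rule cSup_upper)
  show "\<bar>prob (A \<inter> B) - prob A * prob B\<bar> \<in> {\<bar>prob (A \<inter> B) - prob A * prob B\<bar> | t A B.
    A \<in> sets (gen_sigma M X {..t}) \<and> B \<in> sets (gen_sigma M X {t + int h..})}"
    using assms by blast
  \<comment> \<open>Over an unbounded set \<open>Sup\<close> would carry no information; the trivial
    bound 1 makes it an upper bound.\<close>
  have "\<bar>prob (A \<inter> B) - prob A * prob B\<bar> \<le> 1" for A B
  proof -
    have "0 \<le> prob A * prob B" "prob A * prob B \<le> 1" by (auto intro: mult_le_one)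
    moreover have "0 \<le> prob (A \<inter> B)" "prob (A \<inter> B) \<le> 1" by auto
    ultimately show ?thesis by linarith
  qed
  thus "bdd_above {\<bar>prob (A \<inter> B) - prob A * prob B\<bar> | t A B.
    A \<in> sets (gen_sigma M X {..t}) \<and> B \<in> sets (gen_sigma M X {t + int h..})}"
    by (auto intro!: bdd_aboveI[of _ 1])
qed

lemma sets_gen_sigma:
  "sets (gen_sigma P X I) = sigma_sets (space P) {X s -` B \<inter> space P | s B. s \<in> I \<and> B \<in> sets borel}"
  unfolding gen_sigma_def by (rule sets_measure_of) auto

lemma level_set_gen_sigma:
  assumes "s \<in> I" and f: "f \<in> borel_measurable borel"
  shows "{\<omega> \<in> space P. (c :: real) \<le> f (X s \<omega>)} \<in> sets (gen_sigma P X I)"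
proof -
  have "f -` {c..} \<in> sets borel" using measurable_sets[OF f, of "{c..}"] by simp
  moreover have "{\<omega> \<in> space P. c \<le> f (X s \<omega>)} = X s -` (f -` {c..}) \<inter> space P" by auto
  ultimately show ?thesis unfolding sets_gen_sigma using assms(1) by (intro sigma_sets.Basic) blast
qed

text \<open>Size -a with a >= 4 gives coefficients of order h^(-4), enough for summable covariances
  of order h^(-2). The function f lets one entry of a matrix sequence be treated while the mixing is
  that of the whole sequence.\<close>

lemma mixing_covariance_decay:
  fixes Z :: "int \<Rightarrow> 'a \<Rightarrow> 'b::topological_space" and f :: "'b \<Rightarrow> real"
  assumes P: "prob_space P" and mix: "strongly_mixing P a Z" and a: "4 \<le> a"
    and f: "f \<in> borel_measurable borel" and fZ: "\<And>t. (\<lambda>\<omega>. f (Z t \<omega>)) \<in> borel_measurable P"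
    and i4: "\<And>t. integrable P (\<lambda>\<omega>. f (Z t \<omega>) ^ 4)" and K: "\<And>t. (LINT \<omega>|P. f (Z t \<omega>) ^ 4) \<le> K"
  obtains C where "0 \<le> C" "\<And>s t. (LINT \<omega>|P. f (Z s \<omega>)) = 0 \<Longrightarrow> (LINT \<omega>|P. f (Z t \<omega>)) = 0 \<Longrightarrow>
     \<bar>LINT \<omega>|P. f (Z s \<omega>) * f (Z t \<omega>)\<bar> \<le> C / (1 + \<bar>of_int (t - s)\<bar>)\<^sup>2"
proof -
  interpret prob_space P by (rule P)
  obtain b where b: "b > a" and O: "(\<lambda>h. mixing_coeff P Z h) \<in> O(\<lambda>h. real h powr (- b))"
    using mix by (auto simp: strongly_mixing_def)
  obtain c where c: "c > 0" and ev: "\<forall>\<^sub>F h in at_top. norm (mixing_coeff P Z h) \<le> c * norm (real h powr (- b))"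
    using landau_o.bigE[OF O] by blast
  obtain H0 where H0: "\<And>h. H0 \<le> h \<Longrightarrow> norm (mixing_coeff P Z h) \<le> c * norm (real h powr (- b))"
    using ev by (auto simp: eventually_at_top_linorder)
  define H where "H = max H0 1"
  have mc: "mixing_coeff P Z h \<le> c / real h ^ 4" if "H \<le> h" for h
  proof -
    have h: "1 \<le> real h" "H0 \<le> h" using that by (auto simp: H_def)
    have "mixing_coeff P Z h \<le> c * (real h powr (- b))" using H0[OF h(2)] by simp
    also have "\<dots> \<le> c * (real h powr (- 4))" using a b c h by (intro mult_left_mono powr_mono) auto
    also have "real h powr (- 4) = 1 / real h ^ 4" using h by (simp add: powr_minus_divide)
    finally show ?thesis by simp
  qed
  have "0 \<le> (LINT \<omega>|P. f (Z 0 \<omega>) ^ 4)" by (rule integral_nonneg_AE) auto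
  hence K0: "0 \<le> K" using K[of 0] by linarith
  \<comment> \<open>The first part covers lags of at least H, its factor 4 coming from (1 + h)^2 <=
    (2 h)^2; the second covers the finitely many shorter lags by moments alone.\<close>
  define C where "C = 4 * (4 * c + 5 * K) + (1 + 2 * K) * (1 + real H)\<^sup>2"
  have far: "\<bar>LINT \<omega>|P. f (Z s \<omega>) * f (Z t \<omega>)\<bar> \<le> C / (1 + \<bar>of_int (t - s)\<bar>)\<^sup>2"
    if "s \<le> t" "H \<le> nat (t - s)" and m: "(LINT \<omega>|P. f (Z s \<omega>)) = 0" "(LINT \<omega>|P. f (Z t \<omega>)) = 0" for s t
  proof -
    define h where "h = nat (t - s)"
    have h: "1 \<le> real h" "H \<le> h" "t = s + int h" "\<bar>real_of_int (t - s)\<bar> = real h"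
      using that by (auto simp: h_def H_def)
    have "level_dependence P (\<lambda>\<omega>. f (Z s \<omega>)) (\<lambda>\<omega>. f (Z t \<omega>)) (c / real h ^ 4)"
      unfolding level_dependence_def
      by (intro allI, rule order_trans[OF mixing_coeff_ge[where t = s and h = h] mc[OF h(2)]]; 
          rule level_set_gen_sigma[OF _ f]; use h(3) in simp)
    \<comment> \<open>truncation at the lag itself: \<open>h\<^sup>2\<close> times a coefficient of order \<open>h\<^bsup>-4\<^esup>\<close>, plus a tail of order \<open>h\<^bsup>-2\<^esup>\<close>\<close>
    from covariance_fourth_moments[OF P fZ fZ _ _ i4 i4 K K m this, of "real h"]
    have "\<bar>LINT \<omega>|P. f (Z s \<omega>) * f (Z t \<omega>)\<bar> \<le> 4 * (real h)\<^sup>2 * (c / real h ^ 4) + 5 * K / (real h)\<^sup>2"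
      using h(1) c by simp
    also have "\<dots> = (4 * c + 5 * K) / (real h)\<^sup>2" using h(1) by (simp add: field_simps eval_nat_numeral)
    also have "\<dots> \<le> (4 * (4 * c + 5 * K)) / (1 + real h)\<^sup>2"
    proof -
      have "(1 + real h)\<^sup>2 \<le> (2 * real h)\<^sup>2" using h(1) by (intro power_mono) auto
      hence "(1 + real h)\<^sup>2 * (4 * c + 5 * K) \<le> (2 * real h)\<^sup>2 * (4 * c + 5 * K)" using c K0 by (intro mult_right_mono) auto
      thus ?thesis using h(1) by (simp add: field_simps power_mult_distrib)
    qed
    also have "\<dots> \<le> C / (1 + real h)\<^sup>2" using c K0 by (intro divide_right_mono) (auto simp: C_def)
    finally show ?thesis unfolding h(4) .
  qed
  have near: "\<bar>LINT \<omega>|P. f (Z s \<omega>) * f (Z t \<omega>)\<bar> \<le> C / (1 + \<bar>of_int (t - s)\<bar>)\<^sup>2"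
    if "\<bar>t - s\<bar> \<le> int H" for s t
  proof -
    have le: "\<bar>f (Z s \<omega>) * f (Z t \<omega>)\<bar> \<le> 1 + f (Z s \<omega>) ^ 4 + f (Z t \<omega>) ^ 4" for \<omega> by (rule mult_le_fourth_powers)
    have "\<bar>LINT \<omega>|P. f (Z s \<omega>) * f (Z t \<omega>)\<bar> \<le> (LINT \<omega>|P. \<bar>f (Z s \<omega>) * f (Z t \<omega>)\<bar>)" by (rule integral_abs_bound)
    also have "\<dots> \<le> (LINT \<omega>|P. 1 + f (Z s \<omega>) ^ 4 + f (Z t \<omega>) ^ 4)"
      by (rule Bochner_Integration.integral_mono_AE') (use le i4 in auto)
    also have "\<dots> \<le> 1 + K + K" using i4 K[of s] K[of t] by (simp add: prob_space)
    also have "\<dots> = (1 + 2 * K) * (1 + real H)\<^sup>2 / (1 + real H)\<^sup>2" by simp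
    also have "\<dots> \<le> (1 + 2 * K) * (1 + real H)\<^sup>2 / (1 + \<bar>of_int (t - s)\<bar>)\<^sup>2"
    proof -
      have "\<bar>real_of_int (t - s)\<bar> \<le> real H" using that by linarith
      hence "(1 + \<bar>real_of_int (t - s)\<bar>)\<^sup>2 \<le> (1 + real H)\<^sup>2" by (intro power_mono) auto
      thus ?thesis using K0 by (intro divide_left_mono) (auto intro!: mult_pos_pos zero_less_power)
    qed
    also have "\<dots> \<le> C / (1 + \<bar>of_int (t - s)\<bar>)\<^sup>2" using c K0 by (intro divide_right_mono) (auto simp: C_def)
    finally show ?thesis .
  qed
  have "0 \<le> C" using c K0 by (simp add: C_def)
  moreover have "\<bar>LINT \<omega>|P. f (Z s \<omega>) * f (Z t \<omega>)\<bar> \<le> C / (1 + \<bar>of_int (t - s)\<bar>)\<^sup>2"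
    if m: "(LINT \<omega>|P. f (Z s \<omega>)) = 0" "(LINT \<omega>|P. f (Z t \<omega>)) = 0" for s t
  proof -
    consider "\<bar>t - s\<bar> \<le> int H" | "s \<le> t" "H \<le> nat (t - s)" | "t \<le> s" "H \<le> nat (s - t)" by linarith
    thus ?thesis
    proof cases
      case 1 thus ?thesis by (rule near)
    next
      case 2 thus ?thesis using m by (rule far)
    next
      case 3 thus ?thesis using far[OF 3 m(2) m(1)] by (simp add: mult.commute abs_minus_commute)
    qed
  qed
  ultimately show ?thesis by (rule that)
qed

section \<open>Linear growth of the variance of partial sums\<close>

lemma sum_inverse_squares_le: "(\<Sum>h<n. 1 / (1 + real h)\<^sup>2) \<le> 2"
proof -
  \<comment> \<open>The correction makes the induction close, by telescoping.\<close>
  have "(\<Sum>h<Suc n. 1 / (1 + real h)\<^sup>2) \<le> 2 - 1 / real (Suc n)" for n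
  proof (induction n)
    case (Suc n)
    have "1 / (2 + real n)\<^sup>2 \<le> 1 / ((1 + real n) * (2 + real n))"
      by (intro divide_left_mono) (auto simp: power2_eq_square intro!: mult_right_mono)
    also have "\<dots> = 1 / (1 + real n) - 1 / (2 + real n)" by (simp add: field_simps)
    finally show ?case using Suc by simp
  qed simp
  moreover have "(\<Sum>h<n. 1 / (1 + real h)\<^sup>2) \<le> (\<Sum>h<Suc n. 1 / (1 + real h)\<^sup>2)" by simp
  moreover have "0 \<le> 1 / real (Suc n)" by simp
  ultimately show ?thesis by (meson diff_le_eq order_trans le_add_same_cancel1)
qed

lemma sum_inverse_square_distances_le: "(\<Sum>j<l. 1 / (1 + \<bar>real j - real i\<bar>)\<^sup>2) \<le> 4"
proof -
  let ?g = "\<lambda>h. 1 / (1 + real h)\<^sup>2"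
  have "(\<Sum>j<l. 1 / (1 + \<bar>real j - real i\<bar>)\<^sup>2) \<le> (\<Sum>j\<in>{..i} \<union> {i<..<i + l}. 1 / (1 + \<bar>real j - real i\<bar>)\<^sup>2)"
    by (intro sum_mono2) auto
  also have "\<dots> = (\<Sum>j\<in>{..i}. 1 / (1 + \<bar>real j - real i\<bar>)\<^sup>2) + (\<Sum>j\<in>{i<..<i + l}. 1 / (1 + \<bar>real j - real i\<bar>)\<^sup>2)"
    by (intro sum.union_disjoint) auto
  also have "(\<Sum>j\<in>{..i}. 1 / (1 + \<bar>real j - real i\<bar>)\<^sup>2) = (\<Sum>h<Suc i. ?g h)"
    by (rule sum.reindex_bij_witness[of _ "\<lambda>h. i - h" "\<lambda>j. i - j"]) (auto simp: of_nat_diff)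
  also have "(\<Sum>j\<in>{i<..<i + l}. 1 / (1 + \<bar>real j - real i\<bar>)\<^sup>2) = (\<Sum>h\<in>{0<..<l}. ?g h)"
    by (rule sum.reindex_bij_witness[of _ "\<lambda>h. i + h" "\<lambda>j. j - i"]) (auto simp: of_nat_diff)
  also have "(\<Sum>h\<in>{0<..<l}. ?g h) \<le> (\<Sum>h<l. ?g h)" by (intro sum_mono2) auto
  finally show ?thesis using sum_inverse_squares_le[of "Suc i"] sum_inverse_squares_le[of l] by linarith
qed

text \<open>Summable covariances bound each row of the double sum by 4 C. The weights serve to
  restrict a series to the sample or to multiply it by a bounded trend, and they must vanish where
  the mean is not zero.\<close>

lemma weighted_psum_variance:
  fixes X :: "int \<Rightarrow> 'a \<Rightarrow> real" and wt :: "int \<Rightarrow> real"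
  assumes int: "\<And>s t. integrable P (\<lambda>\<omega>. X s \<omega> * X t \<omega>)" and C: "0 \<le> C"
    and cov: "\<And>s t. (LINT \<omega>|P. X s \<omega>) = 0 \<Longrightarrow> (LINT \<omega>|P. X t \<omega>) = 0 \<Longrightarrow>
     \<bar>LINT \<omega>|P. X s \<omega> * X t \<omega>\<bar> \<le> C / (1 + \<bar>of_int (t - s)\<bar>)\<^sup>2"
    and wt: "\<And>t. \<bar>wt t\<bar> \<le> 1" "\<And>t. wt t \<noteq> 0 \<Longrightarrow> (LINT \<omega>|P. X t \<omega>) = 0"
  shows "linear_variance P (4 * C) (\<lambda>\<omega> t. wt t * X t \<omega>)"
  unfolding linear_variance_def
proof (intro allI conjI)
  fix a l
  let ?c = "\<lambda>i j. wt (a + int i) * wt (a + int j)"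
  have eq: "(psum (\<lambda>t. wt t * X t \<omega>) a l)\<^sup>2 = (\<Sum>i<l. \<Sum>j<l. ?c i j * (X (a + int i) \<omega> * X (a + int j) \<omega>))" for \<omega>
    by (simp add: psum_def power2_eq_square sum_product mult_ac)
  show "integrable P (\<lambda>\<omega>. (psum (\<lambda>t. wt t * X t \<omega>) a l)\<^sup>2)" unfolding eq using int by auto
  have "(LINT \<omega>|P. (psum (\<lambda>t. wt t * X t \<omega>) a l)\<^sup>2) = (\<Sum>i<l. \<Sum>j<l. ?c i j * (LINT \<omega>|P. X (a + int i) \<omega> * X (a + int j) \<omega>))"
    unfolding eq using int by simp
  also have "\<dots> \<le> (\<Sum>i<l. \<Sum>j<l. C * (1 / (1 + \<bar>real j - real i\<bar>)\<^sup>2))"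
  proof (intro sum_mono)
    fix i j
    let ?E = "LINT \<omega>|P. X (a + int i) \<omega> * X (a + int j) \<omega>"
    show "?c i j * ?E \<le> C * (1 / (1 + \<bar>real j - real i\<bar>)\<^sup>2)"
    proof (cases "wt (a + int i) = 0 \<or> wt (a + int j) = 0")
      case False
      hence E: "\<bar>?E\<bar> \<le> C / (1 + \<bar>real j - real i\<bar>)\<^sup>2"
        using cov[of "a + int i" "a + int j"] wt(2) by simp
      have "?c i j * ?E \<le> \<bar>?c i j\<bar> * \<bar>?E\<bar>" by (metis abs_ge_self abs_mult)
      also have "\<dots> \<le> 1 * \<bar>?E\<bar>" using wt(1) by (intro mult_right_mono) (auto simp: abs_mult intro: mult_le_one)
      finally show ?thesis using E by simp
    qed (use C in auto)
  qed
  also have "\<dots> = (\<Sum>i<l. C * (\<Sum>j<l. 1 / (1 + \<bar>real j - real i\<bar>)\<^sup>2))" by (simp only: sum_distrib_left)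
  also have "\<dots> \<le> (\<Sum>i<l. C * 4)" by (intro sum_mono mult_left_mono sum_inverse_square_distances_le C)
  finally show "(LINT \<omega>|P. (psum (\<lambda>t. wt t * X t \<omega>) a l)\<^sup>2) \<le> 4 * C * real l" by (simp add: mult_ac)
qed

section \<open>Convergence in probability\<close>

lemma o_p1E:
  assumes "o_p1 P X" "\<epsilon> > 0"
  obtains A where "\<And>T. A T \<in> sets P" "\<And>T. {\<omega> \<in> space P. \<epsilon> < \<bar>X T \<omega>\<bar>} \<subseteq> A T" "(\<lambda>T. measure P (A T)) \<longlonglongrightarrow> 0"
proof -
  have "\<exists>A. (\<forall>T. A T \<in> sets P \<and> {\<omega> \<in> space P. \<epsilon> < \<bar>X T \<omega>\<bar>} \<subseteq> A T) \<and> (\<lambda>T. measure P (A T)) \<longlonglongrightarrow> 0"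
    by (rule assms(1)[unfolded o_p1_def, rule_format, OF assms(2)])
  then obtain A where "\<forall>T. A T \<in> sets P \<and> {\<omega> \<in> space P. \<epsilon> < \<bar>X T \<omega>\<bar>} \<subseteq> A T" "(\<lambda>T. measure P (A T)) \<longlonglongrightarrow> 0"
    by (elim exE conjE)
  thus ?thesis by (intro that[of A]) auto
qed

text \<open>For the finitely many T before the domination sets in, the whole space is taken as
  exceptional set. X may be nonmeasurable, as its exceptional sets are those of Y.\<close>

lemma o_p1_dominated:
  assumes P: "prob_space P" and Y: "o_p1 P Y"
    and le: "\<forall>\<^sub>F T in sequentially. \<forall>\<omega>\<in>space P. \<bar>X T \<omega>\<bar> \<le> \<bar>Y T \<omega>\<bar>"
  shows "o_p1 P X"
  unfolding o_p1_def
proof (intro allI impI)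
  fix \<epsilon> :: real assume "\<epsilon> > 0"
  then obtain A where A: "\<And>T. A T \<in> sets P" "\<And>T. {\<omega> \<in> space P. \<epsilon> < \<bar>Y T \<omega>\<bar>} \<subseteq> A T" "(\<lambda>T. measure P (A T)) \<longlonglongrightarrow> 0"
    using o_p1E[OF Y] by metis
  obtain T0 where T0: "\<And>T \<omega>. T0 \<le> T \<Longrightarrow> \<omega> \<in> space P \<Longrightarrow> \<bar>X T \<omega>\<bar> \<le> \<bar>Y T \<omega>\<bar>"
    using le by (auto simp: eventually_sequentially)
  define A' where "A' T = (if T0 \<le> T then A T else space P)" for T
  have 1: "A' T \<in> sets P \<and> {\<omega> \<in> space P. \<epsilon> < \<bar>X T \<omega>\<bar>} \<subseteq> A' T" for T
    using A(1,2)[of T] T0[of T] by (fastforce simp: A'_def)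
  have 2: "(\<lambda>T. measure P (A' T)) \<longlonglongrightarrow> 0"
    by (rule Lim_transform_eventually[OF A(3)]) (auto simp: eventually_sequentially A'_def)
  show "\<exists>A. (\<forall>T. A T \<in> sets P \<and> {\<omega> \<in> space P. \<epsilon> < \<bar>X T \<omega>\<bar>} \<subseteq> A T) \<and> (\<lambda>T. measure P (A T)) \<longlonglongrightarrow> 0"
    by (rule exI[of _ A'], rule conjI, rule allI, rule 1, rule 2)
qed

text \<open>The premise is that h vanishes continuously at the origin. One argument then serves
  sums, products, multiples and roots; the unary maps use it with Y = X.\<close>

lemma o_p1_combine:
  assumes P: "prob_space P" and X: "o_p1 P X" and Y: "o_p1 P Y"
    and h: "\<And>\<epsilon> :: real. \<epsilon> > 0 \<Longrightarrow> \<exists>\<epsilon>1>0. \<exists>\<epsilon>2>0. \<forall>x y. \<bar>x\<bar> \<le> \<epsilon>1 \<longrightarrow> \<bar>y\<bar> \<le> \<epsilon>2 \<longrightarrow> \<bar>h x y\<bar> \<le> \<epsilon>"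
  shows "o_p1 P (\<lambda>T \<omega>. h (X T \<omega>) (Y T \<omega>))"
  unfolding o_p1_def
proof (intro allI impI)
  interpret prob_space P by (rule P)
  fix \<epsilon> :: real assume "\<epsilon> > 0"
  then obtain e1 e2 where e: "e1 > 0" "e2 > 0" "\<And>x y. \<bar>x\<bar> \<le> e1 \<Longrightarrow> \<bar>y\<bar> \<le> e2 \<Longrightarrow> \<bar>h x y\<bar> \<le> \<epsilon>"
    using h by meson
  obtain A where A: "\<And>T. A T \<in> sets P" "\<And>T. {\<omega> \<in> space P. e1 < \<bar>X T \<omega>\<bar>} \<subseteq> A T" "(\<lambda>T. measure P (A T)) \<longlonglongrightarrow> 0"
    using o_p1E[OF X e(1)] by metis
  obtain B where B: "\<And>T. B T \<in> sets P" "\<And>T. {\<omega> \<in> space P. e2 < \<bar>Y T \<omega>\<bar>} \<subseteq> B T" "(\<lambda>T. measure P (B T)) \<longlonglongrightarrow> 0"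
    using o_p1E[OF Y e(2)] by metis
  have "A T \<union> B T \<in> sets P \<and> {\<omega> \<in> space P. \<epsilon> < \<bar>h (X T \<omega>) (Y T \<omega>)\<bar>} \<subseteq> A T \<union> B T" for T
    using A(1,2)[of T] B(1,2)[of T] e(3) by (fastforce simp: not_le[symmetric])
  moreover have "(\<lambda>T. measure P (A T \<union> B T)) \<longlonglongrightarrow> 0"
  proof (rule tendsto_sandwich[OF _ _ tendsto_const])
    show "(\<lambda>T. measure P (A T) + measure P (B T)) \<longlonglongrightarrow> 0" using tendsto_add[OF A(3) B(3)] by simp
    show "\<forall>\<^sub>F T in sequentially. measure P (A T \<union> B T) \<le> measure P (A T) + measure P (B T)"
      using A(1) B(1) by (intro always_eventually allI measure_Un_le) auto
  qed auto
  ultimately show "\<exists>A. (\<forall>T. A T \<in> sets P \<and> {\<omega> \<in> space P. \<epsilon> < \<bar>h (X T \<omega>) (Y T \<omega>)\<bar>} \<subseteq> A T) \<and> (\<lambda>T. measure P (A T)) \<longlonglongrightarrow> 0"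
    by (intro exI[of _ "\<lambda>T. A T \<union> B T"] conjI) blast+
qed

lemma o_p1_zero: "o_p1 P (\<lambda>T \<omega>. 0)"
  unfolding o_p1_def by (auto intro!: exI[of _ "\<lambda>_. {}"])

lemma o_p1_add:
  assumes "prob_space P" "o_p1 P X" "o_p1 P Y" shows "o_p1 P (\<lambda>T \<omega>. X T \<omega> + Y T \<omega>)"
proof (rule o_p1_combine[OF assms, where h = "(+)"])
  fix e :: real assume e: "e > 0"
  have "\<bar>x + y\<bar> \<le> e" if "\<bar>x\<bar> \<le> e / 2" "\<bar>y\<bar> \<le> e / 2" for x y :: real using that by linarith
  thus "\<exists>e1>0. \<exists>e2>0. \<forall>x y. \<bar>x\<bar> \<le> e1 \<longrightarrow> \<bar>y\<bar> \<le> e2 \<longrightarrow> \<bar>x + y\<bar> \<le> e" using e half_gt_zero by blast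
qed

lemma o_p1_mult:
  assumes "prob_space P" "o_p1 P X" "o_p1 P Y" shows "o_p1 P (\<lambda>T \<omega>. X T \<omega> * Y T \<omega>)"
proof (rule o_p1_combine[OF assms, where h = "(*)"])
  fix e :: real assume e: "e > 0"
  have "\<bar>x * y\<bar> \<le> e" if "\<bar>x\<bar> \<le> e" "\<bar>y\<bar> \<le> 1" for x y :: real 
    using mult_mono[OF that] e by (simp add: abs_mult)
  thus "\<exists>e1>0. \<exists>e2>0. \<forall>x y. \<bar>x\<bar> \<le> e1 \<longrightarrow> \<bar>y\<bar> \<le> e2 \<longrightarrow> \<bar>x * y\<bar> \<le> e" using e zero_less_one by blast
qed

lemma o_p1_cmult:
  assumes "prob_space P" "o_p1 P X" shows "o_p1 P (\<lambda>T \<omega>. c * X T \<omega>)"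
proof (rule o_p1_combine[OF assms(1) assms(2) assms(2), where h = "\<lambda>x y. c * x"])
  fix e :: real assume e: "e > 0"
  have "\<bar>c * x\<bar> \<le> e" if "\<bar>x\<bar> \<le> e / (1 + \<bar>c\<bar>)" for x :: real
  proof -
    have "\<bar>c\<bar> * \<bar>x\<bar> \<le> (1 + \<bar>c\<bar>) * (e / (1 + \<bar>c\<bar>))" using that e by (intro mult_mono) auto
    thus ?thesis by (simp add: abs_mult add_pos_nonneg)
  qed
  moreover have "0 < e / (1 + \<bar>c\<bar>)" using e by (simp add: add_pos_nonneg)
  ultimately show "\<exists>e1>0. \<exists>e2>0. \<forall>x (y :: real). \<bar>x\<bar> \<le> e1 \<longrightarrow> \<bar>y\<bar> \<le> e2 \<longrightarrow> \<bar>c * x\<bar> \<le> e"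
    by (intro exI[of _ "e / (1 + \<bar>c\<bar>)"] exI[of _ 1] conjI) auto
qed

lemma o_p1_sqrt:
  assumes "prob_space P" "o_p1 P X" shows "o_p1 P (\<lambda>T \<omega>. sqrt (X T \<omega>))"
proof (rule o_p1_combine[OF assms(1) assms(2) assms(2), where h = "\<lambda>x y. sqrt x"])
  fix e :: real assume e: "e > 0"
  have "\<bar>sqrt x\<bar> \<le> e" if "\<bar>x\<bar> \<le> e\<^sup>2" for x :: real
  proof -
    have "\<bar>sqrt x\<bar> = sqrt \<bar>x\<bar>" by (simp add: real_sqrt_abs2 abs_if real_sqrt_minus)
    also have "\<dots> \<le> sqrt (e\<^sup>2)" using that by (rule real_sqrt_le_mono)
    finally show ?thesis using e by simp
  qed
  moreover have "0 < e\<^sup>2" using e by simp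
  ultimately show "\<exists>e1>0. \<exists>e2>0. \<forall>x (y :: real). \<bar>x\<bar> \<le> e1 \<longrightarrow> \<bar>y\<bar> \<le> e2 \<longrightarrow> \<bar>sqrt x\<bar> \<le> e"
    by (intro exI[of _ "e\<^sup>2"] exI[of _ 1] conjI) auto
qed

lemma o_p1_sum:
  assumes "prob_space P" "\<And>i. i \<in> I \<Longrightarrow> o_p1 P (X i)" shows "o_p1 P (\<lambda>T \<omega>. \<Sum>i\<in>I. X i T \<omega>)"
  using assms(2)
proof (induction I rule: infinite_finite_induct)
  case (insert i I)
  thus ?case using o_p1_add[OF assms(1), of "X i" "\<lambda>T \<omega>. \<Sum>i\<in>I. X i T \<omega>"] by simp
qed (simp_all add: o_p1_zero)

lemma o_p1_markov:
  assumes P: "prob_space P" and b: "b \<longlonglongrightarrow> 0"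
    and ev: "\<forall>\<^sub>F T in sequentially. integrable P (X T) \<and> (\<forall>\<omega>\<in>space P. 0 \<le> X T \<omega>) \<and> (LINT \<omega>|P. X T \<omega>) \<le> b T"
  shows "o_p1 P X"
  unfolding o_p1_def
proof (intro allI impI)
  interpret prob_space P by (rule P)
  fix \<epsilon> :: real assume e: "\<epsilon> > 0"
  obtain T0 where T0: "\<And>T. T0 \<le> T \<Longrightarrow> integrable P (X T)" "\<And>T \<omega>. T0 \<le> T \<Longrightarrow> \<omega> \<in> space P \<Longrightarrow> 0 \<le> X T \<omega>"
    "\<And>T. T0 \<le> T \<Longrightarrow> (LINT \<omega>|P. X T \<omega>) \<le> b T"
    using ev unfolding eventually_sequentially by blast
  define A where "A T = (if T0 \<le> T then {\<omega> \<in> space P. \<epsilon> \<le> X T \<omega>} else space P)" for T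
  have "A T \<in> sets P" for T
  proof (cases "T0 \<le> T")
    case True
    have [measurable]: "X T \<in> borel_measurable P" using T0(1)[OF True] by auto
    show ?thesis unfolding A_def by simp
  qed (simp add: A_def)
  moreover have "{\<omega> \<in> space P. \<epsilon> < \<bar>X T \<omega>\<bar>} \<subseteq> A T" for T
    using T0(2) by (fastforce simp: A_def)
  moreover have "(\<lambda>T. measure P (A T)) \<longlonglongrightarrow> 0"
  proof (rule tendsto_sandwich[OF _ _ tendsto_const])
    show "(\<lambda>T. b T / \<epsilon>) \<longlonglongrightarrow> 0" using tendsto_divide[OF b tendsto_const, of \<epsilon>] e by simp
    have "measure P (A T) \<le> b T / \<epsilon>" if T: "T0 \<le> T" for T
    proof -
      have "measure P {\<omega> \<in> space P. \<epsilon> \<le> X T \<omega>} \<le> (LINT \<omega>|P. X T \<omega>) / \<epsilon>"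
        by (rule integral_Markov_inequality_measure[where A = "{}"]) (use T0 T e in \<open>auto intro!: AE_I2\<close>)
      also have "\<dots> \<le> b T / \<epsilon>" using T0(3)[OF T] e by (intro divide_right_mono) auto
      finally show ?thesis using T by (simp add: A_def)
    qed
    thus "\<forall>\<^sub>F T in sequentially. measure P (A T) \<le> b T / \<epsilon>" unfolding eventually_sequentially by blast
  qed auto
  ultimately show "\<exists>A. (\<forall>T. A T \<in> sets P \<and> {\<omega> \<in> space P. \<epsilon> < \<bar>X T \<omega>\<bar>} \<subseteq> A T) \<and> (\<lambda>T. measure P (A T)) \<longlonglongrightarrow> 0"
    by (intro exI[of _ A] conjI) blast+
qed

text \<open>W need not have moments, so Markov's inequality is out of reach; dominated convergence
  of indicators replaces it. The case in view is the starting value of w.\<close>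

lemma o_p1_fixed:
  assumes P: "prob_space P" and a: "a \<longlonglongrightarrow> 0" and W: "W \<in> borel_measurable P"
  shows "o_p1 P (\<lambda>T \<omega>. a T * W \<omega>)"
  unfolding o_p1_def
proof (intro allI impI)
  interpret prob_space P by (rule P)
  fix \<epsilon> :: real assume e: "\<epsilon> > 0"
  note [measurable] = W
  define A where "A T = {\<omega> \<in> space P. \<epsilon> < \<bar>a T * W \<omega>\<bar>}" for T
  have A[measurable]: "A T \<in> sets P" for T unfolding A_def by measurable
  have "(\<lambda>T. LINT \<omega>|P. indicator (A T) \<omega>) \<longlonglongrightarrow> (LINT \<omega>|P. 0 :: real)"
  proof (rule integral_dominated_convergence[where w = "\<lambda>_. 1"])
    have "(\<lambda>T. indicator (A T) \<omega> :: real) \<longlonglongrightarrow> 0" for \<omega>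
    proof (rule tendsto_eventually)
      have "(\<lambda>T. \<bar>a T * W \<omega>\<bar>) \<longlonglongrightarrow> 0" using tendsto_rabs[OF tendsto_mult[OF a tendsto_const, of "W \<omega>"]] by simp
      hence "\<forall>\<^sub>F T in sequentially. \<bar>a T * W \<omega>\<bar> < \<epsilon>" using e by (rule order_tendstoD(2))
      thus "\<forall>\<^sub>F T in sequentially. indicator (A T) \<omega> = (0 :: real)" by eventually_elim (auto simp: A_def)
    qed
    thus "AE \<omega> in P. (\<lambda>T. indicator (A T) \<omega> :: real) \<longlonglongrightarrow> 0" by simp
  qed (auto simp: indicator_def)
  hence "(\<lambda>T. measure P (A T)) \<longlonglongrightarrow> 0" using A sets.sets_into_space[OF A] by (simp add: Int_absorb2)
  thus "\<exists>A. (\<forall>T. A T \<in> sets P \<and> {\<omega> \<in> space P. \<epsilon> < \<bar>a T * W \<omega>\<bar>} \<subseteq> A T) \<and> (\<lambda>T. measure P (A T)) \<longlonglongrightarrow> 0"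
    using A by (intro exI[of _ A]) (auto simp: A_def)
qed

text \<open>With N the rounded-up M v^(-2), 2^k covers the 2 N + 1 dates within distance N of a
  break and is at most 4 N + 4. The rate condition enters twice: it gives v^(-2) <= T eventually,
  hence k of order log T, and then it sends k^2 v^(-2) / T to 0.\<close>

lemma window_rate:
  fixes v :: "nat \<Rightarrow> real"
  assumes v: "\<And>T. v T > 0" "v \<longlonglongrightarrow> 0"
    and rate: "filterlim (\<lambda>T. sqrt (real T) * v T / ln (real T)) at_top sequentially" and M: "M > 0"
  obtains k :: "nat \<Rightarrow> nat" where
    "\<And>T. 2 * \<lceil>M * v T powr (- 2)\<rceil> + 1 \<le> 2 ^ k T"
    "(\<lambda>T. (real (k T + 1))\<^sup>2 * 2 ^ k T / real T) \<longlonglongrightarrow> 0"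
    "(\<lambda>T. (v T * real T powr (- (1 / 2)) + (real T powr (- (1 / 2)))\<^sup>2) * 2 ^ k T) \<longlonglongrightarrow> 0"
proof -
  define N where "N T = nat \<lceil>M * v T powr (- 2)\<rceil>" for T
  have "\<exists>k. 2 * N T + 2 \<le> 2 ^ k \<and> 2 ^ k \<le> 4 * N T + 4" for T
  proof -
    obtain n where "2 ^ n < 2 * N T + 2" "2 * N T + 2 \<le> 2 ^ (n + 1)"
      using ex_power_ivl2[of 2 "2 * N T + 2"] by auto
    thus ?thesis by (intro exI[of _ "n + 1"]) auto
  qed
  then obtain k where k: "\<And>T. 2 * N T + 2 \<le> 2 ^ k T" "\<And>T. 2 ^ k T \<le> 4 * N T + 4" by metis
  \<comment> \<open>From 4 N + 4 <= 4 M v^(-2) + 8 and v < 1.\<close>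
  define c where "c = 4 * M + 8"
  define r where "r T = sqrt (real T) * v T / ln (real T)" for T
  have c: "c > 0" using M by (simp add: c_def)
  have rinv: "(\<lambda>T. inverse (r T)) \<longlonglongrightarrow> 0" using rate unfolding r_def by (rule tendsto_inverse_0_at_top)
  have ev: "\<forall>\<^sub>F T in sequentially. v T < 1 \<and> 1 \<le> r T \<and> c + 3 \<le> real T"
  proof (intro eventually_conj)
    show "\<forall>\<^sub>F T in sequentially. v T < 1" using order_tendstoD(2)[OF v(2), of 1] by simp
    show "\<forall>\<^sub>F T in sequentially. 1 \<le> r T" using rate unfolding r_def filterlim_at_top by blast
    show "\<forall>\<^sub>F T in sequentially. c + 3 \<le> real T" using filterlim_real_sequentially unfolding filterlim_at_top by blast
  qed
  have key: "real (k T + 1) \<le> 4 * ln (real T) \<and> 2 ^ k T \<le> c / (v T)\<^sup>2 \<and> 1 \<le> ln (real T)" 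
    if T: "v T < 1" "1 \<le> r T" "c + 3 \<le> real T" for T
  proof -
    have T3: "3 \<le> real T" using T c by simp
    have "exp 1 \<le> (3 :: real)" by (rule exp_le)
    hence "exp 1 \<le> real T" using T3 by linarith
    hence ln1: "1 \<le> ln (real T)" using T3 by (subst ln_ge_iff) auto
    have vp: "v T powr (- 2) = 1 / (v T)\<^sup>2" using v(1)[of T] by (simp add: powr_minus_divide)
    have v1: "1 \<le> 1 / (v T)\<^sup>2" using v(1)[of T] T(1) by (simp add: power_le_one)
    have "real (N T) \<le> M * (1 / (v T)\<^sup>2) + 1"
      unfolding N_def vp using M by (simp add: of_nat_nat ceiling_correct less_imp_le)
    hence "4 * real (N T) + 4 \<le> (4 * M) * (1 / (v T)\<^sup>2) + 8 * (1 / (v T)\<^sup>2)" using v1 by linarith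
    moreover have "(2 :: real) ^ k T \<le> 4 * real (N T) + 4"
    proof -
      have "real (2 ^ k T) \<le> real (4 * N T + 4)" using k(2)[of T] by (simp only: of_nat_le_iff)
      thus ?thesis by simp
    qed
    ultimately have 2: "2 ^ k T \<le> c / (v T)\<^sup>2" by (simp add: c_def add_divide_distrib)
    have "ln (real T) \<le> sqrt (real T) * v T" using T(2) ln1 by (simp add: r_def field_simps)
    hence "1 \<le> sqrt (real T) * v T" using ln1 by linarith
    hence "1 \<le> (sqrt (real T) * v T)\<^sup>2" by (simp add: one_le_power)
    hence "1 / (v T)\<^sup>2 \<le> real T" using v(1)[of T] by (simp add: field_simps power_mult_distrib)
    hence "c * (1 / (v T)\<^sup>2) \<le> c * real T" using c by (intro mult_left_mono) auto
    hence "2 ^ k T \<le> c * real T" using 2 by simp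
    \<comment> \<open>The crude T^2 suffices, as only the logarithm of 2^k is used; with ln 2 >= 2/3
      it leads to k <= 3 ln T.\<close>
    also have "\<dots> \<le> real T * real T" using T c by (intro mult_right_mono) auto
    finally have "ln (2 ^ k T) \<le> ln (real T * real T)" by (intro ln_mono) (use T3 in auto)
    hence kl: "real (k T) * ln 2 \<le> 2 * ln (real T)" using T3 by (simp add: ln_mult ln_realpow)
    have "real (k T) * (2 / 3) \<le> real (k T) * ln 2" using ln2_ge_two_thirds by (intro mult_left_mono) auto
    hence "real (k T) \<le> 3 * ln (real T)" using kl by linarith
    thus ?thesis using ln1 2 by simp
  qed
  have lim2: "(\<lambda>T. (16 * c) * (inverse (r T))\<^sup>2) \<longlonglongrightarrow> 0" 
    using tendsto_mult[OF tendsto_const tendsto_power[OF rinv, of 2], of "16 * c"] by simp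
  have lim1: "(\<lambda>T. c * inverse (r T) + c * (inverse (r T))\<^sup>2) \<longlonglongrightarrow> 0"
    using tendsto_add[OF tendsto_mult[OF tendsto_const rinv, of c] tendsto_mult[OF tendsto_const tendsto_power[OF rinv, of 2], of c]] by simp
  show ?thesis
  proof
    show "2 * \<lceil>M * v T powr (- 2)\<rceil> + 1 \<le> 2 ^ k T" for T
    proof -
      have "int (2 * N T + 2) \<le> int (2 ^ k T)" using k(1)[of T] by (simp only: of_nat_le_iff)
      moreover have "\<lceil>M * v T powr (- 2)\<rceil> \<le> int (N T)" by (simp add: N_def)
      ultimately show ?thesis by simp
    qed
    show "(\<lambda>T. (real (k T + 1))\<^sup>2 * 2 ^ k T / real T) \<longlonglongrightarrow> 0"
    proof (rule tendsto_sandwich[OF _ _ tendsto_const lim2])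
      show "\<forall>\<^sub>F T in sequentially. (real (k T + 1))\<^sup>2 * 2 ^ k T / real T \<le> (16 * c) * (inverse (r T))\<^sup>2"
        using ev
      proof eventually_elim
        case (elim T)
        note K = key[of T] 
        have "(real (k T + 1))\<^sup>2 * 2 ^ k T \<le> (4 * ln (real T))\<^sup>2 * (c / (v T)\<^sup>2)"
          using K elim by (intro mult_mono power_mono) auto
        hence "(real (k T + 1))\<^sup>2 * 2 ^ k T / real T \<le> (4 * ln (real T))\<^sup>2 * (c / (v T)\<^sup>2) / real T"
          by (intro divide_right_mono) auto
        also have "\<dots> = (16 * c) * (inverse (r T))\<^sup>2"
          by (simp add: r_def field_simps power_mult_distrib power_divide)
        finally show ?case .
      qed
    qed auto
    show "(\<lambda>T. (v T * real T powr (- (1 / 2)) + (real T powr (- (1 / 2)))\<^sup>2) * 2 ^ k T) \<longlonglongrightarrow> 0"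
    proof (rule tendsto_sandwich[OF _ _ tendsto_const lim1])
      show "\<forall>\<^sub>F T in sequentially. (v T * real T powr (- (1 / 2)) + (real T powr (- (1 / 2)))\<^sup>2) * 2 ^ k T
        \<le> c * inverse (r T) + c * (inverse (r T))\<^sup>2"
        using ev
      proof eventually_elim
        case (elim T)
        note K = key[of T] 
        define s where "s = real T powr (- (1 / 2))"
        have T0: "0 < real T" using elim c by linarith
        have s: "s = 1 / sqrt (real T)" using T0 by (simp add: s_def powr_minus_divide powr_half_sqrt)
        have s0: "0 < s" using s T0 by simp
        have "(v T * s + s\<^sup>2) * 2 ^ k T \<le> (v T * s + s\<^sup>2) * (c / (v T)\<^sup>2)"
          using K elim v(1)[of T] s0 by (intro mult_left_mono) auto
        also have "\<dots> = c * (s / v T) + c * (s / v T)\<^sup>2"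
          using v(1)[of T] by (simp add: field_simps power2_eq_square)
        also have "\<dots> \<le> c * inverse (r T) + c * (inverse (r T))\<^sup>2"
        proof -
          have "inverse (r T) = ln (real T) * (s / v T)" by (simp add: r_def s field_simps)
          moreover have "1 * (s / v T) \<le> ln (real T) * (s / v T)"
            using K elim s0 v(1)[of T] by (intro mult_right_mono) auto
          ultimately have "s / v T \<le> inverse (r T)" by simp
          moreover have "0 \<le> s / v T" using s0 v(1)[of T] by simp
          ultimately show ?thesis using c by (intro add_mono mult_left_mono power_mono) auto
        qed
        finally show ?case by (simp add: s_def)
      qed
    qed (use v(1) in \<open>auto intro!: always_eventually simp: less_imp_le\<close>)
  qed
qed

section \<open>Score and regressor sums near a break\<close>

lemma psum_eq_interval_sum: "psum f a l = (\<Sum>t\<in>{a..<a + int l}. f t)"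
  unfolding psum_def
  by (rule sum.reindex_bij_witness[of _ "\<lambda>t. nat (t - a)" "\<lambda>i. a + int i"]) auto

lemma interval_sum_eq_psum:
  assumes "{c..d} \<subseteq> {a..<a + int n}" "c \<le> d"
  shows "(\<Sum>t\<in>{c..d}. f t) = psum f a (nat (d - a + 1)) - psum f a (nat (c - a))"
proof -
  have "a \<le> c" using assms by auto
  hence "{a..<a + int (nat (d - a + 1))} = {a..<a + int (nat (c - a))} \<union> {c..d}" using assms by auto
  moreover have "{a..<a + int (nat (c - a))} \<inter> {c..d} = {}" using \<open>a \<le> c\<close> by auto
  ultimately show ?thesis unfolding psum_eq_interval_sum by (simp add: sum.union_disjoint)
qed

text \<open>An inner interval is the difference of two initial segments of the window, hence the
  factor 2.\<close>

lemma interval_sum_le: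
  assumes "{c..d} \<subseteq> {a..<a + 2 ^ k}"
  shows "\<bar>\<Sum>t\<in>{c..d}. f t\<bar> \<le> 2 * sqrt (real (k + 1) * dyadic_sq f k a)"
proof (cases "c \<le> d")
  case True
  have le: "\<bar>psum f a l\<bar> \<le> sqrt (real (k + 1) * dyadic_sq f k a)" if "l \<le> 2 ^ k" for l
    using real_sqrt_le_mono[OF psum_le_dyadic_sq[OF that, of f a]] by simp
  have "a \<le> c" "d < a + 2 ^ k" using assms True by auto
  hence "nat (d - a + 1) \<le> 2 ^ k" "nat (c - a) \<le> 2 ^ k" using True by (auto simp: nat_le_iff)
  thus ?thesis using interval_sum_eq_psum[of c d a "2 ^ k" f] assms True
      le[of "nat (d - a + 1)"] le[of "nat (c - a)"] by simp
qed (simp add: dyadic_sq_nonneg)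

lemma interval_iter_le:
  assumes "{c..d} \<subseteq> {a..<a + 2 ^ k}"
  shows "\<bar>\<Sum>t\<in>{c..d}. psum g a (nat (t - a)) * f t\<bar> \<le> 2 * dyadic_iter g f k a"
proof (cases "c \<le> d")
  case True
  let ?h = "\<lambda>t. psum g a (nat (t - a)) * f t"
  have "psum ?h a l = iter_sum g f a l" for l by (simp add: psum_def iter_sum_def)
  hence le: "\<bar>psum ?h a l\<bar> \<le> dyadic_iter g f k a" if "l \<le> 2 ^ k" for l
    using iter_sum_le_dyadic_iter[OF that, of g f a] by simp
  have "a \<le> c" "d < a + 2 ^ k" using assms True by auto
  hence "nat (d - a + 1) \<le> 2 ^ k" "nat (c - a) \<le> 2 ^ k" using True by (auto simp: nat_le_iff)
  thus ?thesis using interval_sum_eq_psum[of c d a "2 ^ k" ?h] assms True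
      le[of "nat (d - a + 1)"] le[of "nat (c - a)"] by simp
qed (simp add: dyadic_iter_nonneg)

text \<open>Centring is a premise at each pair of dates because
  \<open>outer (\<eta> t) (\<eta> t) - mat 1\<close> is known to be centred only for t >= 1.\<close>

definition short_memory :: "'a measure \<Rightarrow> (int \<Rightarrow> 'a \<Rightarrow> real) \<Rightarrow> bool" where
  "short_memory P X \<longleftrightarrow> (\<forall>s t. integrable P (\<lambda>\<omega>. X s \<omega> * X t \<omega>)) \<and>
     (\<exists>C\<ge>0. \<forall>s t. (LINT \<omega>|P. X s \<omega>) = 0 \<longrightarrow> (LINT \<omega>|P. X t \<omega>) = 0 \<longrightarrow>
        \<bar>LINT \<omega>|P. X s \<omega> * X t \<omega>\<bar> \<le> C / (1 + \<bar>of_int (t - s)\<bar>)\<^sup>2)"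

lemma short_memory_cong:
  assumes "\<And>t \<omega>. \<omega> \<in> space P \<Longrightarrow> X t \<omega> = Y t \<omega>" "short_memory P X"
  shows "short_memory P Y"
proof -
  have 1: "(LINT \<omega>|P. X t \<omega>) = (LINT \<omega>|P. Y t \<omega>)" for t
    using assms(1) by (intro Bochner_Integration.integral_cong) auto
  have 2: "(LINT \<omega>|P. X s \<omega> * X t \<omega>) = (LINT \<omega>|P. Y s \<omega> * Y t \<omega>)" for s t
    using assms(1) by (intro Bochner_Integration.integral_cong) auto
  have 3: "integrable P (\<lambda>\<omega>. X s \<omega> * X t \<omega>) \<longleftrightarrow> integrable P (\<lambda>\<omega>. Y s \<omega> * Y t \<omega>)" for s t
    using assms(1) by (intro Bochner_Integration.integrable_cong) auto
  show ?thesis using assms(2) unfolding short_memory_def 1 2 3 .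
qed

text \<open>The exponent (4 + \<kappa>) / \<kappa> exceeds 4 for \<kappa> < 1/2, and moments of
  order 4 + \<kappa> dominate fourth moments.\<close>

lemma mixing_moments_short_memory:
  fixes Z :: "int \<Rightarrow> 'a \<Rightarrow> real^'c^'b"
  assumes P: "prob_space P" and mm: "mixing_moments P \<kappa> Z" and \<kappa>: "0 < \<kappa>" "\<kappa> < 1 / 2"
    and Z: "\<And>t. (\<lambda>\<omega>. Z t \<omega> $ i $ j) \<in> borel_measurable P"
  shows "short_memory P (\<lambda>t \<omega>. Z t \<omega> $ i $ j)"
proof -
  interpret prob_space P by (rule P)
  have mix: "strongly_mixing P ((4 + \<kappa>) / \<kappa>) Z" using mm by (simp add: mixing_moments_def)
  have int: "integrable P (\<lambda>\<omega>. \<bar>Z t \<omega> $ i $ j\<bar> powr (4 + \<kappa>))" for t i j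
    using mm by (auto simp: mixing_moments_def Lr_bounded_def)
  obtain C where C: "\<And>t. Lr_norm P (4 + \<kappa>) (Z t) \<le> C"
    using mm by (auto simp: mixing_moments_def Lr_bounded_def)
  have bd: "(LINT \<omega>|P. \<bar>Z t \<omega> $ i $ j\<bar> powr (4 + \<kappa>)) \<le> C powr (4 + \<kappa>)" for t
  proof -
    define s where "s = (\<Sum>i\<in>UNIV. \<Sum>j\<in>UNIV. (LINT \<omega>|P. \<bar>Z t \<omega> $ i $ j\<bar> powr (4 + \<kappa>)))"
    have "(LINT \<omega>|P. \<bar>Z t \<omega> $ i $ j\<bar> powr (4 + \<kappa>)) \<le> (\<Sum>j\<in>UNIV. (LINT \<omega>|P. \<bar>Z t \<omega> $ i $ j\<bar> powr (4 + \<kappa>)))"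
      by (rule member_le_sum[of j UNIV "\<lambda>j. LINT \<omega>|P. \<bar>Z t \<omega> $ i $ j\<bar> powr (4 + \<kappa>)"]) auto
    also have "\<dots> \<le> s" unfolding s_def
      by (rule member_le_sum[of i UNIV "\<lambda>i. \<Sum>j\<in>UNIV. LINT \<omega>|P. \<bar>Z t \<omega> $ i $ j\<bar> powr (4 + \<kappa>)"]) (auto intro: sum_nonneg)
    also have "s = (s powr (1 / (4 + \<kappa>))) powr (4 + \<kappa>)"
    proof -
      have "0 \<le> s" unfolding s_def by (intro sum_nonneg) auto
      thus ?thesis using \<kappa> by (simp add: powr_powr)
    qed
    also have "\<dots> \<le> C powr (4 + \<kappa>)"
      using C[of t] \<kappa> unfolding Lr_norm_def s_def[symmetric] by (intro powr_mono2) auto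
    finally show ?thesis .
  qed
  have le: "x ^ 4 \<le> 1 + \<bar>x\<bar> powr (4 + \<kappa>)" for x :: real
  proof (cases "\<bar>x\<bar> \<le> 1")
    case True
    have "\<bar>x\<bar> ^ 4 \<le> 1" using True by (intro power_le_one) auto
    thus ?thesis by (simp add: add_increasing2)
  next
    case False
    hence "\<bar>x\<bar> powr 4 \<le> \<bar>x\<bar> powr (4 + \<kappa>)" using \<kappa> by (intro powr_mono) auto
    moreover have "\<bar>x\<bar> powr 4 = x ^ 4" using False by simp
    ultimately show ?thesis by simp
  qed
  have i4: "integrable P (\<lambda>\<omega>. (Z t \<omega> $ i $ j) ^ 4)" for t
  proof (rule Bochner_Integration.integrable_bound[of P "\<lambda>\<omega>. 1 + \<bar>Z t \<omega> $ i $ j\<bar> powr (4 + \<kappa>)"])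
    show "integrable P (\<lambda>\<omega>. 1 + \<bar>Z t \<omega> $ i $ j\<bar> powr (4 + \<kappa>))" using int by simp
    show "(\<lambda>\<omega>. (Z t \<omega> $ i $ j) ^ 4) \<in> borel_measurable P" by (intro borel_measurable_power Z)
    show "AE \<omega> in P. norm ((Z t \<omega> $ i $ j) ^ 4) \<le> norm (1 + \<bar>Z t \<omega> $ i $ j\<bar> powr (4 + \<kappa>))"
      using le by (intro AE_I2) (simp add: add_nonneg_nonneg)
  qed
  have m4: "(LINT \<omega>|P. (Z t \<omega> $ i $ j) ^ 4) \<le> 1 + C powr (4 + \<kappa>)" for t
  proof -
    have "(LINT \<omega>|P. (Z t \<omega> $ i $ j) ^ 4) \<le> (LINT \<omega>|P. 1 + \<bar>Z t \<omega> $ i $ j\<bar> powr (4 + \<kappa>))"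
      using i4 int le by (intro integral_mono) auto
    also have "\<dots> \<le> 1 + C powr (4 + \<kappa>)" using int bd by (simp add: prob_space)
    finally show ?thesis .
  qed
  have a: "4 \<le> (4 + \<kappa>) / \<kappa>" using \<kappa> by (simp add: field_simps)
  have f: "(\<lambda>M :: real^'c^'b. M $ i $ j) \<in> borel_measurable borel" 
    by (intro borel_measurable_continuous_onI continuous_intros)
  obtain C' where C': "0 \<le> C'" "\<And>s t. (LINT \<omega>|P. Z s \<omega> $ i $ j) = 0 \<Longrightarrow> (LINT \<omega>|P. Z t \<omega> $ i $ j) = 0 \<Longrightarrow>
     \<bar>LINT \<omega>|P. Z s \<omega> $ i $ j * Z t \<omega> $ i $ j\<bar> \<le> C' / (1 + \<bar>of_int (t - s)\<bar>)\<^sup>2"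
    by (fact mixing_covariance_decay[OF P mix a f Z i4 m4])
  have "integrable P (\<lambda>\<omega>. Z s \<omega> $ i $ j * Z t \<omega> $ i $ j)" for s t
  proof (rule Bochner_Integration.integrable_bound[of P "\<lambda>\<omega>. 1 + (Z s \<omega> $ i $ j) ^ 4 + (Z t \<omega> $ i $ j) ^ 4"])
    show "(\<lambda>\<omega>. Z s \<omega> $ i $ j * Z t \<omega> $ i $ j) \<in> borel_measurable P" by (intro borel_measurable_times Z)
    show "AE \<omega> in P. norm (Z s \<omega> $ i $ j * Z t \<omega> $ i $ j) \<le> norm (1 + (Z s \<omega> $ i $ j) ^ 4 + (Z t \<omega> $ i $ j) ^ 4)"
      unfolding real_norm_def by (intro AE_I2 order_trans[OF mult_le_fourth_powers abs_ge_self])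
  qed (use i4 in auto)
  thus ?thesis unfolding short_memory_def using C' by blast
qed

text \<open>The constant is chosen before the weights, which later vary with T.\<close>

lemma short_memory_linear_variance:
  assumes sm: "short_memory P X"
  obtains C where "\<And>wt. (\<And>t. \<bar>wt t\<bar> \<le> 1) \<Longrightarrow> (\<And>t. wt t \<noteq> 0 \<Longrightarrow> (LINT \<omega>|P. X t \<omega>) = 0) \<Longrightarrow>
       linear_variance P C (\<lambda>\<omega> t. wt t * X t \<omega>)"
proof -
  obtain C where C: "0 \<le> C" "\<And>s t. (LINT \<omega>|P. X s \<omega>) = 0 \<Longrightarrow> (LINT \<omega>|P. X t \<omega>) = 0 \<Longrightarrow>
        \<bar>LINT \<omega>|P. X s \<omega> * X t \<omega>\<bar> \<le> C / (1 + \<bar>of_int (t - s)\<bar>)\<^sup>2"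
    using sm unfolding short_memory_def by blast
  have int: "\<And>s t. integrable P (\<lambda>\<omega>. X s \<omega> * X t \<omega>)" using sm unfolding short_memory_def by blast
  have "linear_variance P (4 * C) (\<lambda>\<omega> t. wt t * X t \<omega>)"
    if "\<And>t. \<bar>wt t\<bar> \<le> 1" "\<And>t. wt t \<noteq> 0 \<Longrightarrow> (LINT \<omega>|P. X t \<omega>) = 0" for wt
    using weighted_psum_variance[where X = X and C = C and wt = wt, OF int C] that by blast
  thus ?thesis by (rule that)
qed

abbreviation (input) root_inv :: "nat \<Rightarrow> real" where "root_inv T \<equiv> real T powr (- (1 / 2))"

lemma root_inv: "root_inv T = 1 / sqrt (real T)"
  by (simp add: powr_minus_divide powr_half_sqrt)

lemma root_inv_sq: "(root_inv T)\<^sup>2 = 1 / real T"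
  by (simp add: root_inv power_divide)

text \<open>The window at sample size T is the block of length \<open>2 ^ k T\<close> that starts at
  \<open>a T\<close>. A nonnegative start lets w at that date be reached from w_0 by
  increments.\<close>

locale break_windows = prob_space P for P :: "'a measure" +
  fixes k :: "nat \<Rightarrow> nat" and a :: "nat \<Rightarrow> int" and v :: "nat \<Rightarrow> real"
  assumes rate: "(\<lambda>T. (real (k T + 1))\<^sup>2 * 2 ^ k T / real T) \<longlonglongrightarrow> 0"
    and rate': "(\<lambda>T. (v T * root_inv T + (root_inv T)\<^sup>2) * 2 ^ k T) \<longlonglongrightarrow> 0"
    and start: "\<And>T. 0 \<le> a T" "\<forall>\<^sub>F T in sequentially. a T \<le> int T"
    and v_pos: "\<And>T. 0 < v T"
begin

definition \<rho> where "\<rho> T = (real (k T + 1))\<^sup>2 * 2 ^ k T / real T"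

text \<open>By \<open>psum_le_dyadic_sq\<close> it dominates the squared sums over all initial
  segments of the window, divided by T.\<close>

definition max_sq where "max_sq X wt T \<omega> = real (k T + 1) * dyadic_sq (\<lambda>t. wt T t * X t \<omega>) (k T) (a T) / real T"

lemma max_sq_nonneg: "0 \<le> max_sq X wt T \<omega>"
  by (simp add: max_sq_def dyadic_sq_nonneg)

lemma max_sq_expectation:
  assumes sm: "short_memory P X"
  obtains C where "\<And>wt T. (\<And>t. \<bar>wt T t\<bar> \<le> 1) \<Longrightarrow> (\<And>t. wt T t \<noteq> 0 \<Longrightarrow> (LINT \<omega>|P. X t \<omega>) = 0) \<Longrightarrow>
       integrable P (max_sq X wt T) \<and> (LINT \<omega>|P. max_sq X wt T \<omega>) \<le> C * \<rho> T"
proof -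
  obtain C where C: "\<And>wt. (\<And>t. \<bar>wt t\<bar> \<le> 1) \<Longrightarrow> (\<And>t. wt t \<noteq> 0 \<Longrightarrow> (LINT \<omega>|P. X t \<omega>) = 0) \<Longrightarrow>
       linear_variance P C (\<lambda>\<omega> t. wt t * X t \<omega>)"
    by (fact short_memory_linear_variance[OF sm])
  have "integrable P (max_sq X wt T) \<and> (LINT \<omega>|P. max_sq X wt T \<omega>) \<le> C * \<rho> T"
    if "\<And>t. \<bar>wt T t\<bar> \<le> 1" "\<And>t. wt T t \<noteq> 0 \<Longrightarrow> (LINT \<omega>|P. X t \<omega>) = 0" for wt T
  proof
    have "linear_variance P C (\<lambda>\<omega> t. wt T t * X t \<omega>)" by (rule C) (use that in auto)
    note D = dyadic_sq_expectation[OF this, of "k T" "a T"]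
    show "integrable P (max_sq X wt T)" unfolding max_sq_def[abs_def] using D by simp
    have "(LINT \<omega>|P. max_sq X wt T \<omega>) = real (k T + 1) * (LINT \<omega>|P. dyadic_sq (\<lambda>t. wt T t * X t \<omega>) (k T) (a T)) / real T"
      unfolding max_sq_def using D by simp
    also have "\<dots> \<le> real (k T + 1) * (C * (real (k T + 1) * 2 ^ k T)) / real T"
      using D by (intro divide_right_mono mult_left_mono) auto
    also have "\<dots> = C * \<rho> T" by (simp add: \<rho>_def power2_eq_square)
    finally show "(LINT \<omega>|P. max_sq X wt T \<omega>) \<le> C * \<rho> T" .
  qed
  thus ?thesis by (rule that)
qed

lemma max_sq_o_p1:
  assumes sm: "short_memory P X"
    and wt: "\<And>T t. \<bar>wt T t\<bar> \<le> 1" "\<And>T t. wt T t \<noteq> 0 \<Longrightarrow> (LINT \<omega>|P. X t \<omega>) = 0"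
  shows "o_p1 P (max_sq X wt)"
proof -
  obtain C where C: "\<And>wt T. (\<And>t. \<bar>wt T t\<bar> \<le> 1) \<Longrightarrow> (\<And>t. wt T t \<noteq> 0 \<Longrightarrow> (LINT \<omega>|P. X t \<omega>) = 0) \<Longrightarrow>
       integrable P (max_sq X wt T) \<and> (LINT \<omega>|P. max_sq X wt T \<omega>) \<le> C * \<rho> T"
    by (fact max_sq_expectation[OF sm])
  show ?thesis
  proof (rule o_p1_markov[OF prob_space_axioms])
    show "(\<lambda>T. C * \<rho> T) \<longlonglongrightarrow> 0" unfolding \<rho>_def using tendsto_mult[OF tendsto_const rate, of C] by simp
    show "\<forall>\<^sub>F T in sequentially. integrable P (max_sq X wt T) \<and> (\<forall>\<omega>\<in>space P. 0 \<le> max_sq X wt T \<omega>) \<and> (LINT \<omega>|P. max_sq X wt T \<omega>) \<le> C * \<rho> T"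
    proof (intro always_eventually allI)
      fix T
      have "integrable P (max_sq X wt T) \<and> (LINT \<omega>|P. max_sq X wt T \<omega>) \<le> C * \<rho> T"
        by (rule C) (use wt in auto)
      thus "integrable P (max_sq X wt T) \<and> (\<forall>\<omega>\<in>space P. 0 \<le> max_sq X wt T \<omega>) \<and> (LINT \<omega>|P. max_sq X wt T \<omega>) \<le> C * \<rho> T"
        by (auto simp: max_sq_nonneg)
    qed
  qed
qed

lemma window_sum_le:
  assumes "{c..d} \<subseteq> {a T..<a T + 2 ^ k T}"
  shows "root_inv T * \<bar>\<Sum>t\<in>{c..d}. wt T t * X t \<omega>\<bar> \<le> 2 * sqrt (max_sq X wt T \<omega>)"
proof -
  have "root_inv T * \<bar>\<Sum>t\<in>{c..d}. wt T t * X t \<omega>\<bar> \<le> root_inv T * (2 * sqrt (real (k T + 1) * dyadic_sq (\<lambda>t. wt T t * X t \<omega>) (k T) (a T)))"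
    by (intro mult_left_mono interval_sum_le assms) auto
  also have "\<dots> = 2 * sqrt (max_sq X wt T \<omega>)"
    by (simp add: root_inv max_sq_def real_sqrt_divide)
  finally show ?thesis .
qed

end

lemma norm_le_entry_sum: "norm (A :: real^'m^'n) \<le> (\<Sum>i\<in>UNIV. \<Sum>j\<in>UNIV. \<bar>A $ i $ j\<bar>)"
proof -
  have "norm A \<le> (\<Sum>i\<in>UNIV. norm (A $ i))" unfolding norm_vec_def by (rule L2_set_le_sum) auto
  also have "\<dots> \<le> (\<Sum>i\<in>UNIV. \<Sum>j\<in>UNIV. \<bar>A $ i $ j\<bar>)" by (intro sum_mono norm_le_l1_cart)
  finally show ?thesis .
qed

lemma gen_sigma_measurable:
  fixes X :: "int \<Rightarrow> 'a \<Rightarrow> 'b::topological_space" and f :: "'a \<Rightarrow> 'c::topological_space"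
  assumes X: "\<And>s. s \<in> I \<Longrightarrow> X s \<in> borel_measurable P" and f: "f \<in> borel_measurable (gen_sigma P X I)"
  shows "f \<in> borel_measurable P"
proof (rule measurableI)
  have sp: "space (gen_sigma P X I) = space P" by (simp add: gen_sigma_def space_measure_of_conv)
  fix B :: "'c set" assume "B \<in> sets borel"
  hence "f -` B \<inter> space P \<in> sets (gen_sigma P X I)" using measurable_sets[OF f] sp by metis
  moreover have "sets (gen_sigma P X I) \<subseteq> sets P"
    unfolding sets_gen_sigma using X by (intro sets.sigma_sets_subset) (auto intro: measurable_sets)
  ultimately show "f -` B \<inter> space P \<in> sets P" by blast
qed simp

lemma kron_col: "kron x (col e) $ (i, j) $ 1 = x $ i * e $ j"
  by (simp add: kron_def col_def)

lemma trend_bound: "0 \<le> s \<Longrightarrow> s \<le> 1 \<Longrightarrow> \<bar>trend kind s $ i\<bar> \<le> 1"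
  by (cases "kind i") (auto simp: trend_def power_le_one)

lemma norm_sum4_sq: "(norm (p + q + r + s))\<^sup>2 \<le> 4 * ((norm p)\<^sup>2 + (norm q)\<^sup>2 + (norm r)\<^sup>2 + (norm s)\<^sup>2)"
  for p q r s :: "'a::real_normed_vector"
proof -
  have "norm (p + q + r + s) \<le> norm p + norm q + norm r + norm s"
    by (intro order_trans[OF norm_triangle_ineq] add_mono order_refl)
  hence "(norm (p + q + r + s))\<^sup>2 \<le> (norm p + norm q + norm r + norm s)\<^sup>2" by (intro power_mono) auto
  also have "\<dots> \<le> 4 * ((norm p)\<^sup>2 + (norm q)\<^sup>2 + (norm r)\<^sup>2 + (norm s)\<^sup>2)"
  proof -
    have "4 * (A\<^sup>2 + B\<^sup>2 + C\<^sup>2 + D\<^sup>2) - (A + B + C + D)\<^sup>2 = (A - B)\<^sup>2 + (A - C)\<^sup>2 + (A - D)\<^sup>2 + (B - C)\<^sup>2 + (B - D)\<^sup>2 + (C - D)\<^sup>2"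
      for A B C D :: real by (simp add: power2_eq_square algebra_simps)
    from this[of "norm p" "norm q" "norm r" "norm s"]
    have "0 \<le> 4 * ((norm p)\<^sup>2 + (norm q)\<^sup>2 + (norm r)\<^sup>2 + (norm s)\<^sup>2) - (norm p + norm q + norm r + norm s)\<^sup>2"
      by simp
    thus ?thesis by simp
  qed
  finally show ?thesis .
qed

text \<open>A window may contain date 0 or run beyond T, where the centring of squared errors or the
  bound on the trend may fail; this weight removes such dates.\<close>

definition in_sample :: "nat \<Rightarrow> int \<Rightarrow> real" where
  "in_sample T t = (if t \<in> {1..int T} then 1 else 0)"

lemma in_sample_sum: "{c..d} \<subseteq> {1..int T} \<Longrightarrow> (\<Sum>t\<in>{c..d}. in_sample T t * f t) = (\<Sum>t\<in>{c..d}. f t)"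
  by (intro sum.cong) (auto simp: in_sample_def)

text \<open>\<open>eta_cov\<close> states the centring as plain integrals, so that the errors u and
  their covariances, which vary with T, stay outside the locale.\<close>

locale regressor_windows = break_windows P k a v
  for P :: "'a measure" and k :: "nat \<Rightarrow> nat" and a :: "nat \<Rightarrow> int" and v :: "nat \<Rightarrow> real" +
  fixes kind :: "'q::finite \<Rightarrow> regressor"
    and z uw w :: "int \<Rightarrow> 'a \<Rightarrow> real^'q"
    and \<eta> :: "int \<Rightarrow> 'a \<Rightarrow> real^'n::finite"
    and x :: "nat \<Rightarrow> int \<Rightarrow> 'a \<Rightarrow> real^'q"
  assumes rv: "\<And>t. z t \<in> borel_measurable P" "\<And>t. uw t \<in> borel_measurable P"
      "\<And>t. \<eta> t \<in> borel_measurable P"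
    and blocks: "\<And>t \<omega>. \<omega> \<in> space P \<Longrightarrow> in_block kind Stationary (z t \<omega>)"
      "\<And>t \<omega>. \<omega> \<in> space P \<Longrightarrow> in_block kind Integrated (uw t \<omega>)"
    and z: "stationary_type P z"
    and uw: "integrated_increments P uw"
    and w: "\<And>t \<omega>. 1 \<le> t \<Longrightarrow> \<omega> \<in> space P \<Longrightarrow> w t \<omega> = w (t - 1) \<omega> + uw t \<omega>"
    and x: "\<And>T t \<omega>. t \<in> {1..int T} \<Longrightarrow> \<omega> \<in> space P \<Longrightarrow>
      x T t \<omega> = z t \<omega> + trend kind (of_int t / real T) + root_inv T *\<^sub>R w t \<omega>"
    and mixing: "mixing_condition P kind z uw (w 0) \<eta>"
    and eta_cov: "\<And>t i j. 1 \<le> t \<Longrightarrow> (LINT \<omega>|P. (outer (\<eta> t \<omega>) (\<eta> t \<omega>) - mat 1) $ i $ j) = 0"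
begin

lemma component_measurable:
  "(\<lambda>\<omega>. z t \<omega> $ i) \<in> borel_measurable P" "(\<lambda>\<omega>. uw t \<omega> $ i) \<in> borel_measurable P" "(\<lambda>\<omega>. \<eta> t \<omega> $ j) \<in> borel_measurable P"
proof -
  have nth: "(\<lambda>u :: real^'d. u $ i) \<in> borel_measurable borel" for i
    by (intro borel_measurable_continuous_onI continuous_intros)
  show "(\<lambda>\<omega>. z t \<omega> $ i) \<in> borel_measurable P" "(\<lambda>\<omega>. uw t \<omega> $ i) \<in> borel_measurable P" "(\<lambda>\<omega>. \<eta> t \<omega> $ j) \<in> borel_measurable P"
    using measurable_compose[OF rv(1) nth] measurable_compose[OF rv(2) nth] measurable_compose[OF rv(3) nth] by auto
qed

lemma w0_measurable: "w 0 \<in> borel_measurable P"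
proof (rule gen_sigma_measurable)
  show "w 0 \<in> borel_measurable (gen_sigma P (\<lambda>s \<omega>. (z s \<omega>, uw s \<omega>, \<eta> s \<omega>)) {..0})"
    using mixing by (simp add: mixing_condition_def history_def)
  show "(\<lambda>\<omega>. (z s \<omega>, uw s \<omega>, \<eta> s \<omega>)) \<in> borel_measurable P" for s
    using rv by (intro borel_measurable_Pair)
qed

lemma short_memory_eta_cov: "short_memory P (\<lambda>t \<omega>. (outer (\<eta> t \<omega>) (\<eta> t \<omega>) - mat 1) $ i $ j)"
proof -
  obtain \<kappa> where \<kappa>: "0 < \<kappa>" "\<kappa> < 1 / 2" "mixing_moments P \<kappa> (\<lambda>t \<omega>. outer (\<eta> t \<omega>) (\<eta> t \<omega>) - mat 1)"
    using mixing unfolding mixing_condition_def by blast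
  have "(\<lambda>\<omega>. (outer (\<eta> t \<omega>) (\<eta> t \<omega>) - mat 1) $ i $ j) \<in> borel_measurable P" for t
    using component_measurable by (simp add: outer_def)
  thus ?thesis by (rule mixing_moments_short_memory[OF prob_space_axioms \<kappa>(3,1,2)])
qed

text \<open>Mixing is given for products with z + uw. At a stationary coordinate uw vanishes, and at
  any other coordinate z does.\<close>

lemma short_memory_z_eta: "short_memory P (\<lambda>t \<omega>. z t \<omega> $ i * \<eta> t \<omega> $ j)"
proof (cases "kind i = Stationary")
  case True
  obtain \<kappa> where \<kappa>: "0 < \<kappa>" "\<kappa> < 1 / 2" "mixing_moments P \<kappa> (\<lambda>t \<omega>. kron (z t \<omega> + uw t \<omega>) (col (\<eta> t \<omega>)))"
    using mixing unfolding mixing_condition_def by blast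
  have m: "(\<lambda>\<omega>. kron (z t \<omega> + uw t \<omega>) (col (\<eta> t \<omega>)) $ (i, j) $ 1) \<in> borel_measurable P" for t
    using component_measurable by (simp add: kron_col)
  have "short_memory P (\<lambda>t \<omega>. kron (z t \<omega> + uw t \<omega>) (col (\<eta> t \<omega>)) $ (i, j) $ 1)"
    by (rule mixing_moments_short_memory[OF prob_space_axioms \<kappa>(3,1,2) m])
  moreover have "kron (z t \<omega> + uw t \<omega>) (col (\<eta> t \<omega>)) $ (i, j) $ 1 = z t \<omega> $ i * \<eta> t \<omega> $ j" if "\<omega> \<in> space P" for t \<omega>
    using blocks(2)[OF that, of t] True by (simp add: kron_col in_block_def)
  ultimately show ?thesis by (rule short_memory_cong[rotated])
next
  case False
  have "short_memory P (\<lambda>t \<omega>. 0)" unfolding short_memory_def by (auto intro!: exI[of _ 0])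
  moreover have "0 = z t \<omega> $ i * \<eta> t \<omega> $ j" if "\<omega> \<in> space P" for t \<omega>
    using blocks(1)[OF that, of t] False by (simp add: in_block_def)
  ultimately show ?thesis by (rule short_memory_cong[rotated])
qed

lemma z_eta_mean: "(LINT \<omega>|P. z t \<omega> $ i * \<eta> t \<omega> $ j) = 0"
proof -
  have "has_bochner_integral P (\<lambda>\<omega>. kron (z t \<omega>) (col (\<eta> t \<omega>))) 0"
    using mixing unfolding mixing_condition_def by blast
  note this = has_bochner_integral_bounded_linear[OF bounded_linear_vec_nth this, of "(i, j)"]
  from has_bochner_integral_bounded_linear[OF bounded_linear_vec_nth this, of 1]
  show ?thesis by (simp add: kron_col has_bochner_integral_iff)
qed

lemma const_regressor: obtains i where "\<And>t \<omega>. \<omega> \<in> space P \<Longrightarrow> z t \<omega> $ i = 1"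
  using mixing unfolding mixing_condition_def by blast

text \<open>The constant regressor turns a product z \<eta> into \<eta> itself.\<close>

lemma short_memory_eta: "short_memory P (\<lambda>t \<omega>. \<eta> t \<omega> $ j)"
proof -
  obtain i where i: "\<And>t \<omega>. \<omega> \<in> space P \<Longrightarrow> z t \<omega> $ i = 1" using const_regressor by blast
  show ?thesis by (rule short_memory_cong[OF _ short_memory_z_eta[of i j]]) (simp add: i)
qed

lemma eta_mean: "(LINT \<omega>|P. \<eta> t \<omega> $ j) = 0"
proof -
  obtain i where i: "\<And>t \<omega>. \<omega> \<in> space P \<Longrightarrow> z t \<omega> $ i = 1" using const_regressor by blast
  have "(LINT \<omega>|P. \<eta> t \<omega> $ j) = (LINT \<omega>|P. z t \<omega> $ i * \<eta> t \<omega> $ j)"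
    by (intro Bochner_Integration.integral_cong) (auto simp: i)
  thus ?thesis by (simp add: z_eta_mean)
qed

text \<open>Shifted by one, so that \<open>psum (w_step i \<omega>) b l\<close> is coordinate \<open>i\<close> of \<open>w\<^bsub>b + l\<^esub> - w\<^sub>b\<close>.\<close>

definition w_step where "w_step i \<omega> t = uw (t + 1) \<omega> $ i"

lemma psum_w_step: "psum (w_step i \<omega>) b l = (\<Sum>s\<in>{b<..b + int l}. uw s \<omega>) $ i"
  unfolding psum_def w_step_def sum_component
  by (rule sum.reindex_bij_witness[of _ "\<lambda>s. nat (s - b - 1)" "\<lambda>i. b + int i + 1"]) auto

lemma w_increment:
  assumes "0 \<le> b" "b \<le> t" "\<omega> \<in> space P"
  shows "w t \<omega> = w b \<omega> + (\<Sum>s\<in>{b<..t}. uw s \<omega>)"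
  using assms(2)
proof (induction t rule: int_ge_induct)
  case (step t)
  have "{b<..t + 1} = insert (t + 1) {b<..t}" using step by auto
  thus ?case using w[of "t + 1" \<omega>] step assms by (simp add: add_ac)
qed simp

lemma w_increment_component:
  assumes "0 \<le> b" "b \<le> t" "\<omega> \<in> space P"
  shows "w t \<omega> $ i = w b \<omega> $ i + psum (w_step i \<omega>) b (nat (t - b))"
  using w_increment[OF assms] assms by (simp add: psum_w_step)

lemma increment_moments:
  obtains C where "0 \<le> C"
    "\<And>s t. s \<le> t \<Longrightarrow> integrable P (\<lambda>\<omega>. (norm (\<Sum>i\<in>{s<..t}. uw i \<omega>))\<^sup>2) \<and> (LINT \<omega>|P. (norm (\<Sum>i\<in>{s<..t}. uw i \<omega>))\<^sup>2) \<le> C * of_int (t - s)"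
proof -
  obtain C where C: "\<And>s t. s \<le> t \<Longrightarrow> integrable P (\<lambda>\<omega>. (norm (\<Sum>i\<in>{s<..t}. uw i \<omega>))\<^sup>2) \<and> (LINT \<omega>|P. (norm (\<Sum>i\<in>{s<..t}. uw i \<omega>))\<^sup>2) \<le> C * of_int (t - s)"
    using uw unfolding integrated_increments_def by blast
  have "0 \<le> (LINT \<omega>|P. (norm (\<Sum>i\<in>{0<..1}. uw i \<omega>))\<^sup>2)" by simp
  also have "\<dots> \<le> C" using conjunct2[OF C[of 0 1]] by simp
  finally show ?thesis using C by (rule that)
qed

lemma w_step_linear_variance: "\<exists>C. \<forall>i. linear_variance P C (w_step i)"
proof -
  obtain C where C: "0 \<le> C"
    "\<And>s t. s \<le> t \<Longrightarrow> integrable P (\<lambda>\<omega>. (norm (\<Sum>i\<in>{s<..t}. uw i \<omega>))\<^sup>2) \<and> (LINT \<omega>|P. (norm (\<Sum>i\<in>{s<..t}. uw i \<omega>))\<^sup>2) \<le> C * of_int (t - s)"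
    by (fact increment_moments)
  have "linear_variance P C (w_step i)" for i
    unfolding linear_variance_def
  proof (intro allI conjI)
    fix b l
    note D = C(2)[of b "b + int l"]
    have le: "(psum (w_step i \<omega>) b l)\<^sup>2 \<le> (norm (\<Sum>s\<in>{b<..b + int l}. uw s \<omega>))\<^sup>2" for \<omega>
      unfolding psum_w_step by (subst power2_abs[symmetric], intro power_mono component_le_norm_cart) auto
    show int: "integrable P (\<lambda>\<omega>. (psum (w_step i \<omega>) b l)\<^sup>2)"
    proof (rule Bochner_Integration.integrable_bound[of P "\<lambda>\<omega>. (norm (\<Sum>s\<in>{b<..b + int l}. uw s \<omega>))\<^sup>2"])
      show "(\<lambda>\<omega>. (psum (w_step i \<omega>) b l)\<^sup>2) \<in> borel_measurable P"
        unfolding psum_def w_step_def by (intro borel_measurable_power borel_measurable_sum component_measurable)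
    qed (use D le in auto)
    have "(LINT \<omega>|P. (psum (w_step i \<omega>) b l)\<^sup>2) \<le> (LINT \<omega>|P. (norm (\<Sum>s\<in>{b<..b + int l}. uw s \<omega>))\<^sup>2)"
      using int D le by (intro integral_mono) auto
    also have "\<dots> \<le> C * real l" using D by simp
    finally show "(LINT \<omega>|P. (psum (w_step i \<omega>) b l)\<^sup>2) \<le> C * real l" .
  qed
  thus ?thesis by blast
qed

lemma \<rho>_limit: "\<rho> \<longlonglongrightarrow> 0"
  using rate by (simp add: \<rho>_def[abs_def])

lemma \<rho>_pos: "1 \<le> T \<Longrightarrow> 0 < \<rho> T"
  by (simp add: \<rho>_def)

abbreviation window :: "nat \<Rightarrow> int set" where "window T \<equiv> {1..int T} \<inter> {a T..<a T + 2 ^ k T}"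

section \<open>Bounds uniform over the subintervals of a window\<close>

lemma eta_cov_bound:
  obtains D where "o_p1 P D" 
    "\<And>T \<omega> c d. {c..d} \<subseteq> window T \<Longrightarrow> root_inv T * norm (\<Sum>t\<in>{c..d}. outer (\<eta> t \<omega>) (\<eta> t \<omega>) - mat 1) \<le> D T \<omega>"
proof -
  let ?X = "\<lambda>i j t \<omega>. (outer (\<eta> t \<omega>) (\<eta> t \<omega>) - mat 1) $ i $ j"
  define D where "D T \<omega> = (\<Sum>i\<in>UNIV. \<Sum>j\<in>UNIV. 2 * sqrt (max_sq (?X i j) in_sample T \<omega>))" for T \<omega>
  have "o_p1 P (max_sq (?X i j) in_sample)" for i j
  proof (rule max_sq_o_p1[OF short_memory_eta_cov])
    show "\<bar>in_sample T t\<bar> \<le> 1" for T t by (simp add: in_sample_def)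
    show "(LINT \<omega>|P. ?X i j t \<omega>) = 0" if "in_sample T t \<noteq> 0" for T t
      by (rule eta_cov) (use that in \<open>simp add: in_sample_def split: if_splits\<close>)
  qed
  hence "o_p1 P D" unfolding D_def[abs_def]
    by (intro o_p1_sum o_p1_cmult o_p1_sqrt prob_space_axioms)
  moreover have "root_inv T * norm (\<Sum>t\<in>{c..d}. outer (\<eta> t \<omega>) (\<eta> t \<omega>) - mat 1) \<le> D T \<omega>" if "{c..d} \<subseteq> window T" for T \<omega> c d
  proof -
    have s: "{c..d} \<subseteq> {1..int T}" "{c..d} \<subseteq> {a T..<a T + 2 ^ k T}" using that by auto
    have "root_inv T * norm (\<Sum>t\<in>{c..d}. outer (\<eta> t \<omega>) (\<eta> t \<omega>) - mat 1)
      \<le> root_inv T * (\<Sum>i\<in>UNIV. \<Sum>j\<in>UNIV. \<bar>(\<Sum>t\<in>{c..d}. outer (\<eta> t \<omega>) (\<eta> t \<omega>) - mat 1) $ i $ j\<bar>)"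
      by (intro mult_left_mono norm_le_entry_sum) auto
    also have "\<dots> = (\<Sum>i\<in>UNIV. \<Sum>j\<in>UNIV. root_inv T * \<bar>\<Sum>t\<in>{c..d}. in_sample T t * ?X i j t \<omega>\<bar>)"
      unfolding in_sample_sum[OF s(1)] by (simp add: sum_distrib_left)
    also have "\<dots> \<le> D T \<omega>" unfolding D_def by (intro sum_mono window_sum_le s)
    finally show ?thesis .
  qed
  ultimately show ?thesis by (rule that)
qed

text \<open>The divisor T collects two factors T^(-1/2), one from the scaling of w and one from the
  size of the parameter change; hence the mean is of order \<rho> without a square root.\<close>

lemma iter_o_p1: "o_p1 P (\<lambda>T \<omega>. dyadic_iter (w_step i \<omega>) (\<lambda>t. in_sample T t * \<eta> t \<omega> $ j) (k T) (a T) / real T)"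
proof -
  let ?Y = "\<lambda>T \<omega> t. in_sample T t * \<eta> t \<omega> $ j"
  obtain C1 where C1: "\<And>wt. (\<And>t. \<bar>wt t\<bar> \<le> 1) \<Longrightarrow> (\<And>t. wt t \<noteq> 0 \<Longrightarrow> (LINT \<omega>|P. \<eta> t \<omega> $ j) = 0) \<Longrightarrow>
       linear_variance P C1 (\<lambda>\<omega> t. wt t * \<eta> t \<omega> $ j)"
    by (fact short_memory_linear_variance[OF short_memory_eta])
  obtain C2 where C2: "\<And>i. linear_variance P C2 (w_step i)" using w_step_linear_variance by blast
  define C where "C = max C1 C2"
  have "linear_variance P C1 (?Y T)" for T by (rule C1) (auto simp: in_sample_def eta_mean)
  hence Y: "linear_variance P C (?Y T)" for T by (rule linear_variance_mono) (simp add: C_def)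
  have Z: "linear_variance P C (w_step i)" by (rule linear_variance_mono[OF C2]) (simp add: C_def)
  show ?thesis
  proof (rule o_p1_markov[OF prob_space_axioms])
    show "(\<lambda>T. C * \<rho> T) \<longlonglongrightarrow> 0" using tendsto_mult[OF tendsto_const \<rho>_limit, of C] by simp
    show "\<forall>\<^sub>F T in sequentially. integrable P (\<lambda>\<omega>. dyadic_iter (w_step i \<omega>) (?Y T \<omega>) (k T) (a T) / real T) \<and>
      (\<forall>\<omega>\<in>space P. 0 \<le> dyadic_iter (w_step i \<omega>) (?Y T \<omega>) (k T) (a T) / real T) \<and>
      (LINT \<omega>|P. dyadic_iter (w_step i \<omega>) (?Y T \<omega>) (k T) (a T) / real T) \<le> C * \<rho> T"
    proof (intro always_eventually allI conjI ballI)
      fix T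
      have D: "integrable P (\<lambda>\<omega>. dyadic_iter (w_step i \<omega>) (?Y T \<omega>) (k T) (a T)) \<and>
        (LINT \<omega>|P. dyadic_iter (w_step i \<omega>) (?Y T \<omega>) (k T) (a T)) \<le> C * ((real (k T + 1))\<^sup>2 * 2 ^ k T)"
        by (rule dyadic_iter_expectation[OF Y Z])
      thus "integrable P (\<lambda>\<omega>. dyadic_iter (w_step i \<omega>) (?Y T \<omega>) (k T) (a T) / real T)" by simp
      show "0 \<le> dyadic_iter (w_step i \<omega>) (?Y T \<omega>) (k T) (a T) / real T" for \<omega> by (simp add: dyadic_iter_nonneg)
      have "(LINT \<omega>|P. dyadic_iter (w_step i \<omega>) (?Y T \<omega>) (k T) (a T) / real T) \<le> C * ((real (k T + 1))\<^sup>2 * 2 ^ k T) / real T"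
        using D by (simp add: divide_right_mono)
      thus "(LINT \<omega>|P. dyadic_iter (w_step i \<omega>) (?Y T \<omega>) (k T) (a T) / real T) \<le> C * \<rho> T" by (simp add: \<rho>_def)
    qed
  qed
qed

text \<open>
  \<open>T\<^bsup>-1/2\<^esup> (w\<^sub>a - w\<^sub>0)\<close> is only bounded in mean square; weighting the arithmetic-geometric mean inequality
  by \<open>\<surd>\<rho>\<close> makes both squares negligible in mean.
\<close>

lemma level_product_o_p1: "o_p1 P (\<lambda>T \<omega>. root_inv T * \<bar>psum (w_step i \<omega>) 0 (nat (a T))\<bar> * (2 * sqrt (max_sq (\<lambda>t \<omega>. \<eta> t \<omega> $ j) in_sample T \<omega>)))"
proof -
  obtain C1 where C1: "\<And>wt T. (\<And>t. \<bar>wt T t\<bar> \<le> 1) \<Longrightarrow> (\<And>t. wt T t \<noteq> 0 \<Longrightarrow> (LINT \<omega>|P. \<eta> t \<omega> $ j) = 0) \<Longrightarrow>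
       integrable P (max_sq (\<lambda>t \<omega>. \<eta> t \<omega> $ j) wt T) \<and> (LINT \<omega>|P. max_sq (\<lambda>t \<omega>. \<eta> t \<omega> $ j) wt T \<omega>) \<le> C1 * \<rho> T"
    by (fact max_sq_expectation[OF short_memory_eta])
  obtain C2 where C2: "\<And>i. linear_variance P C2 (w_step i)" using w_step_linear_variance by blast
  define m where "m = max_sq (\<lambda>t \<omega>. \<eta> t \<omega> $ j) in_sample"
  have m: "integrable P (m T) \<and> (LINT \<omega>|P. m T \<omega>) \<le> C1 * \<rho> T" for T
    unfolding m_def by (rule C1) (auto simp: in_sample_def eta_mean)
  have m0: "0 \<le> m T \<omega>" for T \<omega> unfolding m_def by (rule max_sq_nonneg)
  define U where "U T \<omega> = (psum (w_step i \<omega>) 0 (nat (a T)))\<^sup>2" for T \<omega>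
  define Z where "Z T \<omega> = sqrt (\<rho> T) * (U T \<omega> / real T) + m T \<omega> / sqrt (\<rho> T)" for T \<omega>
  have Z: "o_p1 P Z"
  proof (rule o_p1_markov[OF prob_space_axioms])
    have "(\<lambda>T. sqrt (\<rho> T)) \<longlonglongrightarrow> 0" using tendsto_real_sqrt[OF \<rho>_limit] by simp
    thus "(\<lambda>T. (C2 + C1) * sqrt (\<rho> T)) \<longlonglongrightarrow> 0" using tendsto_mult[OF tendsto_const, of "\<lambda>T. sqrt (\<rho> T)" 0 _ "C2 + C1"] by simp
    have "\<forall>\<^sub>F T in sequentially. 1 \<le> T \<and> a T \<le> int T" using start(2) eventually_ge_at_top[of 1] by eventually_elim simp
    thus "\<forall>\<^sub>F T in sequentially. integrable P (Z T) \<and> (\<forall>\<omega>\<in>space P. 0 \<le> Z T \<omega>) \<and> (LINT \<omega>|P. Z T \<omega>) \<le> (C2 + C1) * sqrt (\<rho> T)"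
    proof eventually_elim
      case (elim T)
      have r: "0 < \<rho> T" using elim \<rho>_pos by simp
      have U: "integrable P (U T)" "(LINT \<omega>|P. U T \<omega>) \<le> C2 * real (nat (a T))"
        using linear_varianceD[OF C2, of i 0 "nat (a T)"] by (auto simp: U_def[abs_def])
      have "C2 * real (nat (a T)) \<le> C2 * real T" using elim linear_variance_nonneg[OF C2] by (intro mult_left_mono) auto
      hence U': "(LINT \<omega>|P. U T \<omega>) / real T \<le> C2" using U(2) elim by (simp add: divide_le_eq)
      have "(LINT \<omega>|P. Z T \<omega>) = sqrt (\<rho> T) * ((LINT \<omega>|P. U T \<omega>) / real T) + (LINT \<omega>|P. m T \<omega>) / sqrt (\<rho> T)"
        unfolding Z_def using U m[of T] by simp
      also have "\<dots> \<le> sqrt (\<rho> T) * C2 + C1 * \<rho> T / sqrt (\<rho> T)"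
        using U' m[of T] r by (intro add_mono mult_left_mono divide_right_mono) auto
      also have "C1 * \<rho> T / sqrt (\<rho> T) = C1 * sqrt (\<rho> T)" by (simp only: times_divide_eq_right[symmetric] real_div_sqrt[OF less_imp_le[OF r]])
      finally have "(LINT \<omega>|P. Z T \<omega>) \<le> (C2 + C1) * sqrt (\<rho> T)" by (simp add: algebra_simps)
      moreover have "integrable P (Z T)" unfolding Z_def[abs_def] using U m[of T] by simp
      moreover have "0 \<le> Z T \<omega>" for \<omega> using r m0 by (simp add: Z_def U_def)
      ultimately show ?case by blast
    qed
  qed
  show ?thesis
  proof (rule o_p1_dominated[OF prob_space_axioms Z])
    have "\<bar>root_inv T * \<bar>psum (w_step i \<omega>) 0 (nat (a T))\<bar> * (2 * sqrt (m T \<omega>))\<bar> \<le> \<bar>Z T \<omega>\<bar>" if T: "1 \<le> T" for T \<omega>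
    proof -
      have r: "0 < sqrt (\<rho> T)" using T \<rho>_pos by simp
      define p q where "p = root_inv T * \<bar>psum (w_step i \<omega>) 0 (nat (a T))\<bar>" and "q = sqrt (m T \<omega>)"
      have pp: "p\<^sup>2 = U T \<omega> / real T" by (simp add: p_def power_mult_distrib root_inv_sq U_def)
      have qq: "q\<^sup>2 = m T \<omega>" using m0 by (simp add: q_def)
      have nn: "0 \<le> p" "0 \<le> q" using m0 by (auto simp: p_def q_def)
      have "sqrt (\<rho> T) * p\<^sup>2 + q\<^sup>2 / sqrt (\<rho> T) - 2 * (p * q) = (sqrt (\<rho> T) * p - q)\<^sup>2 / sqrt (\<rho> T)"
        using r by (simp add: field_simps power2_eq_square)
      also have "\<dots> \<ge> 0" using r by simp
      finally have "2 * (p * q) \<le> Z T \<omega>" by (simp add: Z_def pp qq)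
      moreover have "\<bar>p * (2 * q)\<bar> = 2 * (p * q)" using nn by (simp add: abs_mult)
      ultimately show ?thesis unfolding p_def[symmetric] q_def[symmetric] by linarith
    qed
    thus "\<forall>\<^sub>F T in sequentially. \<forall>\<omega>\<in>space P. \<bar>root_inv T * \<bar>psum (w_step i \<omega>) 0 (nat (a T))\<bar> * (2 * sqrt (max_sq (\<lambda>t \<omega>. \<eta> t \<omega> $ j) in_sample T \<omega>))\<bar> \<le> \<bar>Z T \<omega>\<bar>"
      unfolding m_def by (intro eventually_mono[OF eventually_ge_at_top[of "1 :: nat"]] ballI)
  qed
qed

text \<open>Four contributions: z, by short memory of z \<eta>; the trend, as a bounded weight on
  \<eta>; the level of w at the start of the window times a sum of \<eta>; the increments of w
  inside the window, as an iterated sum. The level splits once more into w_0 and w_a - w_0, since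
  only the latter is known to have moments. All coordinates are treated alike, without a case
  distinction on \<open>kind i\<close>.\<close>

lemma score_entry_bound:
  obtains D where "o_p1 P D" 
    "\<And>T \<omega> c d. \<omega> \<in> space P \<Longrightarrow> {c..d} \<subseteq> window T \<Longrightarrow> root_inv T * \<bar>\<Sum>t\<in>{c..d}. x T t \<omega> $ i * \<eta> t \<omega> $ j\<bar> \<le> D T \<omega>"
proof -
  define tw where "tw T t = in_sample T t * trend kind (of_int t / real T) $ i" for T t
  have tw: "\<bar>tw T t\<bar> \<le> 1" for T t
  proof (cases "t \<in> {1..int T}")
    case True
    hence "0 \<le> of_int t / real T" "of_int t / real T \<le> 1" by (auto simp: divide_le_eq)
    thus ?thesis using trend_bound[of "of_int t / real T" kind i] True by (simp add: tw_def in_sample_def)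
  qed (auto simp: tw_def in_sample_def)
  define m1 m2 m3 where "m1 T \<omega> = 2 * sqrt (max_sq (\<lambda>t \<omega>. z t \<omega> $ i * \<eta> t \<omega> $ j) in_sample T \<omega>)"
    and "m2 T \<omega> = 2 * sqrt (max_sq (\<lambda>t \<omega>. \<eta> t \<omega> $ j) tw T \<omega>)"
    and "m3 T \<omega> = 2 * sqrt (max_sq (\<lambda>t \<omega>. \<eta> t \<omega> $ j) in_sample T \<omega>)" for T \<omega>
  define m4 where "m4 T \<omega> = root_inv T * \<bar>psum (w_step i \<omega>) 0 (nat (a T))\<bar> * m3 T \<omega>" for T \<omega>
  define m5 where "m5 T \<omega> = (root_inv T * \<bar>w 0 \<omega> $ i\<bar>) * m3 T \<omega>" for T \<omega>
  define m6 where "m6 T \<omega> = 2 * (dyadic_iter (w_step i \<omega>) (\<lambda>t. in_sample T t * \<eta> t \<omega> $ j) (k T) (a T) / real T)" for T \<omega>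
  have one: "\<bar>in_sample T t\<bar> \<le> 1" for T t by (simp add: in_sample_def)
  have o1: "o_p1 P m1" unfolding m1_def[abs_def]
    by (intro o_p1_cmult o_p1_sqrt max_sq_o_p1 prob_space_axioms short_memory_z_eta one z_eta_mean)
  have o2: "o_p1 P m2" unfolding m2_def[abs_def]
    by (intro o_p1_cmult o_p1_sqrt max_sq_o_p1 prob_space_axioms short_memory_eta tw eta_mean)
  have o3: "o_p1 P m3" unfolding m3_def[abs_def]
    by (intro o_p1_cmult o_p1_sqrt max_sq_o_p1 prob_space_axioms short_memory_eta one eta_mean)
  have o4: "o_p1 P m4" unfolding m4_def[abs_def] m3_def by (rule level_product_o_p1)
  have "(\<lambda>T. root_inv T) \<longlonglongrightarrow> 0" by (rule tendsto_neg_powr[OF _ filterlim_real_sequentially]) simp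
  moreover have "(\<lambda>\<omega>. \<bar>w 0 \<omega> $ i\<bar>) \<in> borel_measurable P"
  proof -
    have "(\<lambda>u :: real^'q. u $ i) \<in> borel_measurable borel"
      by (intro borel_measurable_continuous_onI continuous_intros)
    from measurable_compose[OF w0_measurable this] show ?thesis by simp
  qed
  ultimately have "o_p1 P (\<lambda>T \<omega>. root_inv T * \<bar>w 0 \<omega> $ i\<bar>)" by (rule o_p1_fixed[OF prob_space_axioms])
  hence o5: "o_p1 P m5" unfolding m5_def[abs_def] by (rule o_p1_mult[OF prob_space_axioms _ o3])
  have o6: "o_p1 P m6" unfolding m6_def[abs_def] by (intro o_p1_cmult prob_space_axioms iter_o_p1)
  define D where "D T \<omega> = m1 T \<omega> + m2 T \<omega> + m4 T \<omega> + m5 T \<omega> + m6 T \<omega>" for T \<omega>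
  have "o_p1 P D" unfolding D_def[abs_def] by (intro o_p1_add prob_space_axioms o1 o2 o4 o5 o6)
  moreover have "root_inv T * \<bar>\<Sum>t\<in>{c..d}. x T t \<omega> $ i * \<eta> t \<omega> $ j\<bar> \<le> D T \<omega>" 
    if \<omega>: "\<omega> \<in> space P" and cd: "{c..d} \<subseteq> window T" for T \<omega> c d
  proof -
    have s: "{c..d} \<subseteq> {1..int T}" "{c..d} \<subseteq> {a T..<a T + 2 ^ k T}" using cd by auto
    let ?r = "root_inv T" and ?e = "\<lambda>t. \<eta> t \<omega> $ j" and ?g = "\<lambda>t. psum (w_step i \<omega>) (a T) (nat (t - a T))"
    have eq: "x T t \<omega> $ i * ?e t = in_sample T t * (z t \<omega> $ i * ?e t) + tw T t * ?e t 
        + (?r * w (a T) \<omega> $ i) * (in_sample T t * ?e t) + ?r * (?g t * (in_sample T t * ?e t))" if t: "t \<in> {c..d}" for t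
    proof -
      have "t \<in> {1..int T}" "a T \<le> t" using s t by auto
      thus ?thesis using x[OF _ \<omega>, of t T] w_increment_component[OF start(1)[of T] _ \<omega>, of t i]
        by (simp add: in_sample_def tw_def algebra_simps)
    qed
    define A1 where "A1 = (\<Sum>t\<in>{c..d}. in_sample T t * (z t \<omega> $ i * ?e t))"
    define A2 where "A2 = (\<Sum>t\<in>{c..d}. tw T t * ?e t)"
    define A3 where "A3 = (\<Sum>t\<in>{c..d}. in_sample T t * ?e t)"
    define A4 where "A4 = (\<Sum>t\<in>{c..d}. ?g t * (in_sample T t * ?e t))"
    have "(\<Sum>t\<in>{c..d}. x T t \<omega> $ i * ?e t) = A1 + A2 + (?r * w (a T) \<omega> $ i) * A3 + ?r * A4"
      unfolding A1_def A2_def A3_def A4_def sum_distrib_left sum.distrib[symmetric] by (intro sum.cong refl eq)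
    moreover have "\<bar>A1 + A2 + (?r * w (a T) \<omega> $ i) * A3 + ?r * A4\<bar> \<le> \<bar>A1\<bar> + \<bar>A2\<bar> + \<bar>?r * w (a T) \<omega> $ i\<bar> * \<bar>A3\<bar> + ?r * \<bar>A4\<bar>"
      by (intro order_trans[OF abs_triangle_ineq] add_mono order_refl) (simp_all add: abs_mult)
    ultimately have "?r * \<bar>\<Sum>t\<in>{c..d}. x T t \<omega> $ i * ?e t\<bar> \<le> ?r * (\<bar>A1\<bar> + \<bar>A2\<bar> + \<bar>?r * w (a T) \<omega> $ i\<bar> * \<bar>A3\<bar> + ?r * \<bar>A4\<bar>)"
      by (intro mult_left_mono) auto
    also have "\<dots> = ?r * \<bar>A1\<bar> + ?r * \<bar>A2\<bar> + \<bar>?r * w (a T) \<omega> $ i\<bar> * (?r * \<bar>A3\<bar>) + ?r\<^sup>2 * \<bar>A4\<bar>"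
      by (simp add: algebra_simps power2_eq_square)
    also have "\<dots> \<le> m1 T \<omega> + m2 T \<omega> + \<bar>?r * w (a T) \<omega> $ i\<bar> * m3 T \<omega> + m6 T \<omega>"
    proof -
      have 1: "?r * \<bar>A1\<bar> \<le> m1 T \<omega>" unfolding A1_def m1_def by (rule window_sum_le[OF s(2)])
      have 2: "?r * \<bar>A2\<bar> \<le> m2 T \<omega>" unfolding A2_def m2_def by (rule window_sum_le[OF s(2)])
      have 3: "?r * \<bar>A3\<bar> \<le> m3 T \<omega>" unfolding A3_def m3_def by (rule window_sum_le[OF s(2)])
      have "?r\<^sup>2 * \<bar>A4\<bar> \<le> ?r\<^sup>2 * (2 * dyadic_iter (w_step i \<omega>) (\<lambda>t. in_sample T t * ?e t) (k T) (a T))"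
        unfolding A4_def by (intro mult_left_mono interval_iter_le s) auto
      hence 4: "?r\<^sup>2 * \<bar>A4\<bar> \<le> m6 T \<omega>" by (simp add: m6_def root_inv_sq)
      show ?thesis by (intro add_mono 1 2 4 mult_left_mono 3) auto
    qed
    also have "\<bar>?r * w (a T) \<omega> $ i\<bar> * m3 T \<omega> \<le> m4 T \<omega> + m5 T \<omega>"
    proof -
      have "w (a T) \<omega> $ i = w 0 \<omega> $ i + psum (w_step i \<omega>) 0 (nat (a T))"
        using w_increment_component[OF order_refl start(1) \<omega>] by simp
      hence "\<bar>?r * w (a T) \<omega> $ i\<bar> \<le> ?r * \<bar>psum (w_step i \<omega>) 0 (nat (a T))\<bar> + ?r * \<bar>w 0 \<omega> $ i\<bar>"
        by (simp add: abs_mult distrib_left[symmetric] mult_left_mono)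
      hence "\<bar>?r * w (a T) \<omega> $ i\<bar> * m3 T \<omega> \<le> (?r * \<bar>psum (w_step i \<omega>) 0 (nat (a T))\<bar> + ?r * \<bar>w 0 \<omega> $ i\<bar>) * m3 T \<omega>"
        by (intro mult_right_mono) (auto simp: m3_def max_sq_nonneg)
      thus ?thesis by (simp add: m4_def m5_def distrib_right)
    qed
    finally show ?thesis by (simp add: D_def)
  qed
  ultimately show ?thesis by (rule that)
qed

lemma score_bound:
  obtains D where "o_p1 P D" 
    "\<And>T \<omega> c d. \<omega> \<in> space P \<Longrightarrow> {c..d} \<subseteq> window T \<Longrightarrow> root_inv T * norm (\<Sum>t\<in>{c..d}. outer (x T t \<omega>) (\<eta> t \<omega>)) \<le> D T \<omega>"
proof -
  define good where "good i j D \<longleftrightarrow> o_p1 P D \<and> (\<forall>T \<omega> c d. \<omega> \<in> space P \<longrightarrow> {c..d} \<subseteq> window T \<longrightarrow>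
      root_inv T * \<bar>\<Sum>t\<in>{c..d}. x T t \<omega> $ i * \<eta> t \<omega> $ j\<bar> \<le> D T \<omega>)" for i j D
  have "\<exists>D. good i j D" for i j
  proof -
    obtain D where "o_p1 P D" "\<And>T \<omega> c d. \<omega> \<in> space P \<Longrightarrow> {c..d} \<subseteq> window T \<Longrightarrow> root_inv T * \<bar>\<Sum>t\<in>{c..d}. x T t \<omega> $ i * \<eta> t \<omega> $ j\<bar> \<le> D T \<omega>"
      by (fact score_entry_bound[of i j])
    hence "good i j D" unfolding good_def by (intro conjI allI impI)
    thus ?thesis by (rule exI[of "good i j" D])
  qed
  then obtain E where good: "good i j (E i j)" for i j by metis
  have E: "o_p1 P (E i j)" for i j using good[of i j] by (simp add: good_def)
  have E': "root_inv T * \<bar>\<Sum>t\<in>{c..d}. x T t \<omega> $ i * \<eta> t \<omega> $ j\<bar> \<le> E i j T \<omega>" 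
    if "\<omega> \<in> space P" "{c..d} \<subseteq> window T" for i j T \<omega> c d
    using good[of i j] that unfolding good_def by blast
  define D where "D T \<omega> = (\<Sum>i\<in>UNIV. \<Sum>j\<in>UNIV. E i j T \<omega>)" for T \<omega>
  have "o_p1 P D" unfolding D_def[abs_def] by (intro o_p1_sum prob_space_axioms E)
  moreover have "root_inv T * norm (\<Sum>t\<in>{c..d}. outer (x T t \<omega>) (\<eta> t \<omega>)) \<le> D T \<omega>"
    if "\<omega> \<in> space P" "{c..d} \<subseteq> window T" for T \<omega> c d
  proof -
    have "root_inv T * norm (\<Sum>t\<in>{c..d}. outer (x T t \<omega>) (\<eta> t \<omega>))
      \<le> root_inv T * (\<Sum>i\<in>UNIV. \<Sum>j\<in>UNIV. \<bar>(\<Sum>t\<in>{c..d}. outer (x T t \<omega>) (\<eta> t \<omega>)) $ i $ j\<bar>)"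
      by (intro mult_left_mono norm_le_entry_sum) auto
    also have "\<dots> = (\<Sum>i\<in>UNIV. \<Sum>j\<in>UNIV. root_inv T * \<bar>\<Sum>t\<in>{c..d}. x T t \<omega> $ i * \<eta> t \<omega> $ j\<bar>)"
      by (simp add: sum_distrib_left outer_def)
    also have "\<dots> \<le> D T \<omega>" unfolding D_def by (intro sum_mono E' that)
    finally show ?thesis .
  qed
  ultimately show ?thesis by (rule that)
qed

text \<open>Apart from w_0, the squared regressors have bounded mean: that of |w_t - w_0|^2 / T is
  at most C t / T. With at most 2^k dates the second rate of the locale applies. No moments of w_0
  being given, it is kept apart as a fixed random variable.\<close>

lemma regressor_square_bound:
  obtains D where "o_p1 P D" 
    "\<And>T \<omega> c d. 1 \<le> T \<Longrightarrow> \<omega> \<in> space P \<Longrightarrow> {c..d} \<subseteq> window T \<Longrightarrow>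
      (v T * root_inv T + (root_inv T)\<^sup>2) * (\<Sum>t\<in>{c..d}. 1 + (norm (x T t \<omega>))\<^sup>2) \<le> D T \<omega>"
proof -
  obtain C where C: "0 \<le> C" 
    "\<And>s t. s \<le> t \<Longrightarrow> integrable P (\<lambda>\<omega>. (norm (\<Sum>i\<in>{s<..t}. uw i \<omega>))\<^sup>2) \<and> (LINT \<omega>|P. (norm (\<Sum>i\<in>{s<..t}. uw i \<omega>))\<^sup>2) \<le> C * of_int (t - s)"
    by (fact increment_moments)
  obtain Cz where Cz: "\<And>t. integrable P (\<lambda>\<omega>. (norm (z t \<omega>))\<^sup>2) \<and> (LINT \<omega>|P. (norm (z t \<omega>))\<^sup>2) \<le> Cz"
    using z unfolding stationary_type_def by blast
  define r where "r T = v T * root_inv T + (root_inv T)\<^sup>2" for T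
  have r0: "0 \<le> r T" for T using v_pos[of T] by (simp add: r_def)
  define q where "q = real CARD('q)"
  define inc where "inc t \<omega> = (norm (\<Sum>s\<in>{0<..t}. uw s \<omega>))\<^sup>2" for t \<omega>
  \<comment> \<open>The factor 4 comes from \<open>norm_sum4_sq\<close>, and q bounds the squared
    norm of the trend part.\<close>
  define Y where "Y T t \<omega> = 1 + 4 * ((norm (z t \<omega>))\<^sup>2 + q + inc t \<omega> / real T)" for T t \<omega>
  define S where "S T \<omega> = r T * (\<Sum>t\<in>window T. Y T t \<omega>)" for T \<omega>
  define W0 where "W0 T \<omega> = (r T * 2 ^ k T) * (4 * (norm (w 0 \<omega>))\<^sup>2)" for T \<omega>
  have card: "real (card (window T)) \<le> 2 ^ k T" for T
  proof -
    have "card (window T) \<le> card {a T..<a T + 2 ^ k T}" by (intro card_mono) auto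
    also have "\<dots> = 2 ^ k T" by simp
    finally have "real (card (window T)) \<le> real (2 ^ k T)" by (simp only: of_nat_le_iff)
    thus ?thesis by simp
  qed
  define B where "B = 1 + 4 * (Cz + q + C)"
  have "0 \<le> (LINT \<omega>|P. (norm (z 0 \<omega>))\<^sup>2)" by simp
  also have "\<dots> \<le> Cz" using Cz by blast
  finally have B0: "0 \<le> B" using C(1) by (simp add: B_def q_def)
  have Y0: "0 \<le> Y T t \<omega>" for T t \<omega> by (auto simp: Y_def q_def inc_def intro!: add_nonneg_nonneg)
  have oS: "o_p1 P S"
  proof (rule o_p1_markov[OF prob_space_axioms])
    show "(\<lambda>T. (r T * 2 ^ k T) * B) \<longlonglongrightarrow> 0" unfolding r_def using tendsto_mult[OF rate' tendsto_const, of B] by simp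
    show "\<forall>\<^sub>F T in sequentially. integrable P (S T) \<and> (\<forall>\<omega>\<in>space P. 0 \<le> S T \<omega>) \<and> (LINT \<omega>|P. S T \<omega>) \<le> (r T * 2 ^ k T) * B"
      using eventually_ge_at_top[of 1]
    proof eventually_elim
      case (elim T)
      have Y: "integrable P (Y T t) \<and> (LINT \<omega>|P. Y T t \<omega>) \<le> B" if t: "t \<in> window T" for t
      proof
        have i: "integrable P (inc t) \<and> (LINT \<omega>|P. inc t \<omega>) \<le> C * of_int (t - 0)"
          unfolding inc_def[abs_def] by (rule C(2)) (use t in auto)
        show "integrable P (Y T t)" unfolding Y_def[abs_def] using i Cz[of t] by simp
        have "C * of_int (t - 0) \<le> C * real T" using t C(1) by (intro mult_left_mono) auto
        hence i': "(LINT \<omega>|P. inc t \<omega>) / real T \<le> C" using i elim by (simp add: divide_le_eq)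
        have "(LINT \<omega>|P. Y T t \<omega>) = 1 + 4 * ((LINT \<omega>|P. (norm (z t \<omega>))\<^sup>2) + q + (LINT \<omega>|P. inc t \<omega>) / real T)"
          unfolding Y_def using i Cz[of t] by (simp add: prob_space)
        also have "\<dots> \<le> B" unfolding B_def using i' Cz[of t] by simp
        finally show "(LINT \<omega>|P. Y T t \<omega>) \<le> B" .
      qed
      have "(LINT \<omega>|P. S T \<omega>) = r T * (\<Sum>t\<in>window T. LINT \<omega>|P. Y T t \<omega>)"
        unfolding S_def using Y by (simp add: Bochner_Integration.integral_sum)
      also have "\<dots> \<le> r T * (\<Sum>t\<in>window T. B)" using Y r0 by (intro mult_left_mono sum_mono) auto
      also have "\<dots> \<le> r T * (2 ^ k T * B)" using card[of T] B0 r0 by (intro mult_left_mono) (auto intro: mult_right_mono)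
      finally have "(LINT \<omega>|P. S T \<omega>) \<le> (r T * 2 ^ k T) * B" by (simp add: mult.assoc)
      moreover have "integrable P (S T)" unfolding S_def[abs_def] using Y by auto
      moreover have "0 \<le> S T \<omega>" for \<omega> unfolding S_def by (intro mult_nonneg_nonneg sum_nonneg r0 Y0)
      ultimately show ?case by blast
    qed
  qed
  have oW: "o_p1 P W0" unfolding W0_def[abs_def]
  proof (rule o_p1_fixed[OF prob_space_axioms])
    show "(\<lambda>T. r T * 2 ^ k T) \<longlonglongrightarrow> 0" unfolding r_def by (rule rate')
    show "(\<lambda>\<omega>. 4 * (norm (w 0 \<omega>))\<^sup>2) \<in> borel_measurable P" using w0_measurable by measurable
  qed
  define D where "D T \<omega> = S T \<omega> + W0 T \<omega>" for T \<omega>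
  have "o_p1 P D" unfolding D_def[abs_def] by (intro o_p1_add prob_space_axioms oS oW)
  moreover have "(v T * root_inv T + (root_inv T)\<^sup>2) * (\<Sum>t\<in>{c..d}. 1 + (norm (x T t \<omega>))\<^sup>2) \<le> D T \<omega>"
    if T: "1 \<le> T" and \<omega>: "\<omega> \<in> space P" and cd: "{c..d} \<subseteq> window T" for T \<omega> c d
  proof -
    have le: "1 + (norm (x T t \<omega>))\<^sup>2 \<le> Y T t \<omega> + 4 * (norm (w 0 \<omega>))\<^sup>2" if t: "t \<in> window T" for t
    proof -
      have t': "t \<in> {1..int T}" "0 \<le> t" using t by auto
      have "x T t \<omega> = z t \<omega> + trend kind (of_int t / real T) + root_inv T *\<^sub>R (\<Sum>s\<in>{0<..t}. uw s \<omega>) + root_inv T *\<^sub>R w 0 \<omega>"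
        using x[OF t'(1) \<omega>] w_increment[OF order_refl t'(2) \<omega>] by (simp add: scaleR_add_right)
      hence "(norm (x T t \<omega>))\<^sup>2 \<le> 4 * ((norm (z t \<omega>))\<^sup>2 + (norm (trend kind (of_int t / real T)))\<^sup>2 
         + (norm (root_inv T *\<^sub>R (\<Sum>s\<in>{0<..t}. uw s \<omega>)))\<^sup>2 + (norm (root_inv T *\<^sub>R w 0 \<omega>))\<^sup>2)"
        by (simp only: norm_sum4_sq)
      moreover have "(norm (trend kind (of_int t / real T)))\<^sup>2 \<le> q"
      proof -
        have "0 \<le> of_int t / real T" "of_int t / real T \<le> 1" using t' by (auto simp: divide_le_eq)
        hence "\<bar>trend kind (of_int t / real T) $ i\<bar> \<le> 1" for i by (rule trend_bound)
        hence "(\<Sum>i\<in>UNIV. (trend kind (of_int t / real T) $ i)\<^sup>2) \<le> (\<Sum>i\<in>(UNIV :: 'q set). 1)"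
          by (intro sum_mono) (simp add: abs_square_le_1)
        thus ?thesis unfolding power2_norm_eq_inner by (simp add: q_def inner_vec_def power2_eq_square)
      qed
      moreover have "(norm (root_inv T *\<^sub>R (\<Sum>s\<in>{0<..t}. uw s \<omega>)))\<^sup>2 = inc t \<omega> / real T"
        by (simp add: inc_def power_mult_distrib root_inv_sq)
      moreover have "(norm (root_inv T *\<^sub>R w 0 \<omega>))\<^sup>2 \<le> (norm (w 0 \<omega>))\<^sup>2"
      proof -
        have "(1 / real T) * (norm (w 0 \<omega>))\<^sup>2 \<le> 1 * (norm (w 0 \<omega>))\<^sup>2" using T by (intro mult_right_mono) auto
        thus ?thesis by (simp add: power_mult_distrib root_inv_sq)
      qed
      moreover have "1 + n \<le> 1 + 4 * (n1 + q + n3) + 4 * n4" 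
        if "n \<le> 4 * (n1 + n2 + m3 + m4)" "n2 \<le> q" "m3 = n3" "m4 \<le> n4" for n n1 n2 n3 n4 m3 m4 :: real
        using that by simp
      ultimately show ?thesis unfolding Y_def by blast
    qed
    have "(\<Sum>t\<in>{c..d}. 1 + (norm (x T t \<omega>))\<^sup>2) \<le> (\<Sum>t\<in>window T. 1 + (norm (x T t \<omega>))\<^sup>2)"
      using cd by (intro sum_mono2) auto
    also have "\<dots> \<le> (\<Sum>t\<in>window T. Y T t \<omega> + 4 * (norm (w 0 \<omega>))\<^sup>2)" by (intro sum_mono le)
    also have "\<dots> = (\<Sum>t\<in>window T. Y T t \<omega>) + real (card (window T)) * (4 * (norm (w 0 \<omega>))\<^sup>2)"
      by (simp add: sum.distrib)
    also have "\<dots> \<le> (\<Sum>t\<in>window T. Y T t \<omega>) + 2 ^ k T * (4 * (norm (w 0 \<omega>))\<^sup>2)"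
      by (intro add_left_mono mult_right_mono card) auto
    finally have "r T * (\<Sum>t\<in>{c..d}. 1 + (norm (x T t \<omega>))\<^sup>2) \<le> r T * ((\<Sum>t\<in>window T. Y T t \<omega>) + 2 ^ k T * (4 * (norm (w 0 \<omega>))\<^sup>2))"
      by (intro mult_left_mono r0)
    thus ?thesis by (simp add: r_def[symmetric] D_def S_def W0_def distrib_left mult.assoc)
  qed
  ultimately show ?thesis by (rule that)
qed

lemma window_bound:
  obtains D where "o_p1 P D" 
    "\<And>T \<omega> c d. 1 \<le> T \<Longrightarrow> \<omega> \<in> space P \<Longrightarrow> {c..d} \<subseteq> window T \<Longrightarrow>
      fluctuation (root_inv T) (v T) (\<lambda>t. x T t \<omega>) (\<lambda>t. \<eta> t \<omega>) {c..d} \<le> D T \<omega>"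
proof -
  obtain D1 where D1: "o_p1 P D1" 
    "\<And>T \<omega> c d. {c..d} \<subseteq> window T \<Longrightarrow> root_inv T * norm (\<Sum>t\<in>{c..d}. outer (\<eta> t \<omega>) (\<eta> t \<omega>) - mat 1) \<le> D1 T \<omega>"
    by (fact eta_cov_bound)
  obtain D2 where D2: "o_p1 P D2" 
    "\<And>T \<omega> c d. \<omega> \<in> space P \<Longrightarrow> {c..d} \<subseteq> window T \<Longrightarrow> root_inv T * norm (\<Sum>t\<in>{c..d}. outer (x T t \<omega>) (\<eta> t \<omega>)) \<le> D2 T \<omega>"
    by (fact score_bound)
  obtain D3 where D3: "o_p1 P D3" 
    "\<And>T \<omega> c d. 1 \<le> T \<Longrightarrow> \<omega> \<in> space P \<Longrightarrow> {c..d} \<subseteq> window T \<Longrightarrow>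
      (v T * root_inv T + (root_inv T)\<^sup>2) * (\<Sum>t\<in>{c..d}. 1 + (norm (x T t \<omega>))\<^sup>2) \<le> D3 T \<omega>"
    by (fact regressor_square_bound)
  show ?thesis
  proof (rule that[of "\<lambda>T \<omega>. D1 T \<omega> + D2 T \<omega> + D3 T \<omega>"])
    show "o_p1 P (\<lambda>T \<omega>. D1 T \<omega> + D2 T \<omega> + D3 T \<omega>)" by (intro o_p1_add prob_space_axioms D1 D2 D3)
  qed (unfold fluctuation_def, intro add_mono D1(2) D2(2) D3(2))
qed

end

section \<open>Separation of the likelihood\<close>

lemma increasing_chain:
  fixes f :: "nat \<Rightarrow> int"
  assumes "\<And>j. j \<in> {1..n} \<Longrightarrow> f (j - 1) < f j" "i \<le> j" "j \<le> n"
  shows "f i \<le> f j"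
  using assms(2,3)
proof (induction j rule: dec_induct)
  case (step j)
  thus ?case using assms(1)[of "Suc j"] by simp
qed simp

lemma trimmed_dates_increasing:
  assumes K: "K \<in> trimmed_dates G m \<nu> T" and "0 < \<nu>" "1 \<le> T" "g \<in> {1..G}"
  shows "K g 0 = 0" "K g (m + 1) = int T" "\<And>j. j \<in> {1..m + 1} \<Longrightarrow> K g (j - 1) < K g j"
    "\<And>i j. i \<le> j \<Longrightarrow> j \<le> m + 1 \<Longrightarrow> K g i \<le> K g j"
proof -
  show "K g 0 = 0" "K g (m + 1) = int T" using assms by (auto simp: trimmed_dates_def date_space_def)
  show *: "K g (j - 1) < K g j" if "j \<in> {1..m + 1}" for j
  proof -
    have "real T * \<nu> \<le> real_of_int (K g j - K g (j - 1))" using assms that by (auto simp: trimmed_dates_def)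
    moreover have "0 < real T * \<nu>" using assms by simp
    ultimately have "0 < real_of_int (K g j - K g (j - 1))" by linarith
    thus ?thesis by simp
  qed
  show "K g i \<le> K g j" if "i \<le> j" "j \<le> m + 1" for i j
    by (rule increasing_chain[of "m + 1" "K g", OF * that])
qed

text \<open>Trimming makes the dates strictly increasing, so at most one j fits the description in
  \<open>regime\<close>, and the least j with t <= \<open>K g j\<close> does. The second part turns
  a label into two inequalities.\<close>

lemma regime:
  assumes K: "K \<in> trimmed_dates G m \<nu> T" and pos: "0 < \<nu>" "1 \<le> T" and g: "g \<in> {1..G}" and t: "t \<in> {1..int T}"
  shows "regime m K g t \<in> {1..m + 1}"
    "j \<in> {1..m + 1} \<Longrightarrow> regime m K g t = j \<longleftrightarrow> K g (j - 1) < t \<and> t \<le> K g j"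
proof -
  note inc = trimmed_dates_increasing[OF K pos g]
  define j0 where "j0 = (LEAST j. t \<le> K g j)"
  have ex: "t \<le> K g (m + 1)" using t inc(2) by simp
  have j0: "t \<le> K g j0" unfolding j0_def by (rule LeastI[of "\<lambda>j. t \<le> K g j", OF ex])
  have j0m: "j0 \<le> m + 1" unfolding j0_def by (rule Least_le[of "\<lambda>j. t \<le> K g j", OF ex])
  have j01: "1 \<le> j0" using j0 t inc(1) by (cases j0) auto
  have low: "K g (j0 - 1) < t"
    using not_less_Least[of "j0 - 1" "\<lambda>j. t \<le> K g j"] j01 by (simp add: j0_def[symmetric])
  have uniq: "i = j" if "i \<in> {1..m + 1}" "K g (i - 1) < t" "t \<le> K g i" "j \<in> {1..m + 1}" "K g (j - 1) < t" "t \<le> K g j" for i j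
  proof (rule ccontr)
    assume "i \<noteq> j"
    hence "i \<le> j - 1 \<or> j \<le> i - 1" by auto
    thus False using inc(4)[of i "j - 1"] inc(4)[of j "i - 1"] that by fastforce
  qed
  have ex1: "\<exists>!j. j \<in> {1..m + 1} \<and> K g (j - 1) + 1 \<le> t \<and> t \<le> K g j"
  proof (rule ex1I[of _ j0])
    show "j0 \<in> {1..m + 1} \<and> K g (j0 - 1) + 1 \<le> t \<and> t \<le> K g j0" using j0 j0m j01 low by auto
    show "i = j0" if "i \<in> {1..m + 1} \<and> K g (i - 1) + 1 \<le> t \<and> t \<le> K g i" for i
      using uniq[of i j0] that j0 j0m j01 low by auto
  qed
  have r: "regime m K g t \<in> {1..m + 1} \<and> K g (regime m K g t - 1) + 1 \<le> t \<and> t \<le> K g (regime m K g t)"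
    unfolding regime_def by (rule theI'[OF ex1])
  thus "regime m K g t \<in> {1..m + 1}" by blast
  show "regime m K g t = j \<longleftrightarrow> K g (j - 1) < t \<and> t \<le> K g j" if "j \<in> {1..m + 1}"
    using r that uniq[of "regime m K g t" j] by auto
qed

text \<open>Two regimes differ by some of the successive jumps; bounding by all of them frees the
  right side of r and s.\<close>

lemma telescope_le:
  fixes f :: "nat \<Rightarrow> 'v::real_normed_vector"
  assumes f: "\<And>j. j \<in> {1..m} \<Longrightarrow> norm (f (j + 1) - f j) \<le> e j"
    and rs: "r \<in> {1..m + 1}" "s \<in> {1..m + 1}"
  shows "norm (f r - f s) \<le> (\<Sum>j\<in>{1..m}. e j)"
proof -
  have e: "0 \<le> e j" if "j \<in> {1..m}" for j using f[OF that] norm_ge_zero order_trans by blast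
  have up: "norm (f r - f s) \<le> (\<Sum>j\<in>{1..m}. e j)" if "s \<le> r" "1 \<le> s" "r \<le> m + 1" for r s
  proof -
    have "norm (f r - f s) \<le> (\<Sum>j\<in>{s..<r}. e j)" using that(1,3)
    proof (induction r rule: dec_induct)
      case (step r)
      have "norm (f (Suc r) - f s) \<le> norm (f (Suc r) - f r) + norm (f r - f s)"
        using norm_triangle_ineq[of "f (Suc r) - f r" "f r - f s"] by simp
      also have "\<dots> \<le> e r + (\<Sum>j\<in>{s..<r}. e j)" using f[of r] step that by (intro add_mono) auto
      finally show ?case using step by simp
    qed simp
    also have "\<dots> \<le> (\<Sum>j\<in>{1..m}. e j)" using that e by (intro sum_mono2) auto
    finally show ?thesis .
  qed
  show ?thesis
  proof (cases "s \<le> r")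
    case True thus ?thesis using up rs by simp
  next
    case False thus ?thesis using up[of r s] rs by (simp add: norm_minus_commute)
  qed
qed

lemma convex_int_set_interval:
  fixes I :: "int set"
  assumes "finite I" "I \<noteq> {}" "\<And>p q t. p \<in> I \<Longrightarrow> q \<in> I \<Longrightarrow> p \<le> t \<Longrightarrow> t \<le> q \<Longrightarrow> t \<in> I"
  shows "I = {Min I..Max I}"
proof
  show "I \<subseteq> {Min I..Max I}" using assms(1) by auto
  show "{Min I..Max I} \<subseteq> I" using assms(3)[OF Min_in[OF assms(1,2)] Max_in[OF assms(1,2)]] by auto
qed

lemma param_space_pd_within:
  assumes "\<theta> \<in> param_space m c1 c2 c3" "j \<in> {1..m + 1}"
  shows "pd_within c2 c3 (snd (\<theta> j))"
proof -
  have "\<forall>j\<in>{1..m + 1}. norm (fst (\<theta> j)) \<le> c1 \<and> transpose (snd (\<theta> j)) = snd (\<theta> j) \<and>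
        c2 \<le> lam_min (snd (\<theta> j)) \<and> lam_max (snd (\<theta> j)) \<le> c3"
    using assms(1) unfolding param_space_def by blast
  from bspec[OF this assms(2)] show ?thesis by (intro pd_within_lam) simp_all
qed

text \<open>Parameter neighbourhoods are stated in the operator norm, estimates in the Frobenius
  norm; bounding every entry by the operator norm is crude but sufficient.\<close>

lemma norm_le_op_norm: "norm (A :: real^'n^'n) \<le> (real CARD('n))\<^sup>2 * op_norm A"
proof -
  have "norm A \<le> (\<Sum>i\<in>(UNIV :: 'n set). \<Sum>j\<in>(UNIV :: 'n set). op_norm A)"
    unfolding op_norm_def
    by (intro order_trans[OF norm_le_entry_sum] sum_mono matrix_component_le_onorm)
  thus ?thesis by (simp add: power2_eq_square)
qed

text \<open>Deterministic, for one outcome. Dates are grouped into cells by their labels under K and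
  K0. Where the labels agree the cross difference is 0; any other nonempty cell is an interval close
  to a true break. The number of cells depends only on G and m, and each costs two applications of
  \<open>gauss_loglik_diff_le\<close>.\<close>

lemma likelihood_separation:
  fixes S :: "real^'p::finite^('q::finite \<times> 'n::finite)" and x :: "int \<Rightarrow> real^'q" and y \<eta> :: "int \<Rightarrow> real^'n"
    and \<theta> \<theta>0 :: "('p, 'n) param" and D :: "nat \<Rightarrow> nat \<Rightarrow> real"
  assumes pos: "0 < \<nu>" "1 \<le> T" and G: "1 \<le> G" and c2: "0 < c2"
    and K: "K \<in> trimmed_dates G m \<nu> T" and K0: "K0 \<in> trimmed_dates G m \<nu> T"
    and near: "\<And>g j. g \<in> {1..G} \<Longrightarrow> j \<in> {1..m} \<Longrightarrow> \<bar>K g j - K0 g j\<bar> \<le> N"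
    and \<theta>: "\<theta> \<in> param_space m c1 c2 c3" and \<theta>0: "\<theta>0 \<in> param_space m c1 c2 c3"
    and y: "\<And>t. t \<in> {1..int T} \<Longrightarrow> 
      y t = transpose (Xmat S (x t)) *v beta_at G m grp K0 \<theta>0 t + mat_sqrt (Sigma_at G m K0 \<theta>0 t) *v \<eta> t"
    and C: "1 \<le> C" "real CARD('n) / c2 \<le> C" "real CARD('n) * c3 \<le> C\<^sup>2"
    and \<tau>: "0 \<le> \<tau>" and v: "0 \<le> v" "v \<le> 1"
    and beta: "\<And>g j. g \<in> {1..G} \<Longrightarrow> j \<in> {1..m + 1} \<Longrightarrow> norm (beta_grp grp \<theta> g j - beta_grp grp \<theta>0 g j) \<le> M * \<tau>"
    and Sigma: "\<And>j. j \<in> {1..m + 1} \<Longrightarrow> norm (snd (\<theta> j) - snd (\<theta>0 j)) \<le> C * \<tau>"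
    and jump_beta: "\<And>g r s. g \<in> {1..G} \<Longrightarrow> r \<in> {1..m + 1} \<Longrightarrow> s \<in> {1..m + 1} \<Longrightarrow> 
      norm (beta_grp grp \<theta>0 g r - beta_grp grp \<theta>0 g s) \<le> e g * v"
    and jump_Sigma: "\<And>r s. r \<in> {1..m + 1} \<Longrightarrow> s \<in> {1..m + 1} \<Longrightarrow> norm (snd (\<theta>0 r) - snd (\<theta>0 s)) \<le> C * v"
    and CS: "norm S * (real G * M) \<le> C" "norm S * (\<Sum>g\<in>{1..G}. e g) \<le> C"
    and D: "\<And>g j c d. g \<in> {1..G} \<Longrightarrow> j \<in> {1..m} \<Longrightarrow> {c..d} \<subseteq> {1..int T} \<inter> {K0 g j - N..K0 g j + N} \<Longrightarrow>
      fluctuation \<tau> v x \<eta> {c..d} \<le> D g j"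
    and D0: "\<And>g j. 0 \<le> D g j"
  shows "\<bar>log_lik_ratio G m grp S T x y K0 \<theta>0 K \<theta> - log_lik_ratio G m grp S T x y K0 \<theta>0 K \<theta>0
      - log_lik_ratio G m grp S T x y K0 \<theta>0 K0 \<theta>\<bar>
    \<le> real (card (({1..G} \<rightarrow>\<^sub>E {1..m + 1}) \<times> ({1..G} \<rightarrow>\<^sub>E {1..m + 1}))) * (4 * C ^ 5 * (\<Sum>g\<in>{1..G}. \<Sum>j\<in>{1..m}. D g j))"
proof -
  define Q where "Q = {1..G} \<rightarrow>\<^sub>E {1..m + 1}"
  define bt where "bt \<theta> r = (\<Sum>g\<in>{1..G}. beta_grp grp \<theta> g (r g))" for \<theta> :: "('p, 'n) param" and r
  define Vt where "Vt \<theta> r = snd (\<theta> (r G))" for \<theta> :: "('p, 'n) param" and r :: "nat \<Rightarrow> nat"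
  define h where "h \<theta> r t = ln (gauss_dens (y t) (Xmat S (x t)) (bt \<theta> r) (Vt \<theta> r))" for \<theta> r t
  \<comment> \<open>Restricted to \<open>{1..G}\<close>, so that labels range over a finite set of
    tuples and are equal once they agree in each group.\<close>
  define lab where "lab K t = (\<lambda>g\<in>{1..G}. regime m K g t)" for K t
  have GG: "G \<in> {1..G}" using G by simp
  have labQ: "lab K' t \<in> Q" if "K' \<in> trimmed_dates G m \<nu> T" "t \<in> {1..int T}" for K' t
    using regime(1)[OF that(1) pos _ that(2)] by (auto simp: Q_def lab_def)
  have bt: "beta_at G m grp K' \<theta>' t = bt \<theta>' (lab K' t)" "Sigma_at G m K' \<theta>' t = Vt \<theta>' (lab K' t)" for K' \<theta>' t
    using GG by (simp_all add: beta_at_def Sigma_at_def bt_def Vt_def lab_def)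
  have pd: "pd_within c2 c3 (Vt \<theta>' r)" if "\<theta>' \<in> param_space m c1 c2 c3" "r \<in> Q" for \<theta>' r
    unfolding Vt_def using that(2) GG by (intro param_space_pd_within[OF that(1)]) (auto simp: Q_def)
  have lik: "ln (quasi_lik G m grp S T x y K' \<theta>') = (\<Sum>t\<in>{1..int T}. h \<theta>' (lab K' t) t)"
    if "K' \<in> trimmed_dates G m \<nu> T" "\<theta>' \<in> param_space m c1 c2 c3" for K' \<theta>'
  proof -
    have "0 < gauss_dens (y t) (Xmat S (x t)) (bt \<theta>' (lab K' t)) (Vt \<theta>' (lab K' t))" if "t \<in> {1..int T}" for t
      by (rule ln_gauss_dens(1)[OF pd c2]) (use labQ that \<open>K' \<in> _\<close> \<open>\<theta>' \<in> _\<close> in auto)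
    thus ?thesis unfolding quasi_lik_def bt h_def by (intro ln_prod) (auto simp: less_imp_neq[symmetric])
  qed
  define f where "f t = (h \<theta> (lab K t) t - h \<theta>0 (lab K t) t) - (h \<theta> (lab K0 t) t - h \<theta>0 (lab K0 t) t)" for t
  have "log_lik_ratio G m grp S T x y K0 \<theta>0 K \<theta> - log_lik_ratio G m grp S T x y K0 \<theta>0 K \<theta>0
      - log_lik_ratio G m grp S T x y K0 \<theta>0 K0 \<theta> = (\<Sum>t\<in>{1..int T}. f t)"
    unfolding log_lik_ratio_def lik[OF K \<theta>] lik[OF K \<theta>0] lik[OF K0 \<theta>] lik[OF K0 \<theta>0] f_def
    by (simp add: sum_subtractf)
  also have "\<dots> = (\<Sum>rs\<in>Q \<times> Q. \<Sum>t\<in>{t \<in> {1..int T}. (lab K t, lab K0 t) = rs}. f t)"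
  proof (rule sum.group[symmetric])
    have "finite Q" unfolding Q_def by (intro finite_PiE) auto
    thus "finite (Q \<times> Q)" by simp
    show "(\<lambda>t. (lab K t, lab K0 t)) ` {1..int T} \<subseteq> Q \<times> Q" using labQ[OF K] labQ[OF K0] by blast
  qed simp
  finally have eq: "log_lik_ratio G m grp S T x y K0 \<theta>0 K \<theta> - log_lik_ratio G m grp S T x y K0 \<theta>0 K \<theta>0
      - log_lik_ratio G m grp S T x y K0 \<theta>0 K0 \<theta> = (\<Sum>rs\<in>Q \<times> Q. \<Sum>t\<in>{t \<in> {1..int T}. (lab K t, lab K0 t) = rs}. f t)" .
  define Dt where "Dt = (\<Sum>g\<in>{1..G}. \<Sum>j\<in>{1..m}. D g j)"
  have Dle: "D g j \<le> Dt" if "g \<in> {1..G}" "j \<in> {1..m}" for g j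
  proof -
    have "D g j \<le> (\<Sum>j\<in>{1..m}. D g j)" using that D0 by (intro member_le_sum) auto
    also have "\<dots> \<le> Dt" unfolding Dt_def 
      by (rule member_le_sum[of g "{1..G}" "\<lambda>g. \<Sum>j\<in>{1..m}. D g j"]) (use that D0 in \<open>auto intro: sum_nonneg\<close>)
    finally show ?thesis .
  qed
  have C5: "0 \<le> 4 * C ^ 5 * Dt" using C(1) D0 by (auto simp: Dt_def intro!: mult_nonneg_nonneg sum_nonneg)
  have part: "\<bar>\<Sum>t\<in>{t \<in> {1..int T}. (lab K t, lab K0 t) = (r, s)}. f t\<bar> \<le> 4 * C ^ 5 * Dt" if rs: "r \<in> Q" "s \<in> Q" for r s
  proof -
    define I where "I = {t \<in> {1..int T}. (lab K t, lab K0 t) = (r, s)}"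
    have lab: "lab K t = r" "lab K0 t = s" "t \<in> {1..int T}" if "t \<in> I" for t using that by (auto simp: I_def)
    show ?thesis
    proof (cases "r = s \<or> I = {}")
      case True
      hence "(\<Sum>t\<in>I. f t) = 0" by (auto simp: f_def lab)
      thus ?thesis using C5 by (simp add: I_def)
    next
      case False
      have rg: "r g \<in> {1..m + 1}" "s g \<in> {1..m + 1}" if "g \<in> {1..G}" for g using rs that by (auto simp: Q_def)
      have I_iff: "t \<in> I \<longleftrightarrow> t \<in> {1..int T} \<and> (\<forall>g\<in>{1..G}. K g (r g - 1) < t \<and> t \<le> K g (r g) \<and> K0 g (s g - 1) < t \<and> t \<le> K0 g (s g))" for t
      proof (cases "t \<in> {1..int T}")
        case t: True
        have ext: "lab K' t = q \<longleftrightarrow> (\<forall>g\<in>{1..G}. regime m K' g t = q g)" if "q \<in> Q" for K' q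
          using that unfolding lab_def Q_def by (auto simp: fun_eq_iff PiE_def extensional_def)
        have "lab K t = r \<longleftrightarrow> (\<forall>g\<in>{1..G}. K g (r g - 1) < t \<and> t \<le> K g (r g))"
          unfolding ext[OF rs(1)] using regime(2)[OF K pos _ t rg(1)] by blast
        moreover have "lab K0 t = s \<longleftrightarrow> (\<forall>g\<in>{1..G}. K0 g (s g - 1) < t \<and> t \<le> K0 g (s g))"
          unfolding ext[OF rs(2)] using regime(2)[OF K0 pos _ t rg(2)] by blast
        ultimately show ?thesis using t by (auto simp: I_def)
      qed (auto simp: I_def)
      have finI: "finite I" unfolding I_def by (rule finite_subset[of _ "{1..int T}"]) auto
      have conv: "t \<in> I" if pq: "p \<in> I" "q \<in> I" "p \<le> t" "t \<le> q" for p q t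
        unfolding I_iff
      proof
        show "t \<in> {1..int T}" using pq lab(3) by fastforce
        show "\<forall>g\<in>{1..G}. K g (r g - 1) < t \<and> t \<le> K g (r g) \<and> K0 g (s g - 1) < t \<and> t \<le> K0 g (s g)"
        proof
          fix g assume g: "g \<in> {1..G}"
          show "K g (r g - 1) < t \<and> t \<le> K g (r g) \<and> K0 g (s g - 1) < t \<and> t \<le> K0 g (s g)"
            using bspec[OF conjunct2[OF pq(1)[unfolded I_iff]] g] bspec[OF conjunct2[OF pq(2)[unfolded I_iff]] g] pq(3,4)
            by linarith
        qed
      qed
      define c d where "c = Min I" and "d = Max I"
      have cd: "I = {c..d}" unfolding c_def d_def
        by (rule convex_int_set_interval[OF finI _ conv]) (use False in simp_all)
      have "\<exists>g\<in>{1..G}. r g \<noteq> s g"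
      proof (rule ccontr)
        assume "\<not> (\<exists>g\<in>{1..G}. r g \<noteq> s g)"
        hence "r = s" using rs unfolding Q_def by (intro PiE_ext) auto
        thus False using False by simp
      qed
      then obtain g where g: "g \<in> {1..G}" "r g \<noteq> s g" by blast
      note inc = trimmed_dates_increasing(4)[OF K pos g(1)] and inc0 = trimmed_dates_increasing(4)[OF K0 pos g(1)]
      have "\<exists>j\<in>{1..m}. I \<subseteq> {1..int T} \<inter> {K0 g j - N..K0 g j + N}"
      proof (cases "r g < s g")
        case True
        have j: "r g \<in> {1..m}" using True rg[OF g(1)] by auto
        \<comment> \<open>Break number r g is already past under K0 but not under K: the dates lie
          after \<open>K0 g (r g)\<close> and up to \<open>K g (r g)\<close>, which are at most N
          apart.\<close>
        have ineq: "K0 g (r g) \<le> K0 g (s g - 1)" using True rg[OF g(1)] by (intro inc0) auto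
        have "t \<in> {1..int T} \<inter> {K0 g (r g) - N..K0 g (r g) + N}" if "t \<in> I" for t
        proof -
          note tI = that[unfolded I_iff]
          show ?thesis using conjunct1[OF tI] bspec[OF conjunct2[OF tI] g(1)] near[OF g(1) j] ineq by (simp add: abs_le_iff)
        qed
        thus ?thesis using j by blast
      next
        case False
        hence lt: "s g < r g" using g by simp
        have j: "s g \<in> {1..m}" using lt rg[OF g(1)] by auto
        \<comment> \<open>The mirror case: the dates lie after \<open>K g (s g)\<close> and up to
          \<open>K0 g (s g)\<close>.\<close>
        have ineq: "K g (s g) \<le> K g (r g - 1)" using lt rg[OF g(1)] by (intro inc) auto
        have "t \<in> {1..int T} \<inter> {K0 g (s g) - N..K0 g (s g) + N}" if "t \<in> I" for t
        proof -
          note tI = that[unfolded I_iff]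
          show ?thesis using conjunct1[OF tI] bspec[OF conjunct2[OF tI] g(1)] near[OF g(1) j] ineq by (simp add: abs_le_iff)
        qed
        thus ?thesis using j by blast
      qed
      then obtain j where j: "j \<in> {1..m}" "I \<subseteq> {1..int T} \<inter> {K0 g j - N..K0 g j + N}" by blast
      have DI: "fluctuation \<tau> v x \<eta> I \<le> Dt"
        using D[OF g(1) j(1), of c d] j(2) Dle[OF g(1) j(1)] unfolding cd by linarith
      have yI: "y t = transpose (Xmat S (x t)) *v bt \<theta>0 s + mat_sqrt (Vt \<theta>0 s) *v \<eta> t" if "t \<in> I" for t
        using y[OF lab(3)[OF that]] unfolding bt lab(2)[OF that] .
      \<comment> \<open>The true parameters in the cell carry label s. The change from \<theta>0 to
        \<theta> is estimated at the labels r and s alike; at r the point of evaluation is off the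
        truth by jumps of order v.\<close>
      have diff: "\<bar>(\<Sum>t\<in>I. h \<theta> q t) - (\<Sum>t\<in>I. h \<theta>0 q t)\<bar> \<le> 2 * C ^ 5 * Dt" if q: "q \<in> Q" for q
      proof -
        have qg: "q g \<in> {1..m + 1}" if "g \<in> {1..G}" for g using q that by (auto simp: Q_def)
        have "norm (bt \<theta> q - bt \<theta>0 q) \<le> (\<Sum>g\<in>{1..G}. M * \<tau>)"
          unfolding bt_def sum_subtractf[symmetric] by (intro sum_norm_le beta qg)
        from mult_left_mono[OF this norm_ge_zero[of S]]
        have "norm S * norm (bt \<theta> q - bt \<theta>0 q) \<le> norm S * (real G * M) * \<tau>" by (simp add: mult_ac)
        also have "\<dots> \<le> C * \<tau>" by (intro mult_right_mono CS \<tau>)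
        finally have b1: "norm S * norm (bt \<theta> q - bt \<theta>0 q) \<le> C * \<tau>" .
        have "norm (bt \<theta>0 q - bt \<theta>0 s) \<le> (\<Sum>g\<in>{1..G}. e g * v)"
          unfolding bt_def sum_subtractf[symmetric] by (intro sum_norm_le jump_beta qg rg)
        from mult_left_mono[OF this norm_ge_zero[of S]]
        have "norm S * norm (bt \<theta>0 q - bt \<theta>0 s) \<le> norm S * (\<Sum>g\<in>{1..G}. e g) * v"
          by (simp only: sum_distrib_right mult.assoc)
        also have "\<dots> \<le> C * v" by (intro mult_right_mono CS v)
        finally have b2: "norm S * norm (bt \<theta>0 q - bt \<theta>0 s) \<le> C * v" .
        have V: "norm (Vt \<theta> q - Vt \<theta>0 q) \<le> C * \<tau>" "norm (Vt \<theta>0 q - Vt \<theta>0 s) \<le> C * v"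
          unfolding Vt_def by (intro Sigma jump_Sigma qg rg GG)+
        have "\<bar>(\<Sum>t\<in>I. h \<theta> q t) - (\<Sum>t\<in>I. h \<theta>0 q t)\<bar> \<le> 2 * C ^ 5 * fluctuation \<tau> v x \<eta> I"
          unfolding h_def
          by (rule gauss_loglik_diff_le[OF pd[OF \<theta>0 q] pd[OF \<theta> q] pd[OF \<theta>0 rs(2)] c2 yI C \<tau> v V b1 b2])
        also have "\<dots> \<le> 2 * C ^ 5 * Dt" using C(1) by (intro mult_left_mono DI) auto
        finally show ?thesis .
      qed
      have "(\<Sum>t\<in>I. f t) = ((\<Sum>t\<in>I. h \<theta> r t) - (\<Sum>t\<in>I. h \<theta>0 r t)) - ((\<Sum>t\<in>I. h \<theta> s t) - (\<Sum>t\<in>I. h \<theta>0 s t))"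
        by (simp add: f_def lab sum_subtractf cong: sum.cong)
      hence "\<bar>\<Sum>t\<in>I. f t\<bar> \<le> 4 * C ^ 5 * Dt" using diff[OF rs(1)] diff[OF rs(2)] by linarith
      thus ?thesis by (simp add: I_def)
    qed
  qed
  have "\<bar>\<Sum>rs\<in>Q \<times> Q. \<Sum>t\<in>{t \<in> {1..int T}. (lab K t, lab K0 t) = rs}. f t\<bar> \<le> (\<Sum>rs\<in>Q \<times> Q. 4 * C ^ 5 * Dt)"
  proof (rule order_trans[OF sum_abs sum_mono])
    fix rs assume "rs \<in> Q \<times> Q"
    then obtain r s where "rs = (r, s)" "r \<in> Q" "s \<in> Q" by blast
    thus "\<bar>\<Sum>t\<in>{t \<in> {1..int T}. (lab K t, lab K0 t) = rs}. f t\<bar> \<le> 4 * C ^ 5 * Dt"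
      using part[of r s] by (simp only:)
  qed
  thus ?thesis unfolding eq by (simp add: Q_def Dt_def)
qed

text \<open>A supremum may be infinite, since the multiplier term is arbitrary; then both sides are
  infinite and r = 0 serves. Nonemptiness excludes the value minus infinity and so keeps the sum of
  suprema meaningful.\<close>

lemma SUP_add_remainder:
  fixes f :: "'k \<Rightarrow> 't \<Rightarrow> real"
  assumes ne: "A \<noteq> {}" "B \<noteq> {}" and le: "\<And>a b. a \<in> A \<Longrightarrow> b \<in> B \<Longrightarrow> \<bar>f a b - g a - h b\<bar> \<le> Z"
  shows "\<exists>r. \<bar>r\<bar> \<le> Z \<and>
    (SUP (a, b)\<in>A \<times> B. ereal (f a b)) = (SUP a\<in>A. ereal (g a)) + (SUP b\<in>B. ereal (h b)) + ereal r"
proof -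
  define L where "L = (SUP (a, b)\<in>A \<times> B. ereal (f a b))"
  define gs where "gs = (SUP a\<in>A. ereal (g a))"
  define hs where "hs = (SUP b\<in>B. ereal (h b))"
  obtain a0 b0 where ab: "a0 \<in> A" "b0 \<in> B" using ne by blast
  have Z: "0 \<le> Z" using le[OF ab] by linarith
  have gs_up: "ereal (g a) \<le> gs" if "a \<in> A" for a unfolding gs_def using that by (rule SUP_upper)
  have hs_up: "ereal (h b) \<le> hs" if "b \<in> B" for b unfolding hs_def using that by (rule SUP_upper)
  have L_up: "ereal (f a b) \<le> L" if "a \<in> A" "b \<in> B" for a b
    unfolding L_def using SUP_upper[of "(a, b)" "A \<times> B" "\<lambda>(a, b). ereal (f a b)"] that by simp
  have fin: "gs \<noteq> -\<infinity>" "hs \<noteq> -\<infinity>" using gs_up[OF ab(1)] hs_up[OF ab(2)] by auto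
  have upper: "L \<le> gs + hs + ereal Z"
    unfolding L_def
  proof (intro SUP_least, clarify)
    fix a b assume "a \<in> A" "b \<in> B"
    have "ereal (f a b) \<le> ereal (g a) + ereal (h b) + ereal Z" using le[OF \<open>a \<in> A\<close> \<open>b \<in> B\<close>] by simp
    also have "\<dots> \<le> gs + hs + ereal Z" by (intro add_mono gs_up hs_up \<open>a \<in> A\<close> \<open>b \<in> B\<close> order_refl)
    finally show "ereal (f a b) \<le> gs + hs + ereal Z" .
  qed
  have lower: "gs + hs \<le> L + ereal Z"
  proof -
    have 1: "gs + ereal (h b) \<le> L + ereal Z" if b: "b \<in> B" for b
    proof -
      have "gs + ereal (h b) = (SUP a\<in>A. ereal (g a) + ereal (h b))"
        unfolding gs_def using ne(1) by (intro SUP_ereal_add_left[symmetric]) auto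
      also have "\<dots> \<le> L + ereal Z"
      proof (intro SUP_least)
        fix a assume a: "a \<in> A"
        have "ereal (g a) + ereal (h b) \<le> ereal (f a b) + ereal Z" using le[OF a b] by simp
        also have "\<dots> \<le> L + ereal Z" by (intro add_mono L_up a b order_refl)
        finally show "ereal (g a) + ereal (h b) \<le> L + ereal Z" .
      qed
      finally show ?thesis .
    qed
    have "gs + hs = (SUP b\<in>B. gs + ereal (h b))"
      unfolding hs_def using ne(2) fin(1) by (intro SUP_ereal_add_right[symmetric]) auto
    also have "\<dots> \<le> L + ereal Z" by (intro SUP_least 1)
    finally show ?thesis .
  qed
  have "\<exists>r. \<bar>r\<bar> \<le> Z \<and> L = gs + hs + ereal r"
  proof (cases "gs = \<infinity> \<or> hs = \<infinity>")
    case True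
    hence "gs + hs = \<infinity>" using fin by auto
    moreover from this have "L = \<infinity>" using lower by (cases L) auto
    ultimately show ?thesis using Z by (intro exI[of _ 0]) simp
  next
    case False
    then obtain p q where pq: "gs = ereal p" "hs = ereal q" using fin by (cases gs; cases hs) auto
    obtain l where l: "L = ereal l" using upper lower unfolding pq by (cases L) auto
    show ?thesis using upper lower unfolding pq l by (intro exI[of _ "l - p - q"]) auto
  qed
  thus ?thesis unfolding L_def gs_def hs_def .
qed

theorem theorem2:
  fixes P :: "'a measure"
    and kind :: "'q::finite \<Rightarrow> regressor"
    and z uw w :: "int \<Rightarrow> 'a \<Rightarrow> real^'q"
    and \<eta> :: "int \<Rightarrow> 'a \<Rightarrow> real^'n::finite"
    and x :: "nat \<Rightarrow> int \<Rightarrow> 'a \<Rightarrow> real^'q"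
    and u y :: "nat \<Rightarrow> int \<Rightarrow> 'a \<Rightarrow> real^'n"
    and S :: "real^'p::finite^('q \<times> 'n)"
    and G m :: nat
    and grp :: "nat \<Rightarrow> 'p set"
    and K0 :: "nat \<Rightarrow> dates"
    and \<theta>0 :: "nat \<Rightarrow> ('p, 'n) param"
    and R :: "('p, 'n) param \<Rightarrow> real^'r::finite"
    and \<gamma> :: "nat \<Rightarrow> 'a \<Rightarrow> real^'r"
    and lam0 :: "nat \<Rightarrow> nat \<Rightarrow> real"
    and \<delta> :: "nat \<Rightarrow> nat \<Rightarrow> real^'p"
    and \<Phi> :: "nat \<Rightarrow> real^'n^'n"
    and v :: "nat \<Rightarrow> real"
    and \<nu> c1 c2 c3 M :: real
  assumes prob: "prob_space P"
    \<comment> \<open>regressors\<close>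
    and rv: "\<And>t. z t \<in> borel_measurable P" "\<And>t. uw t \<in> borel_measurable P"
      "\<And>t. \<eta> t \<in> borel_measurable P"
    and layout: "trend_layout kind"
    and blocks: "\<And>t \<omega>. \<omega> \<in> space P \<Longrightarrow> in_block kind Stationary (z t \<omega>)"
      "\<And>t \<omega>. \<omega> \<in> space P \<Longrightarrow> in_block kind Integrated (uw t \<omega>)"
      "\<And>\<omega>. \<omega> \<in> space P \<Longrightarrow> in_block kind Integrated (w 0 \<omega>)"
    and z: "stationary_type P z"
    and uw: "integrated_increments P uw"
    and w: "\<And>t \<omega>. 1 \<le> t \<Longrightarrow> \<omega> \<in> space P \<Longrightarrow> w t \<omega> = w (t - 1) \<omega> + uw t \<omega>"
    and x: "\<And>T t \<omega>. t \<in> {1..int T} \<Longrightarrow> \<omega> \<in> space P \<Longrightarrow>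
      x T t \<omega> = z t \<omega> + trend kind (of_int t / real T) + real T powr (- (1 / 2)) *\<^sub>R w t \<omega>"
    and S: "selection_matrix S"
    \<comment> \<open>model\<close>
    and m: "1 \<le> m"
    and grp: "coeff_groups G grp"
    and y: "\<And>T t \<omega>. t \<in> {1..int T} \<Longrightarrow> \<omega> \<in> space P \<Longrightarrow>
      y T t \<omega> = transpose (Xmat S (x T t \<omega>)) *v beta_at G m grp (K0 T) (\<theta>0 T) t + u T t \<omega>"
    and u_mean: "\<And>T t. t \<in> {1..int T} \<Longrightarrow> has_bochner_integral P (u T t) 0"
    and u_cov: "\<And>T t. t \<in> {1..int T} \<Longrightarrow>
      has_bochner_integral P (\<lambda>\<omega>. outer (u T t \<omega>) (u T t \<omega>)) (Sigma_at G m (K0 T) (\<theta>0 T) t)"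
    and \<eta>: "\<And>T t \<omega>. t \<in> {1..int T} \<Longrightarrow> \<omega> \<in> space P \<Longrightarrow>
      \<eta> t \<omega> = inv_sqrt (Sigma_at G m (K0 T) (\<theta>0 T) t) *v u T t \<omega>"
    and R: "\<And>T. R (\<theta>0 T) = 0"
    and genuine: "\<And>g j. g \<in> {1..<G} \<Longrightarrow> j \<in> {1..m} \<Longrightarrow> \<delta> g j \<noteq> 0"
      "\<And>j. j \<in> {1..m} \<Longrightarrow> (\<delta> G j, \<Phi> j) \<noteq> (0, 0)"
    and \<nu>: "\<nu> > 0"
    \<comment> \<open>Assumption A1\<close>
    and A1: "eigenvalue_condition P x"
    \<comment> \<open>Assumption A2\<close>
    and A2: "mixing_condition P kind z uw (w 0) \<eta>"
    \<comment> \<open>Assumption A3\<close>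
    and A3: "\<And>T. K0 T \<in> date_space G m T"
      "\<forall>\<^sub>F T in sequentially. K0 T \<in> trimmed_dates G m \<nu> T"
      "\<And>T g j. g \<in> {1..G} \<Longrightarrow> j \<in> {1..m} \<Longrightarrow> K0 T g j = \<lfloor>real T * lam0 g j\<rfloor>"
      "\<And>g. g \<in> {1..G} \<Longrightarrow> 0 < lam0 g 1 \<and> strict_mono_on {1..m} (lam0 g) \<and> lam0 g m < 1"
    \<comment> \<open>Assumption A4\<close>
    and A4: "\<And>T g j. g \<in> {1..G} \<Longrightarrow> j \<in> {1..m} \<Longrightarrow>
        beta_grp grp (\<theta>0 T) g (j + 1) - beta_grp grp (\<theta>0 T) g j = v T *\<^sub>R \<delta> g j"
      "\<And>T j. j \<in> {1..m} \<Longrightarrow> snd (\<theta>0 T (j + 1)) - snd (\<theta>0 T j) = v T *\<^sub>R \<Phi> j"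
      "\<And>T. v T > 0" "v \<longlonglongrightarrow> 0"
      "filterlim (\<lambda>T. sqrt (real T) * v T / ln (real T)) at_top sequentially"
    \<comment> \<open>Assumption A5\<close>
    and A5: "0 < c2" "c2 \<le> c3" "\<And>T. \<theta>0 T \<in> param_space m c1 c2 c3"
    and M: "M > 0"
  shows "\<exists>rem. o_p1 P rem \<and> (\<forall>\<^sub>F T in sequentially. \<forall>\<omega>\<in>space P.
    (SUP (K, \<theta>)\<in>dates_nbhd G m \<nu> T (K0 T) (v T) M \<times> param_nbhd G m grp c1 c2 c3 T (\<theta>0 T) M.
       ereal (log_lik_ratio_R G m grp S T (\<lambda>t. x T t \<omega>) (\<lambda>t. y T t \<omega>) (K0 T) (\<theta>0 T) R (\<gamma> T \<omega>) K \<theta>)) =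
    (SUP K\<in>dates_nbhd G m \<nu> T (K0 T) (v T) M.
       ereal (log_lik_ratio G m grp S T (\<lambda>t. x T t \<omega>) (\<lambda>t. y T t \<omega>) (K0 T) (\<theta>0 T) K (\<theta>0 T))) +
    (SUP \<theta>\<in>param_nbhd G m grp c1 c2 c3 T (\<theta>0 T) M.
       ereal (log_lik_ratio_R G m grp S T (\<lambda>t. x T t \<omega>) (\<lambda>t. y T t \<omega>) (K0 T) (\<theta>0 T) R (\<gamma> T \<omega>) (K0 T) \<theta>)) +
    ereal (rem T \<omega>))"
proof -
  interpret prob_space P by (rule prob)
  obtain k where k: "\<And>T. 2 * \<lceil>M * v T powr (- 2)\<rceil> + 1 \<le> 2 ^ k T"
    "(\<lambda>T. (real (k T + 1))\<^sup>2 * 2 ^ k T / real T) \<longlonglongrightarrow> 0"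
    "(\<lambda>T. (v T * root_inv T + (root_inv T)\<^sup>2) * 2 ^ k T) \<longlonglongrightarrow> 0"
    by (fact window_rate[OF A4(3,4,5) M])
  define N where "N T = \<lceil>M * v T powr (- 2)\<rceil>" for T
  have N0: "0 \<le> N T" for T 
  proof -
    have "0 \<le> M * v T powr (- 2)" using M by simp
    thus ?thesis unfolding N_def by linarith
  qed
  have G: "1 \<le> G" using grp by (simp add: coeff_groups_def)
  hence GG: "G \<in> {1..G}" by simp
  have pd: "pd_within c2 c3 (Sigma_at G m (K0 T) (\<theta>0 T) t)" 
    if "K0 T \<in> trimmed_dates G m \<nu> T" "1 \<le> T" "t \<in> {1..int T}" for T t
    unfolding Sigma_at_def by (intro param_space_pd_within[OF A5(3)] regime(1)[OF that(1) \<nu> that(2) GG that(3)])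

  \<comment> \<open>The standardized errors do not depend on T, so for each t a sample size T >= t
    with trimmed true dates may be picked; there the covariance V of u gives C V C' = I.\<close>
  have eta_cov: "(LINT \<omega>|P. (outer (\<eta> t \<omega>) (\<eta> t \<omega>) - mat 1) $ i $ j) = 0" if t: "1 \<le> t" for t i j
  proof -
    have "\<forall>\<^sub>F T in sequentially. nat t \<le> T \<and> K0 T \<in> trimmed_dates G m \<nu> T"
      using A3(2) eventually_ge_at_top[of "nat t"] by eventually_elim simp
    then obtain T where T: "nat t \<le> T" "K0 T \<in> trimmed_dates G m \<nu> T" by (auto simp: eventually_sequentially)
    have tT: "t \<in> {1..int T}" "1 \<le> T" using T t by auto
    define V C where "V = Sigma_at G m (K0 T) (\<theta>0 T) t" and "C = inv_sqrt V"
    note C = pd_within_sqrt[OF pd[OF T(2) tT(2,1), folded V_def] A5(1), folded C_def]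
    have out: "outer (\<eta> t \<omega>) (\<eta> t \<omega>) = C ** outer (u T t \<omega>) (u T t \<omega>) ** transpose C" if "\<omega> \<in> space P" for \<omega>
      unfolding \<eta>[OF tT(1) that] V_def[symmetric] C_def[symmetric]
      by (simp add: outer_def vec_eq_iff matrix_matrix_mult_def matrix_vector_mult_def transpose_def sum_product sum_distrib_left sum_distrib_right mult_ac)
    have lin: "bounded_linear (\<lambda>A. C ** A ** transpose C)"
      by (intro linear_conv_bounded_linear[THEN iffD1] linearI)
         (simp_all add: matrix_add_ldistrib vec_eq_iff matrix_matrix_mult_def sum_distrib_left sum_distrib_right distrib_right distrib_left sum.distrib mult_ac)
    have "has_bochner_integral P (\<lambda>\<omega>. C ** outer (u T t \<omega>) (u T t \<omega>) ** transpose C) (C ** V ** transpose C)"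
      unfolding V_def by (rule has_bochner_integral_bounded_linear[OF lin u_cov[OF tT(1)]])
    moreover have "C ** V ** transpose C = mat 1"
      by (metis C(2,3,4,5) matrix_mul_assoc matrix_mul_lid)
    ultimately have hbi: "has_bochner_integral P (\<lambda>\<omega>. outer (\<eta> t \<omega>) (\<eta> t \<omega>)) (mat 1)"
      using out by (subst has_bochner_integral_cong[OF refl _ refl]) auto
    note hbi' = has_bochner_integral_bounded_linear[OF bounded_linear_vec_nth 
        has_bochner_integral_bounded_linear[OF bounded_linear_vec_nth hbi, of i], of j]
    hence "integrable P (\<lambda>\<omega>. outer (\<eta> t \<omega>) (\<eta> t \<omega>) $ i $ j)" "(LINT \<omega>|P. outer (\<eta> t \<omega>) (\<eta> t \<omega>) $ i $ j) = mat 1 $ i $ j"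
      by (auto simp: has_bochner_integral_iff)
    thus ?thesis by (simp add: prob_space)
  qed

  define good where "good g j D \<longleftrightarrow> o_p1 P D \<and> (\<forall>T\<ge>1. \<forall>\<omega>\<in>space P. \<forall>c d. {c..d} \<subseteq> {1..int T} \<inter> {K0 T g j - N T..K0 T g j + N T} \<longrightarrow>
      fluctuation (root_inv T) (v T) (\<lambda>t. x T t \<omega>) (\<lambda>t. \<eta> t \<omega>) {c..d} \<le> D T \<omega>)" for g j D
  have "\<exists>D. good g j D" if gj: "g \<in> {1..G}" "j \<in> {1..m}" for g j
  proof -
    \<comment> \<open>Clamping at 0 loses no date of the sample.\<close>
    define a where "a T = max 0 (K0 T g j - N T)" for T
    interpret regressor_windows P k a v kind z uw w \<eta> x
    proof unfold_locales
      show "\<forall>\<^sub>F T in sequentially. a T \<le> int T"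
        using A3(2) eventually_ge_at_top[of "1 :: nat"]
      proof eventually_elim
        case (elim T)
        have "K0 T g j \<le> int T"
          using trimmed_dates_increasing(4)[OF elim(1) \<nu> elim(2) gj(1), of j "m + 1"] 
            trimmed_dates_increasing(2)[OF elim(1) \<nu> elim(2) gj(1)] gj(2) by simp
        thus ?case using N0[of T] by (simp add: a_def)
      qed
    qed (use k(2,3) A4(3) rv blocks z uw w x A2 eta_cov in \<open>auto simp: a_def\<close>)
    obtain D where D: "o_p1 P D" 
      "\<And>T \<omega> c d. 1 \<le> T \<Longrightarrow> \<omega> \<in> space P \<Longrightarrow> {c..d} \<subseteq> window T \<Longrightarrow>
      fluctuation (root_inv T) (v T) (\<lambda>t. x T t \<omega>) (\<lambda>t. \<eta> t \<omega>) {c..d} \<le> D T \<omega>"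
      by (fact window_bound)
    \<comment> \<open>The neighbourhood of the break has 2 N + 1 dates, which 2^k covers.\<close>
    have sub: "{1..int T} \<inter> {K0 T g j - N T..K0 T g j + N T} \<subseteq> window T" for T
      using k(1)[of T] unfolding N_def[symmetric] by (auto simp: a_def max_def)
    have "good g j D" unfolding good_def
    proof (intro conjI allI impI ballI)
      show "o_p1 P D" by (rule D(1))
    qed (rule D(2); use sub in blast)
    thus ?thesis by (rule exI[of "good g j" D])
  qed
  then obtain E where E: "\<And>g j. g \<in> {1..G} \<Longrightarrow> j \<in> {1..m} \<Longrightarrow> good g j (E g j)" by metis

  define es where "es g = (\<Sum>j\<in>{1..m}. norm (\<delta> g j))" for g
  define ps where "ps = (\<Sum>j\<in>{1..m}. norm (\<Phi> j))"
  define n where "n = real CARD('n)"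
  \<comment> \<open>The sum of 1 and all constants that occur: C then dominates each of them, and
    its powers may be enlarged.\<close>
  define C where "C = 1 + n / c2 + n * c3 + n\<^sup>2 * M + ps + norm S * (real G * M) + norm S * (\<Sum>g\<in>{1..G}. es g)"
  have nn: "0 \<le> n / c2" "0 \<le> n * c3" "0 \<le> n\<^sup>2 * M" "0 \<le> ps" "0 \<le> norm S * (real G * M)" "0 \<le> norm S * (\<Sum>g\<in>{1..G}. es g)"
    using A5(1,2) M by (auto simp: n_def ps_def es_def intro!: sum_nonneg mult_nonneg_nonneg)
  have C: "1 \<le> C" "n / c2 \<le> C" "n * c3 \<le> C" "n\<^sup>2 * M \<le> C" "ps \<le> C" "norm S * (real G * M) \<le> C" "norm S * (\<Sum>g\<in>{1..G}. es g) \<le> C"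
    using nn unfolding C_def by linarith+
  have "C ^ 1 \<le> C\<^sup>2" using C(1) by (intro power_increasing) auto
  hence CC: "n * c3 \<le> C\<^sup>2" using C(3) by simp
  define Z where "Z T \<omega> = real (card (({1..G} \<rightarrow>\<^sub>E {1..m + 1}) \<times> ({1..G} \<rightarrow>\<^sub>E {1..m + 1}))) 
      * (4 * C ^ 5 * (\<Sum>g\<in>{1..G}. \<Sum>j\<in>{1..m}. \<bar>E g j T \<omega>\<bar>))" for T \<omega>
  have oE: "o_p1 P (\<lambda>T \<omega>. \<bar>E g j T \<omega>\<bar>)" if "g \<in> {1..G}" "j \<in> {1..m}" for g j
    by (rule o_p1_dominated[OF prob conjunct1[OF E[OF that, unfolded good_def]]]) simp
  have oZ: "o_p1 P Z" unfolding Z_def[abs_def] by (intro o_p1_cmult o_p1_sum prob oE)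

  define Lf where "Lf T \<omega> = log_lik_ratio G m grp S T (\<lambda>t. x T t \<omega>) (\<lambda>t. y T t \<omega>) (K0 T) (\<theta>0 T)" for T \<omega>
  define Kn where "Kn T = dates_nbhd G m \<nu> T (K0 T) (v T) M" for T
  define Pn where "Pn T = param_nbhd G m grp c1 c2 c3 T (\<theta>0 T) M" for T
  define eqn where "eqn T \<omega> r \<longleftrightarrow> 
    (SUP (K, \<theta>)\<in>Kn T \<times> Pn T. ereal (log_lik_ratio_R G m grp S T (\<lambda>t. x T t \<omega>) (\<lambda>t. y T t \<omega>) (K0 T) (\<theta>0 T) R (\<gamma> T \<omega>) K \<theta>)) =
    (SUP K\<in>Kn T. ereal (log_lik_ratio G m grp S T (\<lambda>t. x T t \<omega>) (\<lambda>t. y T t \<omega>) (K0 T) (\<theta>0 T) K (\<theta>0 T))) +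
    (SUP \<theta>\<in>Pn T. ereal (log_lik_ratio_R G m grp S T (\<lambda>t. x T t \<omega>) (\<lambda>t. y T t \<omega>) (K0 T) (\<theta>0 T) R (\<gamma> T \<omega>) (K0 T) \<theta>)) +
    ereal r" for T \<omega> r
  have main: "\<exists>r. \<bar>r\<bar> \<le> Z T \<omega> \<and> eqn T \<omega> r"
    if T: "1 \<le> T" "K0 T \<in> trimmed_dates G m \<nu> T" "v T \<le> 1" and \<omega>: "\<omega> \<in> space P" for T \<omega>
  proof -
    have v0: "0 \<le> v T" using A4(3)[of T] by simp
    \<comment> \<open>The true values lie in both neighbourhoods, so no supremum is taken over an
      empty set.\<close>
    have "K0 T \<in> Kn T" using T(2) M v0 by (auto simp: Kn_def dates_nbhd_def)
    hence ne: "Kn T \<noteq> {}" by blast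
    have "op_norm (0 :: real^'n^'n) = 0" by (simp add: op_norm_def onorm_zero)
    hence "\<theta>0 T \<in> Pn T" using A5(3) M by (auto simp: Pn_def param_nbhd_def)
    hence ne': "Pn T \<noteq> {}" by blast
    have sep: "\<bar>Lf T \<omega> K \<theta> - Lf T \<omega> K (\<theta>0 T) - Lf T \<omega> (K0 T) \<theta>\<bar> \<le> Z T \<omega>" if K: "K \<in> Kn T" and \<theta>: "\<theta> \<in> Pn T" for K \<theta>
      unfolding Lf_def Z_def
    proof (rule likelihood_separation[where \<nu> = \<nu> and N = "N T" and \<tau> = "root_inv T" and v = "v T" and M = M and e = es and ?c3.0 = c3
        and ?c2.0 = c2 and ?c1.0 = c1 and \<eta> = "\<lambda>t. \<eta> t \<omega>"])
      show "K \<in> trimmed_dates G m \<nu> T" using K by (simp add: Kn_def dates_nbhd_def)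
      show "\<theta> \<in> param_space m c1 c2 c3" using \<theta> by (simp add: Pn_def param_nbhd_def)
      show "\<bar>K g j - K0 T g j\<bar> \<le> N T" if "g \<in> {1..G}" "j \<in> {1..m}" for g j
      proof -
        have "real_of_int \<bar>K g j - K0 T g j\<bar> \<le> M * v T powr (- 2)" using K that by (simp add: Kn_def dates_nbhd_def)
        thus ?thesis unfolding N_def by linarith
      qed
      show "y T t \<omega> = transpose (Xmat S (x T t \<omega>)) *v beta_at G m grp (K0 T) (\<theta>0 T) t + mat_sqrt (Sigma_at G m (K0 T) (\<theta>0 T) t) *v \<eta> t \<omega>"
        if t: "t \<in> {1..int T}" for t
        unfolding y[OF t \<omega>] \<eta>[OF t \<omega>]
        by (simp add: matrix_vector_mul_assoc pd_within_sqrt(4)[OF pd[OF T(2,1) t] A5(1)])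
      show "norm (beta_grp grp \<theta> g j - beta_grp grp (\<theta>0 T) g j) \<le> M * root_inv T" if "g \<in> {1..G}" "j \<in> {1..m + 1}" for g j
        using \<theta> that by (simp add: Pn_def param_nbhd_def)
      show "norm (snd (\<theta> j) - snd (\<theta>0 T j)) \<le> C * root_inv T" if "j \<in> {1..m + 1}" for j
      proof -
        have "op_norm (snd (\<theta> j) - snd (\<theta>0 T j)) \<le> M * root_inv T" using \<theta> that by (simp add: Pn_def param_nbhd_def)
        hence "n\<^sup>2 * op_norm (snd (\<theta> j) - snd (\<theta>0 T j)) \<le> n\<^sup>2 * (M * root_inv T)" by (intro mult_left_mono) auto
        also have "\<dots> \<le> C * root_inv T" using C(4) by (simp add: mult.assoc[symmetric] mult_right_mono)
        finally show ?thesis using norm_le_op_norm[of "snd (\<theta> j) - snd (\<theta>0 T j)"] by (simp add: n_def)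
      qed
      show "norm (beta_grp grp (\<theta>0 T) g r - beta_grp grp (\<theta>0 T) g s) \<le> es g * v T"
        if "g \<in> {1..G}" "r \<in> {1..m + 1}" "s \<in> {1..m + 1}" for g r s
      proof -
        have "norm (beta_grp grp (\<theta>0 T) g r - beta_grp grp (\<theta>0 T) g s) \<le> (\<Sum>j\<in>{1..m}. norm (\<delta> g j) * v T)"
          by (rule telescope_le[OF _ that(2,3)]) (use A4(1)[OF that(1)] v0 in simp)
        thus ?thesis by (simp add: es_def sum_distrib_right)
      qed
      show "norm (snd (\<theta>0 T r) - snd (\<theta>0 T s)) \<le> C * v T" if "r \<in> {1..m + 1}" "s \<in> {1..m + 1}" for r s
      proof -
        have "norm (snd (\<theta>0 T r) - snd (\<theta>0 T s)) \<le> (\<Sum>j\<in>{1..m}. norm (\<Phi> j) * v T)"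
          by (rule telescope_le[of m "\<lambda>j. snd (\<theta>0 T j)", OF _ that]) (use A4(2) v0 in simp)
        also have "\<dots> = ps * v T" by (simp add: ps_def sum_distrib_right)
        also have "\<dots> \<le> C * v T" using C(5) v0 by (rule mult_right_mono)
        finally show ?thesis .
      qed
      show "fluctuation (root_inv T) (v T) (\<lambda>t. x T t \<omega>) (\<lambda>t. \<eta> t \<omega>) {c..d} \<le> \<bar>E g j T \<omega>\<bar>"
        if gj: "g \<in> {1..G}" "j \<in> {1..m}" and cd: "{c..d} \<subseteq> {1..int T} \<inter> {K0 T g j - N T..K0 T g j + N T}" for g j c d
        using conjunct2[OF E[OF gj, unfolded good_def], rule_format, OF T(1) \<omega> cd] by (rule order_trans) simp
    qed (use \<nu> T G A5 C CC v0 in \<open>simp_all add: n_def\<close>)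
    have R': "log_lik_ratio_R G m grp S T (\<lambda>t. x T t \<omega>) (\<lambda>t. y T t \<omega>) (K0 T) (\<theta>0 T) R (\<gamma> T \<omega>) K \<theta> = Lf T \<omega> K \<theta> + \<gamma> T \<omega> \<bullet> R \<theta>" for K \<theta>
      by (simp add: log_lik_ratio_R_def Lf_def)
    \<comment> \<open>The multiplier term depends on \<theta> alone, so it cancels in the cross
      difference whatever the multiplier is.\<close>
    have "\<bar>(Lf T \<omega> K \<theta> + \<gamma> T \<omega> \<bullet> R \<theta>) - Lf T \<omega> K (\<theta>0 T) - (Lf T \<omega> (K0 T) \<theta> + \<gamma> T \<omega> \<bullet> R \<theta>)\<bar> \<le> Z T \<omega>"
      if "K \<in> Kn T" "\<theta> \<in> Pn T" for K \<theta> using sep[OF that] by simp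
    from SUP_add_remainder[where A = "Kn T" and B = "Pn T" and f = "\<lambda>K \<theta>. Lf T \<omega> K \<theta> + \<gamma> T \<omega> \<bullet> R \<theta>"
        and g = "\<lambda>K. Lf T \<omega> K (\<theta>0 T)" and h = "\<lambda>\<theta>. Lf T \<omega> (K0 T) \<theta> + \<gamma> T \<omega> \<bullet> R \<theta>", OF ne ne' this]
    show ?thesis unfolding eqn_def R' unfolding Lf_def .
  qed
  \<comment> \<open>Chosen outcome by outcome, so possibly nonmeasurable; domination by Z suffices
    because \<open>o_p1\<close> is in terms of outer probability.\<close>
  define rem where "rem T \<omega> = (SOME r. \<bar>r\<bar> \<le> Z T \<omega> \<and> eqn T \<omega> r)" for T \<omega>
  have "\<forall>\<^sub>F T in sequentially. v T < 1" by (rule order_tendstoD(2)[OF A4(4)]) simp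
  with A3(2) eventually_ge_at_top[of "1 :: nat"]
  have ev: "\<forall>\<^sub>F T in sequentially. \<forall>\<omega>\<in>space P. \<bar>rem T \<omega>\<bar> \<le> Z T \<omega> \<and> eqn T \<omega> (rem T \<omega>)"
  proof eventually_elim
    case (elim T)
    show ?case unfolding rem_def
    proof
      fix \<omega> assume "\<omega> \<in> space P"
      show "\<bar>SOME r. \<bar>r\<bar> \<le> Z T \<omega> \<and> eqn T \<omega> r\<bar> \<le> Z T \<omega> \<and> eqn T \<omega> (SOME r. \<bar>r\<bar> \<le> Z T \<omega> \<and> eqn T \<omega> r)"
        by (rule someI_ex[OF main]) (use elim \<open>\<omega> \<in> space P\<close> in auto)
    qed
  qed
  have "o_p1 P rem"
  proof (rule o_p1_dominated[OF prob oZ])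
    show "\<forall>\<^sub>F T in sequentially. \<forall>\<omega>\<in>space P. \<bar>rem T \<omega>\<bar> \<le> \<bar>Z T \<omega>\<bar>"
      using ev by eventually_elim (meson abs_ge_self order_trans)
  qed
  moreover have "\<forall>\<^sub>F T in sequentially. \<forall>\<omega>\<in>space P. eqn T \<omega> (rem T \<omega>)"
    using ev by eventually_elim blast
  ultimately show ?thesis unfolding eqn_def Kn_def Pn_def by blast
qed

end
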